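(* Let $X$ be a finite simplicial complex with a subcomplex $X_0$ and a base vertex $x_0\in X_0$. Choose a PL-embedding of $X$ into some $\mathbb{R}^N$, identify $X$ with its image, and let $i_0\colon[0,\infty)\to c(X)$, $t\mapsto(tx_0,t)$. Then for every $n\ge1$ the map $$\Psi\colon\pi_n(X,X_0,x_0)\to\pi_n^{\mathrm{coarse}}(c(X),c(X_0),i_0),\qquad \Psi([u])=[c(u)]$$ for $u$ a Lipschitz representative, is an isomorphism (of groups for $n\ge2$, of pointed sets for $n=1$).
   Context: Coarse notions. All spaces here are metric spaces with the bounded coarse structure, so: a subset is bounded if it has finite diameter; a map $f\colon X\to Y$ is controlled if for every $R>0$ there is $S>0$ such that $d(x,y)<R$ implies $d(f(x),f(y))<S$; it is coarse if it is controlled and inverse images of bounded sets are bounded. $\mathbb{R}_+=[0,\infty)$ has the usual metric. For a coarse map $q\colon Z\to\mathbb{R}_+$ the $q$-cylinder is $I_qZ=\{(z,t)\in Z\times\mathbb{R}_+: t\le q(z)+1\}$ (subspace of the product). A coarse homotopy between coarse maps $f_0,f_1\colon Z\to W$ is a coarse map $H\colon I_qZ\to W$, for some coarse $q\colon Z\to\mathbb{R}_+$, with $H(z,0)=f_0(z)$ and $H(z,q(z)+1)=f_1(z)$. Cones. For $Y\subset\mathbb{R}^N$, the metric cone (with flat base) is $c(Y)=\{(hy,h): h\ge0,\ y\in Y\}\subset\mathbb{R}^N\times\mathbb{R}$ with the induced metric. A map $u\colon Y\to Y'$ induces the radial map $c(u)\colon c(Y)\to c(Y')$, $(hy,h)\mapsto(hu(y),h)$.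 Radial maps of Lipschitz maps between bounded sets are coarse. Relative coarse homotopy groups. Let $\partial_+[0,1]^n=\{(x_1,\dots,x_n)\in\partial[0,1]^n: x_n>0\}$, and let $p\colon c([0,1]^n)\to\mathbb{R}_+$, $(hx,h)\mapsto h$, be the height. Then $\pi_n^{\mathrm{coarse}}(c(X),c(X_0),i_0)$ is the set of classes of coarse maps $F\colon c([0,1]^n)\to c(X)$ with $F(c(\partial[0,1]^n))\subset c(X_0)$ and $F|_{c(\partial_+[0,1]^n)}=i_0\circ p$, modulo coarse homotopies $H\colon I_qc([0,1]^n)\to c(X)$ such that $H(z,t)\in c(X_0)$ for $z\in c(\partial[0,1]^n)$ and $H(z,t)=i_0(p(z))$ for $z\in c(\partial_+[0,1]^n)$, for all admissible $t$. Writing points of $c([0,1]^n)$ as $(x_1,\dots,x_n,h)$ with $0\le x_i\le h$, for $n\ge2$ the group structure is $[F]\cdot[G]=[F*G]$ with $F*G(x_1,\dots,x_n,h)=F(2x_1,x_2,\dots,x_n,h)$ for $x_1\le h/2$ and $G(2x_1-h,x_2,\dots,x_n,h)$ for $h/2<x_1\le h$. The classical relative homotopy group (pointed set for $n=1$) $\pi_n(X,X_0,x_0)$ consists of homotopy classes of continuous maps $u\colon([0,1]^n,\partial[0,1]^n,\partial_+[0,1]^n)\to(X,X_0,x_0)$ through such maps. Every class contains a Lipschitz representative, two homotopic Lipschitz representatives are Lipschitz homotopic through such maps, and $\Psi$ is defined by choosing a Lipschitz representative. *)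

theory Defs
  imports "HOL-Analysis.Analysis" "HOL-Algebra.Group"
begin

section \<open>Coarse maps and coarse homotopies\<close>

definition controlled_on :: "'a::metric_space set \<Rightarrow> ('a \<Rightarrow> 'b::metric_space) \<Rightarrow> bool" where
  "controlled_on A f \<longleftrightarrow>
     (\<forall>R>0. \<exists>S>0. \<forall>x\<in>A. \<forall>y\<in>A. dist x y < R \<longrightarrow> dist (f x) (f y) < S)"

definition coarse_map :: "'a::metric_space set \<Rightarrow> 'b::metric_space set \<Rightarrow> ('a \<Rightarrow> 'b) \<Rightarrow> bool" where
  "coarse_map A B f \<longleftrightarrow>
     f ` A \<subseteq> B \<and> controlled_on A f \<and>
     (\<forall>D\<subseteq>B. bounded D \<longrightarrow> bounded {x \<in> A. f x \<in> D})"

definition q_cylinder :: "('a \<Rightarrow> real) \<Rightarrow> 'a set \<Rightarrow> ('a \<times> real) set" where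
  "q_cylinder q Z = {(z, t). z \<in> Z \<and> 0 \<le> t \<and> t \<le> q z + 1}"

definition coarse_homotopy ::
    "'a::metric_space set \<Rightarrow> 'b::metric_space set \<Rightarrow> ('a \<Rightarrow> real) \<Rightarrow> ('a \<times> real \<Rightarrow> 'b) \<Rightarrow>
     ('a \<Rightarrow> 'b) \<Rightarrow> ('a \<Rightarrow> 'b) \<Rightarrow> bool" where
  "coarse_homotopy Z W q H f g \<longleftrightarrow>
     coarse_map Z {0..} q \<and> coarse_map (q_cylinder q Z) W H \<and>
     (\<forall>z\<in>Z. H (z, 0) = f z \<and> H (z, q z + 1) = g z)"


section \<open>Metric cones\<close>

definition metric_cone :: "'a::euclidean_space set \<Rightarrow> ('a \<times> real) set" where
  "metric_cone Y = {(h *\<^sub>R y, h) | h y. 0 \<le> h \<and> y \<in> Y}"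

text \<open>The formula sends \<open>(h y, h)\<close> to \<open>(h u(y), h)\<close>; at height \<open>0\<close> it sends the apex to the
  apex, whatever the value of \<open>u 0\<close>.\<close>

definition radial_map ::
    "('a::euclidean_space \<Rightarrow> 'b::euclidean_space) \<Rightarrow> 'a \<times> real \<Rightarrow> 'b \<times> real" where
  "radial_map u = (\<lambda>(z, h). (h *\<^sub>R u (z /\<^sub>R h), h))"

definition cone_ray :: "'a::euclidean_space \<Rightarrow> real \<Rightarrow> 'a \<times> real" where
  "cone_ray x t = (t *\<^sub>R x, t)"


section \<open>The cube\<close>

text \<open>The cube \<open>[0,1]^n\<close> lives in \<open>real ^ 'n\<close> with \<open>n = CARD('n)\<close>. The linear order on the index
  type identifies it with \<open>1 < \<dots> < n\<close>, so the first and the last coordinate are those at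
  the least and the greatest index.\<close>

abbreviation first_index :: "'n::{finite,linorder}" where
  "first_index \<equiv> Min UNIV"

abbreviation last_index :: "'n::{finite,linorder}" where
  "last_index \<equiv> Max UNIV"

abbreviation unit_cube :: "(real ^ 'n::{finite,linorder}) set" where
  "unit_cube \<equiv> cbox 0 1"

definition boundary_plus :: "(real ^ 'n::{finite,linorder}) set" where
  "boundary_plus = {x \<in> frontier unit_cube. 0 < x $ last_index}"


section \<open>Classical relative homotopy groups\<close>

definition is_rel_map ::
    "'b set \<Rightarrow> 'b \<Rightarrow> (real ^ 'n::{finite,linorder} \<Rightarrow> 'b) \<Rightarrow> bool" where
  "is_rel_map X0 x0 u \<longleftrightarrow> u ` frontier unit_cube \<subseteq> X0 \<and> u ` boundary_plus \<subseteq> {x0}"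

definition rel_maps ::
    "'b::euclidean_space set \<Rightarrow> 'b set \<Rightarrow> 'b \<Rightarrow> (real ^ 'n::{finite,linorder} \<Rightarrow> 'b) set" where
  "rel_maps X X0 x0 =
     {u. continuous_on unit_cube u \<and> u ` unit_cube \<subseteq> X \<and> is_rel_map X0 x0 u}"

text \<open>Maps are total functions, of which only the values on the cube (below: on its cone) matter:
  functions that agree there are homotopic, hence represent the same class.\<close>

definition rel_homotopy ::
    "'b::euclidean_space set \<Rightarrow> 'b set \<Rightarrow> 'b \<Rightarrow>
     ((real ^ 'n::{finite,linorder} \<Rightarrow> 'b) \<times> (real ^ 'n::{finite,linorder} \<Rightarrow> 'b)) set" where
  "rel_homotopy X X0 x0 =
     {(u, v). u \<in> rel_maps X X0 x0 \<and> v \<in> rel_maps X X0 x0 \<and>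
        homotopic_with (is_rel_map X0 x0) (top_of_set unit_cube) (top_of_set X) u v}"

definition rel_concat ::
    "(real ^ 'n::{finite,linorder} \<Rightarrow> 'b) \<Rightarrow> (real ^ 'n::{finite,linorder} \<Rightarrow> 'b) \<Rightarrow>
     real ^ 'n::{finite,linorder} \<Rightarrow> 'b" where
  "rel_concat u v = (\<lambda>x.
     if x $ first_index \<le> 1 / 2
     then u (\<chi> i. if i = first_index then 2 * x $ i else x $ i)
     else v (\<chi> i. if i = first_index then 2 * x $ i - 1 else x $ i))"

text \<open>The multiplication has its meaning only for \<open>n \<ge> 2\<close>. For \<open>n = 1\<close> only the
  carrier and the base point \<open>one\<close> of this record (and of the coarse one below) are used.\<close>

definition rel_homotopy_group ::
    "'b::euclidean_space set \<Rightarrow> 'b set \<Rightarrow> 'b \<Rightarrow> (real ^ 'n::{finite,linorder} \<Rightarrow> 'b) set monoid" where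
  "rel_homotopy_group X X0 x0 =
     \<lparr> carrier = rel_maps X X0 x0 // rel_homotopy X X0 x0,
       mult = (\<lambda>U V. \<Union>u\<in>U. \<Union>v\<in>V. rel_homotopy X X0 x0 `` {rel_concat u v}),
       one = rel_homotopy X X0 x0 `` {\<lambda>x. x0} \<rparr>"


section \<open>Coarse relative homotopy groups\<close>

text \<open>The height \<open>p\<close> on the cone over the cube is \<open>snd\<close>.\<close>

definition coarse_rel_maps ::
    "'w::metric_space set \<Rightarrow> 'w set \<Rightarrow> (real \<Rightarrow> 'w) \<Rightarrow>
     ((real ^ 'n::{finite,linorder}) \<times> real \<Rightarrow> 'w) set" where
  "coarse_rel_maps W W0 i0 =
     {F. coarse_map (metric_cone unit_cube) W F \<and>
         F ` metric_cone (frontier unit_cube) \<subseteq> W0 \<and>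
         (\<forall>z\<in>metric_cone boundary_plus. F z = i0 (snd z))}"

definition coarse_rel_homotopy ::
    "'w::metric_space set \<Rightarrow> 'w set \<Rightarrow> (real \<Rightarrow> 'w) \<Rightarrow>
     (((real ^ 'n::{finite,linorder}) \<times> real \<Rightarrow> 'w) \<times>
      ((real ^ 'n::{finite,linorder}) \<times> real \<Rightarrow> 'w)) set" where
  "coarse_rel_homotopy W W0 i0 =
     {(F, G). F \<in> coarse_rel_maps W W0 i0 \<and> G \<in> coarse_rel_maps W W0 i0 \<and>
        (\<exists>q H. coarse_homotopy (metric_cone unit_cube) W q H F G \<and>
          (\<forall>z\<in>metric_cone (frontier unit_cube). \<forall>t. 0 \<le> t \<and> t \<le> q z + 1 \<longrightarrow> H (z, t) \<in> W0) \<and>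
          (\<forall>z\<in>metric_cone boundary_plus. \<forall>t. 0 \<le> t \<and> t \<le> q z + 1 \<longrightarrow> H (z, t) = i0 (snd z)))}"

definition coarse_concat ::
    "((real ^ 'n::{finite,linorder}) \<times> real \<Rightarrow> 'w) \<Rightarrow>
     ((real ^ 'n::{finite,linorder}) \<times> real \<Rightarrow> 'w) \<Rightarrow>
     (real ^ 'n::{finite,linorder}) \<times> real \<Rightarrow> 'w" where
  "coarse_concat F G = (\<lambda>(x, h).
     if x $ first_index \<le> h / 2
     then F (\<chi> i. if i = first_index then 2 * x $ i else x $ i, h)
     else G (\<chi> i. if i = first_index then 2 * x $ i - h else x $ i, h))"

definition coarse_homotopy_group ::
    "'w::metric_space set \<Rightarrow> 'w set \<Rightarrow> (real \<Rightarrow> 'w) \<Rightarrow>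
     ((real ^ 'n::{finite,linorder}) \<times> real \<Rightarrow> 'w) set monoid" where
  "coarse_homotopy_group W W0 i0 =
     \<lparr> carrier = coarse_rel_maps W W0 i0 // coarse_rel_homotopy W W0 i0,
       mult = (\<lambda>U V. \<Union>F\<in>U. \<Union>G\<in>V. coarse_rel_homotopy W W0 i0 `` {coarse_concat F G}),
       one = coarse_rel_homotopy W W0 i0 `` {\<lambda>z. i0 (snd z)} \<rparr>"


section \<open>The comparison map\<close>

definition cone_comparison ::
    "'b::euclidean_space set \<Rightarrow> 'b set \<Rightarrow> 'b \<Rightarrow>
     (real ^ 'n::{finite,linorder} \<Rightarrow> 'b) set \<Rightarrow>
     ((real ^ 'n::{finite,linorder}) \<times> real \<Rightarrow> 'b \<times> real) set" where
  "cone_comparison X X0 x0 U =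
     coarse_rel_homotopy (metric_cone X) (metric_cone X0) (cone_ray x0) ``
       {radial_map (SOME u. u \<in> U \<and> (\<exists>C. C-lipschitz_on unit_cube u))}"


section \<open>PL embeddings of finite simplicial complexes\<close>

definition subdivision_of :: "'a::euclidean_space set set \<Rightarrow> 'a set set \<Rightarrow> bool" where
  "subdivision_of K' K \<longleftrightarrow>
     simplicial_complex K' \<and> \<Union>K' = \<Union>K \<and> (\<forall>S\<in>K'. \<exists>T\<in>K. S \<subseteq> T)"

definition affine_map_on ::
    "'a::euclidean_space set \<Rightarrow> ('a \<Rightarrow> 'b::euclidean_space) \<Rightarrow> bool" where
  "affine_map_on S f \<longleftrightarrow> (\<exists>l b. linear l \<and> (\<forall>x\<in>S. f x = l x + b))"

definition pl_embedding ::
    "'a::euclidean_space set set \<Rightarrow> ('a \<Rightarrow> 'b::euclidean_space) \<Rightarrow> bool" where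
  "pl_embedding K e \<longleftrightarrow>
     (\<exists>K'. subdivision_of K' K \<and> (\<forall>S\<in>K'. affine_map_on S e)) \<and>
     embedding_map (top_of_set (\<Union>K)) euclidean e"

end

theory Submission
  imports Defs
begin

text \<open>
  Why \<open>\<Psi>\<close> is bijective. At height \<open>h\<close> a coarse map \<open>F\<close> from the cone over the cube to the cone over
  \<open>X\<close> has the form \<open>F (h x, h) = (a y, a)\<close> with \<open>y \<in> X\<close>. A change of \<open>x\<close> by \<open>1/h\<close> moves \<open>F\<close> by a
  bounded amount, hence \<open>y\<close> by an amount of order \<open>1/a\<close>, which tends to \<open>0\<close> as \<open>h\<close> grows because
  \<open>F\<close> is proper. So at a large height \<open>x \<mapsto> y\<close> is a map from the cube to \<open>X\<close> that is continuous up to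
  a small error, and \<open>X\<close> forgives small errors: near \<open>X\<close> there is a Lipschitz map \<open>\<rho>\<close> to \<open>X\<close> that
  sends points close to a cell of \<open>X\<close> into that cell (\<open>neighbourhood_cell_map\<close>). Approximating by a
  Lipschitz map and applying \<open>\<rho>\<close> changes points only within their cells. It therefore respects \<open>X0\<close>
  and the vertex \<open>x0\<close>, and straight lines join the result to the original.

  Injectivity. A coarse homotopy between \<open>c u\<close> and \<open>c v\<close>, restricted to one large height, is in this
  way a homotopy between \<open>u\<close> and \<open>v\<close> (\<open>radial_map_reflects_homotopy\<close>).

  Well-definedness. A homotopy may be taken to be Lipschitz by the same approximation, and is then
  carried out at height \<open>h\<close> in time \<open>h + 1\<close> (\<open>radial_map_homotopic\<close>).

  Surjectivity (\<open>coarse_map_homotopic_radial_map\<close>). The maps \<open>u\<close> found at the various heights \<open>s\<close> form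
  a continuous family \<open>\<Omega> s\<close>, and \<open>F\<close> has to be deformed to the cone over a single one of them. The
  obstacle is that the height \<open>a\<close> of \<open>F\<close> may grow arbitrarily slowly, so that \<open>\<Omega> s\<close> varies as fast as
  \<open>1/a\<close>. The remedy is to lower the height: at a height \<open>A\<close> of the target which grows at most as fast as
  \<open>a\<close> and at most like the square root of \<open>h\<close>, the parameter \<open>s\<close> can slide from about \<open>h\<close> down to
  a constant in time \<open>h + 1\<close>. The boundary condition forbids to lower the height on
  \<open>boundary_plus\<close>; but near \<open>boundary_plus\<close> the family \<open>\<Omega>\<close> is constant, so there it does no harm to
  keep the height.

  All estimates rest on the fact that on a convex set a controlled map satisfies a Lipschitz bound up
  to an additive constant. Coarse homotopies are therefore prolonged to the convex set
  \<open>cube_cone \<times> {0..}\<close> (\<open>long_homotopy\<close>). The group axioms are proved for the classical group only, by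
  reparametrizing the first coordinate, and are transported along the bijection.
\<close>

section \<open>Large-scale Lipschitz maps\<close>

text \<open>One constant serves for the slope and for the additive error; this loses nothing and keeps the
  closure properties short.\<close>

definition ls_lipschitz_on :: "'a::metric_space set \<Rightarrow> ('a \<Rightarrow> 'b::metric_space) \<Rightarrow> bool" where
  "ls_lipschitz_on A f \<longleftrightarrow> (\<exists>C\<ge>0. \<forall>x\<in>A. \<forall>y\<in>A. dist (f x) (f y) \<le> C * (dist x y + 1))"

lemma ls_lipschitz_onI:
  assumes "\<And>x y. x \<in> A \<Longrightarrow> y \<in> A \<Longrightarrow> dist (f x) (f y) \<le> C * (dist x y + 1)"
  shows "ls_lipschitz_on A f"
  unfolding ls_lipschitz_on_def
proof (intro exI[of _ "\<bar>C\<bar>"] conjI ballI)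
  fix x y assume "x \<in> A" "y \<in> A"
  then have "dist (f x) (f y) \<le> C * (dist x y + 1)" by (rule assms)
  also have "\<dots> \<le> \<bar>C\<bar> * (dist x y + 1)" by (rule mult_right_mono) auto
  finally show "dist (f x) (f y) \<le> \<bar>C\<bar> * (dist x y + 1)" .
qed simp

lemma ls_lipschitz_onE:
  assumes "ls_lipschitz_on A f"
  obtains C where "C \<ge> 0" "\<And>x y. x \<in> A \<Longrightarrow> y \<in> A \<Longrightarrow> dist (f x) (f y) \<le> C * (dist x y + 1)"
  using assms unfolding ls_lipschitz_on_def by blast

lemma ls_lipschitz_on_controlled: "ls_lipschitz_on A f \<Longrightarrow> controlled_on A f"
  unfolding controlled_on_def
proof (intro allI impI)
  fix R :: real assume R: "R > 0" and "ls_lipschitz_on A f"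
  then obtain C where C: "C \<ge> 0" "\<And>x y. x \<in> A \<Longrightarrow> y \<in> A \<Longrightarrow> dist (f x) (f y) \<le> C * (dist x y + 1)"
    by (elim ls_lipschitz_onE) blast
  have "dist (f x) (f y) < C * (R + 1) + 1" if "x \<in> A" "y \<in> A" "dist x y < R" for x y
    using C(2)[OF that(1,2)] mult_left_mono[of "dist x y + 1" "R + 1" C] C(1) that(3) by linarith
  moreover have "C * (R + 1) + 1 > 0" using C(1) R by (smt (verit) mult_nonneg_nonneg)
  ultimately show "\<exists>S>0. \<forall>x\<in>A. \<forall>y\<in>A. dist x y < R \<longrightarrow> dist (f x) (f y) < S"
    by blast
qed

text \<open>On a convex set a segment from \<open>x\<close> to \<open>y\<close> is cut into at most \<open>dist x y + 1\<close> steps of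
  length at most one, so that a bound at scale one propagates linearly to all scales.\<close>

lemma ls_lipschitz_on_convexI:
  fixes A :: "'a::real_normed_vector set"
  assumes "convex A"
    and C: "\<And>x y. x \<in> A \<Longrightarrow> y \<in> A \<Longrightarrow> dist x y \<le> 1 \<Longrightarrow> dist (f x) (f y) \<le> C"
  shows "ls_lipschitz_on A f"
proof (rule ls_lipschitz_onI)
  fix x y assume xy: "x \<in> A" "y \<in> A"
  define n where "n = nat \<lfloor>dist x y\<rfloor> + 1"
  have n: "real n \<ge> dist x y" "real n \<le> dist x y + 1" "n > 0"
    unfolding n_def by (auto simp: of_nat_nat) linarith
  define p where "p i = x + (real i / real n) *\<^sub>R (y - x)" for i
  have pA: "p i \<in> A" if "i \<le> n" for i
  proof -
    have "p i = (1 - real i / real n) *\<^sub>R x + (real i / real n) *\<^sub>R y"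
      unfolding p_def by (simp add: algebra_simps)
    then show ?thesis using convexD[OF assms(1) xy, of "1 - real i / real n" "real i / real n"] that n(3)
      by (simp add: divide_simps)
  qed
  have "dist (f (p 0)) (f (p k)) \<le> real k * C" if "k \<le> n" for k
    using that
  proof (induction k)
    case (Suc k)
    have "p (Suc k) - p k = (1 / real n) *\<^sub>R (y - x)"
      unfolding p_def by (simp add: algebra_simps add_divide_distrib)
    then have "dist (p k) (p (Suc k)) = dist x y / real n"
      by (simp add: dist_norm norm_minus_commute[of "p k"] norm_minus_commute[of x])
    also have "\<dots> \<le> 1" using n by (simp add: divide_simps)
    finally have "dist (f (p k)) (f (p (Suc k))) \<le> C"
      using C pA Suc.prems by simp
    moreover have "dist (f (p 0)) (f (p k)) \<le> real k * C" using Suc by simp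
    ultimately show ?case
      using dist_triangle[of "f (p 0)" "f (p (Suc k))" "f (p k)"] by (simp add: algebra_simps)
  qed simp
  then have "dist (f (p 0)) (f (p n)) \<le> real n * C" by simp
  moreover have "p 0 = x" "p n = y" using n(3) unfolding p_def by auto
  ultimately have "dist (f x) (f y) \<le> C * real n" by (simp add: mult.commute)
  moreover have "C \<ge> 0" using C[OF xy(1) xy(1)] by simp
  ultimately show "dist (f x) (f y) \<le> C * (dist x y + 1)"
    using n(2) mult_left_mono order_trans by blast
qed

lemma controlled_on_convex_iff:
  fixes A :: "'a::real_normed_vector set"
  assumes "convex A"
  shows "controlled_on A f \<longleftrightarrow> ls_lipschitz_on A f"
proof
  assume "controlled_on A f"
  then obtain S where "\<And>x y. x \<in> A \<Longrightarrow> y \<in> A \<Longrightarrow> dist x y < 2 \<Longrightarrow> dist (f x) (f y) < S"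
    unfolding controlled_on_def by (meson zero_less_numeral)
  then show "ls_lipschitz_on A f"
    by (intro ls_lipschitz_on_convexI[OF assms, of f S]) (auto intro!: less_imp_le)
qed (rule ls_lipschitz_on_controlled)

lemma ls_lipschitz_on_subset: "ls_lipschitz_on A f \<Longrightarrow> B \<subseteq> A \<Longrightarrow> ls_lipschitz_on B f"
  unfolding ls_lipschitz_on_def by blast

lemma lipschitz_on_imp_ls:
  assumes "C-lipschitz_on A f"
  shows "ls_lipschitz_on A f"
proof (rule ls_lipschitz_onI)
  fix x y assume "x \<in> A" "y \<in> A"
  with assms have "dist (f x) (f y) \<le> C * dist x y" "C \<ge> 0" unfolding lipschitz_on_def by auto
  then show "dist (f x) (f y) \<le> C * (dist x y + 1)" by (simp add: algebra_simps)
qed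

lemma ls_lipschitz_on_compose:
  assumes "ls_lipschitz_on A f" "f ` A \<subseteq> B" "ls_lipschitz_on B g"
  shows "ls_lipschitz_on A (\<lambda>x. g (f x))"
proof -
  obtain C D where C: "C \<ge> 0" "\<And>x y. x \<in> A \<Longrightarrow> y \<in> A \<Longrightarrow> dist (f x) (f y) \<le> C * (dist x y + 1)"
    and D: "D \<ge> 0" "\<And>x y. x \<in> B \<Longrightarrow> y \<in> B \<Longrightarrow> dist (g x) (g y) \<le> D * (dist x y + 1)"
    using assms by (elim ls_lipschitz_onE) blast
  show ?thesis
  proof (rule ls_lipschitz_onI[of _ _ "D * (C + 1)"])
    fix x y assume xy: "x \<in> A" "y \<in> A"
    then have "dist (g (f x)) (g (f y)) \<le> D * (dist (f x) (f y) + 1)" using assms(2) D(2) by blast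
    also have "\<dots> \<le> D * (C * (dist x y + 1) + (dist x y + 1))"
      using C(2)[OF xy] D(1) by (intro mult_left_mono add_mono) auto
    finally show "dist (g (f x)) (g (f y)) \<le> D * (C + 1) * (dist x y + 1)" by (simp add: algebra_simps)
  qed
qed

lemma ls_lipschitz_on_close:
  assumes "ls_lipschitz_on A f" "\<And>x. x \<in> A \<Longrightarrow> dist (f x) (g x) \<le> D"
  shows "ls_lipschitz_on A g"
proof -
  obtain C where C: "C \<ge> 0" "\<And>x y. x \<in> A \<Longrightarrow> y \<in> A \<Longrightarrow> dist (f x) (f y) \<le> C * (dist x y + 1)"
    using assms by (elim ls_lipschitz_onE) blast
  show ?thesis
  proof (rule ls_lipschitz_onI[of _ _ "C + 2 * D"])
    fix x y assume xy: "x \<in> A" "y \<in> A"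
    have "D \<ge> 0" using assms(2)[OF xy(1)] zero_le_dist order_trans by blast
    then have "0 \<le> 2 * D * dist x y" by simp
    moreover have "dist (g x) (g y) \<le> dist (f x) (g x) + dist (f x) (f y) + dist (f y) (g y)"
      by (metis add.commute add_mono_thms_linordered_semiring(3) dist_commute dist_triangle2 dist_triangle_le group_cancel.add2)
    ultimately show "dist (g x) (g y) \<le> (C + 2 * D) * (dist x y + 1)"
      using C(2)[OF xy] assms(2)[OF xy(1)] assms(2)[OF xy(2)] by (simp add: algebra_simps)
  qed
qed

lemma dist_Pair_le: "dist (a, b) (c, d) \<le> dist a c + dist b d"
  by (simp add: dist_Pair_Pair sqrt_sum_squares_le_sum)

text \<open>Sums, differences, pairs, maxima and minima all vary at most as much as their two constituents
  together.\<close>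

lemma ls_lipschitz_on_combine:
  assumes "ls_lipschitz_on A f" "ls_lipschitz_on A g"
    and "\<And>x y. x \<in> A \<Longrightarrow> y \<in> A \<Longrightarrow> dist (h x) (h y) \<le> dist (f x) (f y) + dist (g x) (g y)"
  shows "ls_lipschitz_on A h"
proof -
  obtain C D where C: "C \<ge> 0" "\<And>x y. x \<in> A \<Longrightarrow> y \<in> A \<Longrightarrow> dist (f x) (f y) \<le> C * (dist x y + 1)"
    and D: "D \<ge> 0" "\<And>x y. x \<in> A \<Longrightarrow> y \<in> A \<Longrightarrow> dist (g x) (g y) \<le> D * (dist x y + 1)"
    using assms by (elim ls_lipschitz_onE) blast
  show ?thesis
    by (rule ls_lipschitz_onI[of _ _ "C + D"])
      (use C(2) D(2) assms(3) in \<open>fastforce simp: algebra_simps\<close>)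
qed

lemma ls_lipschitz_on_Pair:
  "ls_lipschitz_on A f \<Longrightarrow> ls_lipschitz_on A g \<Longrightarrow> ls_lipschitz_on A (\<lambda>x. (f x, g x))"
  by (erule ls_lipschitz_on_combine, assumption) (rule dist_Pair_le)

lemma ls_lipschitz_on_add:
  fixes f g :: "'a::metric_space \<Rightarrow> 'b::real_normed_vector"
  shows "ls_lipschitz_on A f \<Longrightarrow> ls_lipschitz_on A g \<Longrightarrow> ls_lipschitz_on A (\<lambda>x. f x + g x)"
  by (erule ls_lipschitz_on_combine, assumption) (rule dist_triangle_add)

lemma ls_lipschitz_on_diff:
  fixes f g :: "'a::metric_space \<Rightarrow> 'b::real_normed_vector"
  shows "ls_lipschitz_on A f \<Longrightarrow> ls_lipschitz_on A g \<Longrightarrow> ls_lipschitz_on A (\<lambda>x. f x - g x)"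
  by (erule ls_lipschitz_on_combine, assumption)
    (metis dist_norm norm_triangle_ineq4 diff_diff_eq2 add.commute add_diff_eq diff_add_eq diff_diff_add)

lemma ls_lipschitz_on_max:
  fixes f g :: "'a::metric_space \<Rightarrow> real"
  shows "ls_lipschitz_on A f \<Longrightarrow> ls_lipschitz_on A g \<Longrightarrow> ls_lipschitz_on A (\<lambda>x. max (f x) (g x))"
  by (erule ls_lipschitz_on_combine, assumption) (auto simp: dist_real_def)

lemma ls_lipschitz_on_min:
  fixes f g :: "'a::metric_space \<Rightarrow> real"
  shows "ls_lipschitz_on A f \<Longrightarrow> ls_lipschitz_on A g \<Longrightarrow> ls_lipschitz_on A (\<lambda>x. min (f x) (g x))"
  by (erule ls_lipschitz_on_combine, assumption) (auto simp: dist_real_def)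

lemma ls_lipschitz_on_fst:
  assumes "ls_lipschitz_on A f"
  shows "ls_lipschitz_on A (\<lambda>x. fst (f x))"
  using assms unfolding ls_lipschitz_on_def by (meson dist_fst_le order_trans)

lemma ls_lipschitz_on_snd:
  assumes "ls_lipschitz_on A f"
  shows "ls_lipschitz_on A (\<lambda>x. snd (f x))"
  using assms unfolding ls_lipschitz_on_def by (meson dist_snd_le order_trans)

lemma ls_lipschitz_on_id: "ls_lipschitz_on A (\<lambda>x. x)"
  by (rule ls_lipschitz_onI[of _ _ 1]) simp

lemma ls_lipschitz_on_const: "ls_lipschitz_on A (\<lambda>x. c)"
  by (rule ls_lipschitz_onI[of _ _ 0]) simp

lemma ls_lipschitz_on_scaleR:
  fixes f :: "'a::metric_space \<Rightarrow> 'b::real_normed_vector"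
  assumes "ls_lipschitz_on A f"
  shows "ls_lipschitz_on A (\<lambda>x. c *\<^sub>R f x)"
proof -
  obtain C where C: "C \<ge> 0" "\<And>x y. x \<in> A \<Longrightarrow> y \<in> A \<Longrightarrow> dist (f x) (f y) \<le> C * (dist x y + 1)"
    using assms by (elim ls_lipschitz_onE) blast
  show ?thesis
    by (rule ls_lipschitz_onI[of _ _ "\<bar>c\<bar> * C"])
      (use C(2) in \<open>simp add: dist_norm mult.assoc mult_left_mono flip: scaleR_diff_right\<close>)
qed

lemma ls_lipschitz_on_mult:
  fixes f :: "'a::metric_space \<Rightarrow> real"
  shows "ls_lipschitz_on A f \<Longrightarrow> ls_lipschitz_on A (\<lambda>x. c * f x)"
  using ls_lipschitz_on_scaleR[of A f c] by simp

lemmas ls_lipschitz_intros = ls_lipschitz_on_Pair ls_lipschitz_on_add ls_lipschitz_on_diff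
  ls_lipschitz_on_max ls_lipschitz_on_min ls_lipschitz_on_fst ls_lipschitz_on_snd
  ls_lipschitz_on_id ls_lipschitz_on_const ls_lipschitz_on_mult ls_lipschitz_on_scaleR

lemma ls_lipschitz_on_cong:
  assumes "ls_lipschitz_on A f" "\<And>x. x \<in> A \<Longrightarrow> f x = g x"
  shows "ls_lipschitz_on A g"
  by (rule ls_lipschitz_on_close[OF assms(1), of g 0]) (simp add: assms(2))

lemma ls_lipschitz_on_vec:
  fixes f :: "'a::metric_space \<Rightarrow> 'n::finite \<Rightarrow> real"
  assumes "\<And>i. ls_lipschitz_on A (\<lambda>x. f x i)"
  shows "ls_lipschitz_on A (\<lambda>x. \<chi> i. f x i)"
proof -
  have "\<forall>i. \<exists>C. \<forall>x\<in>A. \<forall>y\<in>A. dist (f x i) (f y i) \<le> C * (dist x y + 1)"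
    using assms unfolding ls_lipschitz_on_def by blast
  then obtain C where C: "\<And>i x y. x \<in> A \<Longrightarrow> y \<in> A \<Longrightarrow> dist (f x i) (f y i) \<le> C i * (dist x y + 1)"
    by metis
  show ?thesis
  proof (rule ls_lipschitz_onI[of _ _ "\<Sum>i\<in>UNIV. C i"])
    fix x y assume xy: "x \<in> A" "y \<in> A"
    have "dist (\<chi> i. f x i) (\<chi> i. f y i) \<le> (\<Sum>i\<in>UNIV. \<bar>((\<chi> i. f x i) - (\<chi> i. f y i)) $ i\<bar>)"
      unfolding dist_norm by (rule norm_le_l1_cart)
    also have "\<dots> \<le> (\<Sum>i\<in>UNIV. C i * (dist x y + 1))"
      using C[OF xy] by (intro sum_mono) (auto simp: dist_real_def)
    finally show "dist (\<chi> i. f x i) (\<chi> i. f y i) \<le> (\<Sum>i\<in>UNIV. C i) * (dist x y + 1)"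
      by (simp add: sum_distrib_right)
  qed
qed

section \<open>Lipschitz approximation\<close>

text \<open>McShane's infimal convolution: if \<open>f\<close> satisfies a Lipschitz bound up to an additive error
  \<open>D\<close>, then the largest \<open>C\<close>-Lipschitz minorant of \<open>f\<close> is within \<open>D\<close> of \<open>f\<close>.\<close>

lemma mcshane_real:
  fixes f :: "'a::metric_space \<Rightarrow> real"
  assumes C: "0 \<le> C" and f: "\<And>x y. x \<in> A \<Longrightarrow> y \<in> A \<Longrightarrow> \<bar>f x - f y\<bar> \<le> C * dist x y + D"
  obtains g where "C-lipschitz_on A g" "\<And>x. x \<in> A \<Longrightarrow> \<bar>f x - g x\<bar> \<le> D"
proof
  define g where "g x = (INF y\<in>A. f y + C * dist x y)" for x
  have low: "f x - D \<le> f y + C * dist x y" if "x \<in> A" "y \<in> A" for x y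
    using f[OF that] by linarith
  then have bdd: "bdd_below ((\<lambda>y. f y + C * dist x y) ` A)" if "x \<in> A" for x
    using that by (intro bdd_belowI2[of _ "f x - D"]) auto
  have half: "g x \<le> g x' + C * dist x x'" if "x \<in> A" "x' \<in> A" for x x'
  proof -
    have "g x - C * dist x x' \<le> f y + C * dist x' y" if "y \<in> A" for y
    proof -
      have "g x \<le> f y + C * dist x y"
        unfolding g_def by (rule cINF_lower[OF bdd[OF \<open>x \<in> A\<close>] \<open>y \<in> A\<close>])
      also have "C * dist x y \<le> C * (dist x x' + dist x' y)"
        using C dist_triangle by (intro mult_left_mono) auto
      finally show ?thesis by (simp add: algebra_simps)
    qed
    then have "g x - C * dist x x' \<le> g x'"
      unfolding g_def[of x'] using that by (intro cINF_greatest) auto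
    then show ?thesis by simp
  qed
  show "C-lipschitz_on A g"
  proof (rule lipschitz_onI[OF _ C])
    fix x y assume "x \<in> A" "y \<in> A"
    then show "dist (g x) (g y) \<le> C * dist x y"
      using half[of x y] half[of y x] by (simp add: dist_real_def abs_le_iff dist_commute)
  qed
  show "\<bar>f x - g x\<bar> \<le> D" if "x \<in> A" for x
  proof -
    have "g x \<le> f x" using cINF_lower[OF bdd[OF that] that] unfolding g_def by simp
    moreover have "f x - D \<le> g x" unfolding g_def using low that by (intro cINF_greatest) auto
    ultimately show ?thesis by simp
  qed
qed

lemma mcshane:
  fixes f :: "'a::metric_space \<Rightarrow> 'b::euclidean_space" and C D :: real
  assumes C: "0 \<le> C" and f: "\<And>x y. x \<in> A \<Longrightarrow> y \<in> A \<Longrightarrow> dist (f x) (f y) \<le> C * dist x y + D"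
  obtains L g where "L-lipschitz_on A g" "\<And>x. x \<in> A \<Longrightarrow> dist (f x) (g x) \<le> DIM('b) * D"
proof -
  have "\<exists>g. C-lipschitz_on A g \<and> (\<forall>x\<in>A. \<bar>f x \<bullet> b - g x\<bar> \<le> D)" if "b \<in> Basis" for b
  proof (rule mcshane_real[OF C, of A "\<lambda>x. f x \<bullet> b" D])
    fix x y assume xy: "x \<in> A" "y \<in> A"
    have "\<bar>f x \<bullet> b - f y \<bullet> b\<bar> \<le> dist (f x) (f y)"
      unfolding dist_norm using Basis_le_norm[OF that, of "f x - f y"] by (simp add: inner_diff_left)
    then show "\<bar>f x \<bullet> b - f y \<bullet> b\<bar> \<le> C * dist x y + D" using f[OF xy] by linarith
  qed blast
  then obtain g where g: "\<And>b. b \<in> Basis \<Longrightarrow> C-lipschitz_on A (g b)"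
    "\<And>b x. b \<in> Basis \<Longrightarrow> x \<in> A \<Longrightarrow> \<bar>f x \<bullet> b - g b x\<bar> \<le> D"
    by metis
  define G where "G x = (\<Sum>b\<in>Basis. g b x *\<^sub>R b)" for x
  show ?thesis
  proof
    show "(DIM('b) * C)-lipschitz_on A G"
    proof (rule lipschitz_onI)
      fix x y assume xy: "x \<in> A" "y \<in> A"
      have "dist (G x) (G y) \<le> (\<Sum>b\<in>Basis. \<bar>(G x - G y) \<bullet> b\<bar>)"
        unfolding dist_norm by (rule norm_le_l1)
      also have "\<dots> \<le> (\<Sum>b\<in>(Basis::'b set). C * dist x y)"
        using lipschitz_onD[OF g(1) xy]
        by (intro sum_mono) (simp add: inner_diff_left G_def dist_real_def)
      finally show "dist (G x) (G y) \<le> DIM('b) * C * dist x y" by simp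
    qed (use C in simp)
    fix x assume x: "x \<in> A"
    have "dist (f x) (G x) \<le> (\<Sum>b\<in>Basis. \<bar>(f x - G x) \<bullet> b\<bar>)"
      unfolding dist_norm by (rule norm_le_l1)
    also have "\<dots> \<le> (\<Sum>b\<in>(Basis::'b set). D)"
      using g(2) x by (intro sum_mono) (simp add: inner_diff_left G_def)
    finally show "dist (f x) (G x) \<le> DIM('b) * D" by simp
  qed
qed

lemma ls_lipschitz_approx:
  fixes f :: "'a::metric_space \<Rightarrow> 'b::euclidean_space"
  assumes "ls_lipschitz_on A f"
  obtains L D g where "L-lipschitz_on A g" "D \<ge> 0" "\<And>x. x \<in> A \<Longrightarrow> dist (f x) (g x) \<le> D"
proof -
  obtain C where C: "C \<ge> 0" "\<And>x y. x \<in> A \<Longrightarrow> y \<in> A \<Longrightarrow> dist (f x) (f y) \<le> C * (dist x y + 1)"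
    using assms by (elim ls_lipschitz_onE) blast
  from mcshane[OF C(1), of A f C] C(2)
  obtain L g where "L-lipschitz_on A g" "\<And>x. x \<in> A \<Longrightarrow> dist (f x) (g x) \<le> DIM('b) * C"
    by (auto simp: algebra_simps)
  then show thesis using that[of L g "DIM('b) * C"] C(1) by auto
qed

text \<open>Uniform continuity gives a small error at small scale, and at larger scale boundedness of the
  image gives a linear bound.\<close>

lemma continuous_lipschitz_approx:
  fixes f :: "'a::metric_space \<Rightarrow> 'b::euclidean_space"
  assumes S: "compact S" and f: "continuous_on S f" and e: "e > 0"
  obtains L g where "L-lipschitz_on S g" "\<And>x. x \<in> S \<Longrightarrow> dist (f x) (g x) < e"
proof -
  define D where "D = e / (2 * DIM('b))"
  have D: "D > 0" unfolding D_def using e by simp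
  obtain d where d: "d > 0" "\<And>x y. x \<in> S \<Longrightarrow> y \<in> S \<Longrightarrow> dist y x < d \<Longrightarrow> dist (f y) (f x) < D"
    using compact_uniformly_continuous[OF f S] D unfolding uniformly_continuous_on_def by metis
  obtain B where B: "\<And>x y. x \<in> S \<Longrightarrow> y \<in> S \<Longrightarrow> dist (f x) (f y) \<le> B"
    using diameter_bounded_bound[OF compact_imp_bounded[OF compact_continuous_image[OF f S]]] by blast
  have "dist (f x) (f y) \<le> \<bar>B\<bar> / d * dist x y + D" if xy: "x \<in> S" "y \<in> S" for x y
  proof (cases "dist y x < d")
    case True
    moreover have "0 \<le> \<bar>B\<bar> / d * dist x y" using d by simp
    ultimately show ?thesis using d(2)[OF xy] by (simp add: dist_commute)
  next
    case False
    then have "\<bar>B\<bar> / d * d \<le> \<bar>B\<bar> / d * dist x y"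
      using d by (intro mult_left_mono) (auto simp: dist_commute)
    then show ?thesis using B[OF xy] D d(1) by (simp; linarith)
  qed
  moreover have "0 \<le> \<bar>B\<bar> / d" using d by simp
  ultimately obtain L g where "L-lipschitz_on S g" "\<And>x. x \<in> S \<Longrightarrow> dist (f x) (g x) \<le> DIM('b) * D"
    using mcshane[of "\<bar>B\<bar> / d" S f D] by metis
  moreover have "DIM('b) * D < e" unfolding D_def using e by simp
  ultimately show thesis using that by fastforce
qed

section \<open>A Lipschitz map near a family of convex cells\<close>

lemma Inter_closed_family:
  assumes "finite F" "F \<noteq> {}" "F \<subseteq> \<S>" "\<And>S T. S \<in> \<S> \<Longrightarrow> T \<in> \<S> \<Longrightarrow> S \<inter> T \<in> \<S>"
  shows "\<Inter>F \<in> \<S>"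
  using assms(1-3) by (induction F rule: finite_ne_induct) (auto simp: assms(4))

text \<open>Choose a point \<open>p T\<close> in each cell \<open>T\<close>, and let \<open>lam T\<close> be the distance to the union of the
  cells that do not contain \<open>p T\<close>. Where \<open>lam T\<close> is positive, every cell through the point contains
  \<open>p T\<close>; and at \<open>x\<close> it is positive for the smallest cell \<open>T\<close> through \<open>x\<close>. Hence the convex
  combination of the points \<open>p T\<close> with weights \<open>lam T\<close> lies in every cell through \<open>x\<close>. Cutting off the
  weights below \<open>\<epsilon>\<close> makes this stable: a weight which survives at \<open>y\<close> is positive at all points
  within \<open>\<epsilon>\<close> of \<open>y\<close>.\<close>

lemma neighbourhood_cell_map:
  fixes \<S> :: "'b::euclidean_space set set"
  assumes fin: "finite \<S>" and cpt: "\<And>S. S \<in> \<S> \<Longrightarrow> compact S" and cvx: "\<And>S. S \<in> \<S> \<Longrightarrow> convex S"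
    and int: "\<And>S T. S \<in> \<S> \<Longrightarrow> T \<in> \<S> \<Longrightarrow> S \<inter> T \<in> \<S>"
  obtains \<epsilon> L \<rho> where "\<epsilon> > 0" "L-lipschitz_on {y. \<exists>x\<in>\<Union>\<S>. dist x y < \<epsilon>} \<rho>"
    "\<And>S x y. S \<in> \<S> \<Longrightarrow> x \<in> S \<Longrightarrow> dist x y < \<epsilon> \<Longrightarrow> \<rho> y \<in> S"
proof (cases "\<Union>\<S> = {}")
  case True
  then show ?thesis using that[of 1 0 "\<lambda>_. 0"] by (auto simp: lipschitz_on_def)
next
  case ne: False
  define \<T> where "\<T> = \<S> - {{}}"
  define p where "p T = (SOME x. x \<in> T)" for T :: "'b set"
  define bad where "bad T = \<Union>{S \<in> \<T>. p T \<notin> S}" for T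
  define lam where "lam T y = (if bad T = {} then 1 else infdist y (bad T))" for T y
  have \<T>: "finite \<T>" "\<T> \<noteq> {}" using fin ne unfolding \<T>_def by auto
  have pT: "p T \<in> T" if "T \<in> \<T>" for T
    using that unfolding p_def \<T>_def by (auto intro: someI_ex)
  have lam0: "lam T y \<ge> 0" for T y unfolding lam_def by (simp add: infdist_nonneg)
  have lam1: "\<bar>lam T y - lam T y'\<bar> \<le> dist y y'" for T y y'
    unfolding lam_def by (simp add: infdist_triangle_abs)
  have lam_in: "p T \<in> S" if "S \<in> \<S>" "x \<in> S" "lam T x > 0" for T S x
  proof (rule ccontr)
    assume "p T \<notin> S"
    then have "x \<in> bad T" using that unfolding bad_def \<T>_def by auto
    then show False using that(3) unfolding lam_def by (auto simp: infdist_zero split: if_splits)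
  qed
  define f where "f x = (\<Sum>T\<in>\<T>. lam T x)" for x
  have fpos: "f x > 0" if "x \<in> \<Union>\<S>" for x
  proof -
    define T where "T = \<Inter>{S \<in> \<S>. x \<in> S}"
    have "T \<in> \<S>" unfolding T_def using that fin by (intro Inter_closed_family int) auto
    moreover have "x \<in> T" unfolding T_def by auto
    ultimately have T: "T \<in> \<T>" unfolding \<T>_def by auto
    have "x \<notin> bad T" using pT[OF T] unfolding bad_def \<T>_def T_def by auto
    moreover have "closed (bad T)"
      unfolding bad_def using fin cpt by (intro closed_Union) (auto simp: \<T>_def intro: compact_imp_closed)
    ultimately have "lam T x > 0"
      unfolding lam_def using in_closed_iff_infdist_zero[of "bad T" x] infdist_nonneg[of x "bad T"]
      by (auto simp: less_le)
    then show ?thesis unfolding f_def using T \<T>(1) lam0 by (intro sum_pos2) auto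
  qed
  have "continuous_on (\<Union>\<S>) f"
  proof -
    have "1-lipschitz_on (\<Union>\<S>) (lam T)" for T
      using lam1 by (intro lipschitz_onI) (auto simp: dist_real_def)
    then show ?thesis unfolding f_def by (intro continuous_intros lipschitz_on_continuous_on)
  qed
  moreover have "compact (\<Union>\<S>)" using fin cpt by (intro compact_Union)
  ultimately obtain x1 where x1: "x1 \<in> \<Union>\<S>" "\<And>x. x \<in> \<Union>\<S> \<Longrightarrow> f x1 \<le> f x"
    using continuous_attains_inf[of "\<Union>\<S>" f] ne by metis
  define c where "c = f x1"
  have c: "c > 0" "\<And>x. x \<in> \<Union>\<S> \<Longrightarrow> c \<le> f x" using x1 fpos unfolding c_def by auto
  define k where "k = real (card \<T>)"
  have k: "k > 0" unfolding k_def using \<T> by (simp add: card_gt_0_iff)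
  \<comment> \<open>small enough that the cut-off weights still have sum at least \<open>c / 2\<close> near the cells\<close>
  define \<epsilon> where "\<epsilon> = c / (4 * k)"
  have e: "\<epsilon> > 0" unfolding \<epsilon>_def using c k by simp
  define mu where "mu T y = max 0 (lam T y - \<epsilon>)" for T y
  define M where "M y = (\<Sum>T\<in>\<T>. mu T y)" for y
  define N where "N y = (\<Sum>T\<in>\<T>. mu T y *\<^sub>R p T)" for y
  have mu0: "mu T y \<ge> 0" for T y unfolding mu_def by simp
  have mu1: "\<bar>mu T y - mu T y'\<bar> \<le> dist y y'" for T y y'
    using lam1[of T y y'] unfolding mu_def by (auto simp: max_def)
  have Mpos: "M y \<ge> c / 2" if "x \<in> \<Union>\<S>" "dist x y < \<epsilon>" for x y
  proof -
    have "f x - 2 * \<epsilon> * k = (\<Sum>T\<in>\<T>. lam T x - 2 * \<epsilon>)"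
      unfolding f_def k_def by (simp add: sum_subtractf)
    also have "\<dots> \<le> M y" unfolding M_def
    proof (rule sum_mono)
      fix T show "lam T x - 2 * \<epsilon> \<le> mu T y" using lam1[of T x y] that(2) unfolding mu_def by auto
    qed
    finally show ?thesis using c(2)[OF that(1)] k unfolding \<epsilon>_def by simp
  qed
  define \<rho> where "\<rho> y = N y /\<^sub>R M y" for y
  have \<rho>_in: "\<rho> y \<in> S" if S: "S \<in> \<S>" "x \<in> S" and d: "dist x y < \<epsilon>" for S x y
  proof -
    define I where "I = {T \<in> \<T>. mu T y \<noteq> 0}"
    have M: "M y > 0" using Mpos[of x y] S d c by force
    have I: "finite I" "I \<subseteq> \<T>" using \<T> unfolding I_def by auto
    have pS: "p T \<in> S" if "T \<in> I" for T
    proof -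
      have "lam T y > \<epsilon>" using that unfolding I_def mu_def by (auto simp: max_def split: if_splits)
      then show ?thesis using lam1[of T x y] d by (intro lam_in[OF S]) auto
    qed
    have "M y = (\<Sum>T\<in>I. mu T y)"
      unfolding M_def by (rule sum.mono_neutral_right) (use \<T> in \<open>auto simp: I_def\<close>)
    then have "(\<Sum>T\<in>I. mu T y / M y) = 1" using M by (simp flip: sum_divide_distrib)
    moreover have "N y = (\<Sum>T\<in>I. mu T y *\<^sub>R p T)"
      unfolding N_def by (rule sum.mono_neutral_right) (use \<T> in \<open>auto simp: I_def\<close>)
    then have "\<rho> y = (\<Sum>T\<in>I. (mu T y / M y) *\<^sub>R p T)"
      unfolding \<rho>_def by (simp add: scaleR_sum_right divide_inverse mult.commute)
    ultimately show ?thesis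
      using convex_sum[OF I(1) cvx[OF S(1)], of "\<lambda>T. mu T y / M y" p] pS M mu0 by auto
  qed
  obtain B where B: "B \<ge> 0" "\<And>x. x \<in> \<Union>\<S> \<Longrightarrow> norm x \<le> B"
    using compact_imp_bounded[OF \<open>compact (\<Union>\<S>)\<close>] bounded_pos by (metis less_imp_le)
  have pB: "norm (p T) \<le> B" if "T \<in> \<T>" for T
    using B(2) pT[OF that] that unfolding \<T>_def by blast
  have "(4 * k * B / c)-lipschitz_on {y. \<exists>x\<in>\<Union>\<S>. dist x y < \<epsilon>} \<rho>"
  proof (rule lipschitz_onI)
    fix y y' assume "y \<in> {y. \<exists>x\<in>\<Union>\<S>. dist x y < \<epsilon>}" "y' \<in> {y. \<exists>x\<in>\<Union>\<S>. dist x y < \<epsilon>}"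
    then have M: "M y \<ge> c / 2" "M y' \<ge> c / 2" and \<rho>': "norm (\<rho> y') \<le> B"
      using Mpos \<rho>_in B(2) by blast+
    have N: "norm (N y - N y') \<le> k * B * dist y y'"
    proof -
      have "norm (N y - N y') = norm (\<Sum>T\<in>\<T>. (mu T y - mu T y') *\<^sub>R p T)"
        unfolding N_def by (simp add: sum_subtractf scaleR_diff_left)
      also have "\<dots> \<le> (\<Sum>T\<in>\<T>. \<bar>mu T y - mu T y'\<bar> * norm (p T))"
        by (rule order_trans[OF norm_sum]) simp
      also have "\<dots> \<le> (\<Sum>T\<in>\<T>. dist y y' * B)"
        using mu1 pB B(1) by (intro sum_mono mult_mono) auto
      finally show ?thesis unfolding k_def by (simp add: algebra_simps)
    qed
    have Md: "\<bar>M y' - M y\<bar> \<le> k * dist y y'"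
    proof -
      have "\<bar>M y' - M y\<bar> \<le> (\<Sum>T\<in>\<T>. \<bar>mu T y' - mu T y\<bar>)"
        unfolding M_def by (simp flip: sum_subtractf)
      also have "\<dots> \<le> (\<Sum>T\<in>\<T>. dist y y')" using mu1[of _ y' y] by (intro sum_mono) (simp add: dist_commute)
      finally show ?thesis unfolding k_def by simp
    qed
    have eq: "\<rho> y - \<rho> y' = (N y - N y' + (M y' - M y) *\<^sub>R \<rho> y') /\<^sub>R M y"
      using M c unfolding \<rho>_def by (simp add: algebra_simps)
    have "norm (N y - N y' + (M y' - M y) *\<^sub>R \<rho> y') \<le> k * B * dist y y' + (k * dist y y') * B"
      using N Md \<rho>' by (intro order_trans[OF norm_triangle_ineq] add_mono) (auto intro!: mult_mono)
    then have "norm (\<rho> y - \<rho> y') \<le> (2 * k * B * dist y y') / M y"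
      unfolding eq using M c by (simp add: divide_simps mult.commute mult.left_commute)
    also have "\<dots> \<le> (2 * k * B * dist y y') / (c / 2)"
      using M c k B by (intro divide_left_mono) auto
    finally show "dist (\<rho> y) (\<rho> y') \<le> 4 * k * B / c * dist y y'"
      by (simp add: dist_norm algebra_simps)
  qed (use k B c in simp)
  then show ?thesis using that e \<rho>_in by blast
qed

section \<open>The cone over the cube\<close>

abbreviation cube_cone :: "((real ^ 'n::{finite,linorder}) \<times> real) set" where
  "cube_cone \<equiv> metric_cone unit_cube"

text \<open>At the apex this is \<open>0\<close>, a point of the cube and of its frontier; so most statements about
  base points hold without excluding the apex.\<close>

definition base_point :: "'a::real_vector \<times> real \<Rightarrow> 'a" where
  "base_point z = fst z /\<^sub>R snd z"

lemma metric_cone_iff: "z \<in> metric_cone Y \<longleftrightarrow> 0 \<le> snd z \<and> (\<exists>y\<in>Y. fst z = snd z *\<^sub>R y)"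
  unfolding metric_cone_def by (cases z) auto

lemma scaled_in_metric_cone: "0 \<le> h \<Longrightarrow> y \<in> Y \<Longrightarrow> (h *\<^sub>R y, h) \<in> metric_cone Y"
  unfolding metric_cone_def by auto

lemma mem_unit_cube: "x \<in> unit_cube \<longleftrightarrow> (\<forall>i. 0 \<le> x $ i \<and> x $ i \<le> 1)"
  by (simp add: mem_box_cart)

lemma mem_frontier_cube:
  "x \<in> frontier unit_cube \<longleftrightarrow> x \<in> unit_cube \<and> (\<exists>i. x $ i = 0 \<or> x $ i = 1)"
proof -
  have "x \<in> box 0 1 \<longleftrightarrow> \<not> (\<exists>i. x $ i = 0 \<or> x $ i = 1)" if "x \<in> unit_cube"
    using that unfolding mem_unit_cube mem_box_cart by (auto simp: less_le)
  then show ?thesis unfolding frontier_cbox by blast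
qed

lemma frontier_cube_subset: "frontier unit_cube \<subseteq> unit_cube"
  using mem_frontier_cube by blast

lemma boundary_plus_subset: "boundary_plus \<subseteq> frontier unit_cube"
  unfolding boundary_plus_def by blast

lemma boundary_plus_nonempty: "boundary_plus \<noteq> {}"
proof -
  have "(1 :: real ^ 'n::{finite,linorder}) \<in> boundary_plus"
    unfolding boundary_plus_def by (simp add: mem_frontier_cube mem_unit_cube)
  then show ?thesis by blast
qed

lemma metric_cone_mono: "Y \<subseteq> Y' \<Longrightarrow> metric_cone Y \<subseteq> metric_cone Y'"
  unfolding metric_cone_def by blast

lemma cone_frontier_subset: "metric_cone (frontier unit_cube) \<subseteq> cube_cone"
  by (rule metric_cone_mono[OF frontier_cube_subset])

lemma cone_boundary_plus_subset: "metric_cone boundary_plus \<subseteq> metric_cone (frontier unit_cube)"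
  by (rule metric_cone_mono[OF boundary_plus_subset])

lemma cube_coneD:
  assumes "z \<in> cube_cone"
  shows "0 \<le> snd z" "snd z *\<^sub>R base_point z = fst z" "base_point z \<in> unit_cube"
    "z = (snd z *\<^sub>R base_point z, snd z)"
proof -
  obtain y where y: "0 \<le> snd z" "fst z = snd z *\<^sub>R y" "y \<in> unit_cube"
    using assms unfolding metric_cone_iff by blast
  show "0 \<le> snd z" "base_point z \<in> unit_cube"
    using y by (cases "snd z = 0"; auto simp: base_point_def mem_unit_cube)+
  show "snd z *\<^sub>R base_point z = fst z" using y by (cases "snd z = 0") (auto simp: base_point_def)
  then show "z = (snd z *\<^sub>R base_point z, snd z)" by (simp add: prod_eq_iff)
qed

lemma mem_cube_cone:
  "z \<in> cube_cone \<longleftrightarrow> 0 \<le> snd z \<and> (\<forall>i. 0 \<le> fst z $ i \<and> fst z $ i \<le> snd z)"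
proof
  assume z: "z \<in> cube_cone"
  have "fst z $ i = snd z * base_point z $ i" for i
    by (subst cube_coneD(2)[OF z, symmetric]) simp
  then show "0 \<le> snd z \<and> (\<forall>i. 0 \<le> fst z $ i \<and> fst z $ i \<le> snd z)"
    using cube_coneD[OF z] by (simp add: mem_unit_cube mult_left_le)
next
  assume z: "0 \<le> snd z \<and> (\<forall>i. 0 \<le> fst z $ i \<and> fst z $ i \<le> snd z)"
  have "fst z = snd z *\<^sub>R base_point z"
  proof (cases "snd z = 0")
    case True
    then have "fst z $ i = 0" for i using z by (simp add: order_antisym)
    then show ?thesis using True by (simp add: vec_eq_iff)
  qed (simp add: base_point_def)
  moreover have "base_point z \<in> unit_cube"
    using z by (cases "snd z = 0") (auto simp: base_point_def mem_unit_cube divide_simps)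
  ultimately show "z \<in> cube_cone" using z unfolding metric_cone_iff by blast
qed

lemma zero_in_cube_cone: "0 \<in> cube_cone"
  by (simp add: mem_cube_cone)

lemma base_point_frontier:
  assumes "z \<in> metric_cone (frontier unit_cube)"
  shows "base_point z \<in> frontier unit_cube"
proof -
  obtain y where y: "0 \<le> snd z" "fst z = snd z *\<^sub>R y" "y \<in> frontier unit_cube"
    using assms unfolding metric_cone_iff by blast
  then show ?thesis by (cases "snd z = 0"; auto simp: base_point_def mem_frontier_cube mem_unit_cube)
qed

lemma base_point_boundary_plus:
  assumes "z \<in> metric_cone boundary_plus" "snd z \<noteq> 0"
  shows "base_point z \<in> boundary_plus"
  using assms unfolding metric_cone_iff base_point_def by auto

lemma mem_cone_frontier:
  "z \<in> metric_cone (frontier unit_cube) \<longleftrightarrow>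
     z \<in> cube_cone \<and> (\<exists>i. fst z $ i = 0 \<or> fst z $ i = snd z)"
proof
  assume z: "z \<in> metric_cone (frontier unit_cube)"
  then obtain y where y: "0 \<le> snd z" "fst z = snd z *\<^sub>R y" "y \<in> frontier unit_cube"
    unfolding metric_cone_iff by blast
  then show "z \<in> cube_cone \<and> (\<exists>i. fst z $ i = 0 \<or> fst z $ i = snd z)"
    using z cone_frontier_subset by (auto simp: mem_frontier_cube)
next
  assume z: "z \<in> cube_cone \<and> (\<exists>i. fst z $ i = 0 \<or> fst z $ i = snd z)"
  obtain i where "fst z $ i = 0 \<or> fst z $ i = snd z" using z by blast
  then have "base_point z $ i = 0 \<or> base_point z $ i = 1"
    by (cases "snd z = 0") (auto simp: base_point_def)
  then have "base_point z \<in> frontier unit_cube"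
    using z cube_coneD(3)[of z] unfolding mem_frontier_cube by blast
  then show "z \<in> metric_cone (frontier unit_cube)"
    using z cube_coneD unfolding metric_cone_iff by metis
qed

lemma mem_cone_boundary_plus:
  "z \<in> metric_cone boundary_plus \<longleftrightarrow>
     z \<in> metric_cone (frontier unit_cube) \<and> (snd z = 0 \<or> 0 < fst z $ last_index)"
proof
  assume z: "z \<in> metric_cone boundary_plus"
  then obtain y where y: "0 \<le> snd z" "fst z = snd z *\<^sub>R y" "y \<in> boundary_plus"
    unfolding metric_cone_iff by blast
  then show "z \<in> metric_cone (frontier unit_cube) \<and> (snd z = 0 \<or> 0 < fst z $ last_index)"
    using z cone_boundary_plus_subset by (cases "snd z = 0") (auto simp: boundary_plus_def)
next
  assume z: "z \<in> metric_cone (frontier unit_cube) \<and> (snd z = 0 \<or> 0 < fst z $ last_index)"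
  then have zc: "z \<in> cube_cone" using cone_frontier_subset by blast
  show "z \<in> metric_cone boundary_plus"
  proof (cases "snd z = 0")
    case True
    then have "fst z = 0" using cube_coneD(2)[OF zc] by simp
    then show ?thesis using True boundary_plus_nonempty unfolding metric_cone_iff by auto
  next
    case False
    then have "base_point z \<in> boundary_plus"
      using z base_point_frontier[of z] cube_coneD(1)[OF zc]
      by (auto simp: boundary_plus_def base_point_def)
    then show ?thesis using cube_coneD[OF zc] unfolding metric_cone_iff by metis
  qed
qed

lemma convex_cube_cone: "convex cube_cone"
proof (rule convexI)
  fix z z' :: "(real ^ 'n::{finite,linorder}) \<times> real" and u v :: real
  assume z: "z \<in> cube_cone" "z' \<in> cube_cone" and uv: "0 \<le> u" "0 \<le> v" "u + v = 1"
  show "u *\<^sub>R z + v *\<^sub>R z' \<in> cube_cone"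
    using z uv unfolding mem_cube_cone by (auto intro!: add_mono mult_left_mono)
qed

abbreviation cone_cylinder :: "(((real ^ 'n::{finite,linorder}) \<times> real) \<times> real) set" where
  "cone_cylinder \<equiv> cube_cone \<times> {0..}"

lemma convex_cone_cylinder: "convex cone_cylinder"
  by (intro convex_Times convex_cube_cone) simp

lemma norm_unit_cube:
  assumes "x \<in> unit_cube"
  shows "norm (x :: real ^ 'n::{finite,linorder}) \<le> real CARD('n)"
proof -
  have "norm x \<le> (\<Sum>i\<in>UNIV. \<bar>x $ i\<bar>)" by (rule norm_le_l1_cart)
  also have "\<dots> \<le> (\<Sum>i\<in>(UNIV::'n set). 1)" using assms by (intro sum_mono) (auto simp: mem_unit_cube)
  finally show ?thesis by simp
qed

lemma norm_cube_cone:
  assumes "z \<in> cube_cone"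
  shows "norm (z :: (real ^ 'n::{finite,linorder}) \<times> real) \<le> (real CARD('n) + 1) * snd z"
proof -
  have "norm (fst z) \<le> snd z * real CARD('n)"
    using norm_unit_cube[OF cube_coneD(3)[OF assms]] cube_coneD(1)[OF assms]
    by (subst cube_coneD(2)[OF assms, symmetric]) (simp add: mult_left_mono)
  moreover have "norm z \<le> norm (fst z) + norm (snd z)"
    using norm_Pair_le[of "fst z" "snd z"] by simp
  ultimately show ?thesis using cube_coneD(1)[OF assms] by (simp add: algebra_simps)
qed

text \<open>The base point varies by at most a multiple of \<open>1/h\<close> at height \<open>h\<close>: this is why the radial
  extension of a Lipschitz map is Lipschitz.\<close>

lemma base_point_lipschitz:
  fixes z z' :: "(real ^ 'n::{finite,linorder}) \<times> real"
  assumes z: "z \<in> cube_cone" "z' \<in> cube_cone"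
  shows "snd z * norm (base_point z - base_point z') \<le> (real CARD('n) + 1) * dist z z'"
proof -
  have "snd z *\<^sub>R (base_point z - base_point z')
      = (fst z - fst z') + (snd z' - snd z) *\<^sub>R base_point z'"
    using cube_coneD(2)[OF z(1)] cube_coneD(2)[OF z(2)] by (simp add: scaleR_diff_right scaleR_diff_left)
  then have "snd z * norm (base_point z - base_point z')
      = norm ((fst z - fst z') + (snd z' - snd z) *\<^sub>R base_point z')"
    using cube_coneD(1)[OF z(1)] by (metis abs_of_nonneg norm_scaleR)
  also have "\<dots> \<le> norm (fst z - fst z') + \<bar>snd z' - snd z\<bar> * norm (base_point z')"
    by (rule norm_triangle_le) simp
  also have "\<dots> \<le> dist z z' + dist z z' * real CARD('n)"
    using dist_fst_le[of z z'] dist_snd_le[of z' z] norm_unit_cube[OF cube_coneD(3)[OF z(2)]]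
    by (intro add_mono mult_mono) (auto simp: dist_norm norm_minus_commute)
  finally show ?thesis by (simp add: algebra_simps)
qed

lemma ls_lipschitz_growth:
  fixes f :: "(real ^ 'n::{finite,linorder}) \<times> real \<Rightarrow> 'b::real_normed_vector"
  assumes "ls_lipschitz_on cube_cone f"
  obtains c where "c \<ge> 0" "\<And>z. z \<in> cube_cone \<Longrightarrow> norm (f z) \<le> c * (snd z + 1)"
proof -
  obtain C where C: "C \<ge> 0"
    "\<And>x y. x \<in> cube_cone \<Longrightarrow> y \<in> cube_cone \<Longrightarrow> dist (f x) (f y) \<le> C * (dist x y + 1)"
    using assms by (elim ls_lipschitz_onE) blast
  define c where "c = norm (f 0) + C * (real CARD('n) + 1)"
  have "norm (f z) \<le> c * (snd z + 1)" if z: "z \<in> cube_cone" for z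
  proof -
    have "norm (f z) \<le> norm (f 0) + dist (f z) (f 0)"
      unfolding dist_norm by (rule norm_triangle_sub)
    also have "\<dots> \<le> norm (f 0) + C * (norm z + 1)" using C(2)[OF z zero_in_cube_cone] by simp
    also have "\<dots> \<le> norm (f 0) + C * ((real CARD('n) + 1) * snd z + 1)"
      using norm_cube_cone[OF z] C(1) by (intro add_mono mult_left_mono) auto
    also have "\<dots> \<le> norm (f 0) * (snd z + 1) + C * ((real CARD('n) + 1) * (snd z + 1))"
    proof (intro add_mono mult_left_mono C(1))
      show "norm (f 0) \<le> norm (f 0) * (snd z + 1)"
        using cube_coneD(1)[OF z] by (simp add: algebra_simps)
      show "(real CARD('n) + 1) * snd z + 1 \<le> (real CARD('n) + 1) * (snd z + 1)"
        by (simp add: algebra_simps)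
    qed
    finally show ?thesis unfolding c_def by (simp add: algebra_simps)
  qed
  moreover have "c \<ge> 0" unfolding c_def using C(1) by simp
  ultimately show thesis using that by blast
qed

text \<open>The parameter of a homotopy which at height \<open>h\<close> takes time \<open>h + 1\<close>.\<close>

definition ramp :: "real \<Rightarrow> real \<Rightarrow> real" where
  "ramp h t = min 1 (t / (h + 1))"

lemma ramp_range: "0 \<le> h \<Longrightarrow> 0 \<le> t \<Longrightarrow> 0 \<le> ramp h t \<and> ramp h t \<le> 1"
  unfolding ramp_def by simp

lemma ramp_0: "ramp h 0 = 0"
  unfolding ramp_def by simp

lemma ramp_1: "0 \<le> h \<Longrightarrow> h + 1 \<le> t \<Longrightarrow> ramp h t = 1"
  unfolding ramp_def by (simp add: min_def divide_simps)

lemma ramp_lipschitz: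
  assumes "0 \<le> h" "0 \<le> h'" "0 \<le> t" "0 \<le> t'"
  shows "(h' + 1) * \<bar>ramp h t - ramp h' t'\<bar> \<le> \<bar>t - t'\<bar> + 2 * \<bar>h - h'\<bar>"
proof -
  define \<tau> \<tau>' where "\<tau> = min (h + 1) t" and "\<tau>' = min (h' + 1) t'"
  have r: "ramp h t = \<tau> / (h + 1)" "ramp h' t' = \<tau>' / (h' + 1)"
    using assms unfolding ramp_def \<tau>_def \<tau>'_def by (auto simp: min_def divide_simps)
  have "(h' + 1) * (ramp h t - ramp h' t') = (\<tau> - \<tau>') + (h' - h) * ramp h t"
    using assms unfolding r by (simp add: divide_simps) (simp add: algebra_simps)
  then have "(h' + 1) * \<bar>ramp h t - ramp h' t'\<bar> = \<bar>(\<tau> - \<tau>') + (h' - h) * ramp h t\<bar>"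
    using assms by (metis abs_mult abs_of_nonneg add_nonneg_nonneg zero_le_one)
  also have "\<dots> \<le> \<bar>\<tau> - \<tau>'\<bar> + \<bar>h' - h\<bar> * \<bar>ramp h t\<bar>"
    by (metis abs_mult abs_triangle_ineq)
  also have "\<dots> \<le> (\<bar>t - t'\<bar> + \<bar>h - h'\<bar>) + \<bar>h' - h\<bar> * 1"
    using ramp_range[of h t] assms unfolding \<tau>_def \<tau>'_def
    by (intro add_mono mult_left_mono) auto
  finally show ?thesis by (simp add: abs_minus_commute[of h' h])
qed

text \<open>The slope of the ramp at height \<open>h\<close> is \<open>1 / (h + 1)\<close>, which compensates the linear growth of
  \<open>f\<close>.\<close>

lemma ls_lipschitz_on_ramp:
  fixes f :: "(real ^ 'n::{finite,linorder}) \<times> real \<Rightarrow> 'b::real_normed_vector"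
  assumes "ls_lipschitz_on cube_cone f"
  shows "ls_lipschitz_on cone_cylinder (\<lambda>p. ramp (snd (fst p)) (snd p) *\<^sub>R f (fst p))"
proof -
  obtain C where C: "C \<ge> 0"
    "\<And>x y. x \<in> cube_cone \<Longrightarrow> y \<in> cube_cone \<Longrightarrow> dist (f x) (f y) \<le> C * (dist x y + 1)"
    using assms by (elim ls_lipschitz_onE) blast
  obtain c where c: "c \<ge> 0" "\<And>z. z \<in> cube_cone \<Longrightarrow> norm (f z) \<le> c * (snd z + 1)"
    using ls_lipschitz_growth[OF assms] by blast
  show ?thesis
  proof (rule ls_lipschitz_onI[of _ _ "C + 3 * c"])
    fix p p' :: "((real ^ 'n::{finite,linorder}) \<times> real) \<times> real"
    assume p: "p \<in> cone_cylinder" "p' \<in> cone_cylinder"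
    obtain z t z' t' where eq: "p = (z, t)" "p' = (z', t')" by (metis surj_pair)
    have z: "z \<in> cube_cone" "z' \<in> cube_cone" "0 \<le> t" "0 \<le> t'" using p eq by auto
    have h: "0 \<le> snd z" "0 \<le> snd z'" using cube_coneD(1) z by blast+
    let ?r = "ramp (snd z) t" and ?r' = "ramp (snd z') t'"
    have d: "dist z z' \<le> dist p p'" "\<bar>t - t'\<bar> \<le> dist p p'" "\<bar>snd z - snd z'\<bar> \<le> dist p p'"
      using dist_fst_le[of p p'] dist_snd_le[of p p'] dist_snd_le[of z z'] unfolding eq
      by (auto simp: dist_real_def)
    have "?r *\<^sub>R f z - ?r' *\<^sub>R f z' = ?r *\<^sub>R (f z - f z') + (?r - ?r') *\<^sub>R f z'"
      by (simp add: algebra_simps)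
    then have "dist (?r *\<^sub>R f z) (?r' *\<^sub>R f z') \<le> \<bar>?r\<bar> * dist (f z) (f z') + \<bar>?r - ?r'\<bar> * norm (f z')"
      unfolding dist_norm by (metis norm_scaleR norm_triangle_ineq)
    also have "\<dots> \<le> 1 * (C * (dist z z' + 1)) + \<bar>?r - ?r'\<bar> * (c * (snd z' + 1))"
      using ramp_range[OF h(1) z(3)] C(2)[OF z(1,2)] c(2)[OF z(2)]
      by (intro add_mono mult_mono) auto
    also have "\<bar>?r - ?r'\<bar> * (c * (snd z' + 1)) = c * ((snd z' + 1) * \<bar>?r - ?r'\<bar>)" by simp
    also have "\<dots> \<le> c * (\<bar>t - t'\<bar> + 2 * \<bar>snd z - snd z'\<bar>)"
      by (intro mult_left_mono c(1) ramp_lipschitz h z)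
    also have "\<dots> \<le> c * (3 * (dist p p' + 1))"
    proof (rule mult_left_mono[OF _ c(1)])
      show "\<bar>t - t'\<bar> + 2 * \<bar>snd z - snd z'\<bar> \<le> 3 * (dist p p' + 1)" using d(2,3) by argo
    qed
    also have "1 * (C * (dist z z' + 1)) \<le> C * (dist p p' + 1)"
      using d(1) C(1) by (simp add: mult_left_mono)
    finally show "dist (ramp (snd (fst p)) (snd p) *\<^sub>R f (fst p)) (ramp (snd (fst p')) (snd p') *\<^sub>R f (fst p'))
        \<le> (C + 3 * c) * (dist p p' + 1)"
      unfolding eq by (simp add: algebra_simps)
  qed
qed

section \<open>Coarse homotopies on an infinite cylinder\<close>

definition height_proper :: "((real ^ 'n::{finite,linorder}) \<times> real \<Rightarrow> real) \<Rightarrow> bool" where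
  "height_proper a \<longleftrightarrow> (\<forall>M. \<exists>N. \<forall>z\<in>cube_cone. a z \<le> M \<longrightarrow> snd z \<le> N)"

locale pointed_pair =
  fixes X X0 :: "'b::euclidean_space set" and x0 :: 'b
  assumes bounded_X: "bounded X" and X0_subset: "X0 \<subseteq> X" and x0_in: "x0 \<in> X0"
begin

abbreviation coarse_maps :: "((real ^ 'n::{finite,linorder}) \<times> real \<Rightarrow> 'b \<times> real) set" where
  "coarse_maps \<equiv> coarse_rel_maps (metric_cone X) (metric_cone X0) (cone_ray x0)"

abbreviation coarse_htpy ::
    "(((real ^ 'n::{finite,linorder}) \<times> real \<Rightarrow> 'b \<times> real) \<times>
      ((real ^ 'n::{finite,linorder}) \<times> real \<Rightarrow> 'b \<times> real)) set" where
  "coarse_htpy \<equiv> coarse_rel_homotopy (metric_cone X) (metric_cone X0) (cone_ray x0)"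

lemma bounded_cone_iff:
  assumes "D \<subseteq> metric_cone X"
  shows "bounded D \<longleftrightarrow> (\<exists>M. \<forall>w\<in>D. snd w \<le> M)"
proof
  assume "bounded D"
  then obtain M where "\<And>w. w \<in> D \<Longrightarrow> norm w \<le> M" using bounded_pos by metis
  moreover have "snd w \<le> norm w" for w :: "'b \<times> real" using norm_snd_le[of "snd w" "fst w"] by simp
  ultimately show "\<exists>M. \<forall>w\<in>D. snd w \<le> M" by (meson order_trans)
next
  assume "\<exists>M. \<forall>w\<in>D. snd w \<le> M"
  then obtain M where M: "\<And>w. w \<in> D \<Longrightarrow> snd w \<le> M" by blast
  obtain B where B: "\<And>x. x \<in> X \<Longrightarrow> norm x \<le> B" "B > 0" using bounded_X bounded_pos by metis
  have "norm w \<le> M * B + M" if w: "w \<in> D" for w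
  proof -
    obtain y where y: "0 \<le> snd w" "fst w = snd w *\<^sub>R y" "y \<in> X"
      using subsetD[OF assms w] unfolding metric_cone_iff by blast
    have "norm w \<le> norm (fst w) + norm (snd w)" using norm_Pair_le[of "fst w" "snd w"] by simp
    also have "\<dots> \<le> M * B + M"
      using y M[OF w] B(1)[OF y(3)] by (simp add: mult_mono add_mono)
    finally show ?thesis .
  qed
  then show "bounded D" by (rule boundedI)
qed

text \<open>Over a bounded base, boundedness in the cone is boundedness of the height, so properness can
  be stated in terms of heights alone.\<close>

lemma coarse_maps_iff:
  fixes F :: "(real ^ 'n::{finite,linorder}) \<times> real \<Rightarrow> 'b \<times> real"
  shows "F \<in> coarse_maps \<longleftrightarrow>
     (\<forall>z\<in>cube_cone. F z \<in> metric_cone X) \<and> ls_lipschitz_on cube_cone F \<and>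
     height_proper (\<lambda>z. snd (F z)) \<and>
     (\<forall>z\<in>metric_cone (frontier unit_cube). F z \<in> metric_cone X0) \<and>
     (\<forall>z\<in>metric_cone boundary_plus. F z = (snd z *\<^sub>R x0, snd z))"
  (is "_ \<longleftrightarrow> ?in \<and> ?ls \<and> ?pr \<and> ?fr \<and> ?bp")
proof -
  have pr: "(\<forall>D\<subseteq>metric_cone X. bounded D \<longrightarrow> bounded {z \<in> cube_cone. F z \<in> D}) \<longleftrightarrow> ?pr"
    if in_X: ?in
  proof (intro iffI allI impI)
    assume L: "\<forall>D\<subseteq>metric_cone X. bounded D \<longrightarrow> bounded {z \<in> cube_cone. F z \<in> D}"
    show ?pr unfolding height_proper_def
    proof
      fix M
      have "bounded {z \<in> cube_cone. F z \<in> {w \<in> metric_cone X. snd w \<le> M}}"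
        using L bounded_cone_iff[of "{w \<in> metric_cone X. snd w \<le> M}"] by auto
      then obtain N where N: "\<And>z. z \<in> cube_cone \<Longrightarrow> F z \<in> metric_cone X \<Longrightarrow> snd (F z) \<le> M \<Longrightarrow> norm z \<le> N"
        unfolding bounded_iff by auto
      moreover have "snd z \<le> norm z" for z :: "(real ^ 'n::{finite,linorder}) \<times> real" using norm_snd_le[of "snd z" "fst z"] by simp
      ultimately show "\<exists>N. \<forall>z\<in>cube_cone. snd (F z) \<le> M \<longrightarrow> snd z \<le> N"
        using in_X by (meson order_trans)
    qed
  next
    fix D assume R: ?pr and D: "D \<subseteq> metric_cone X" "bounded D"
    obtain M where M: "\<And>w. w \<in> D \<Longrightarrow> snd w \<le> M" using bounded_cone_iff[OF D(1)] D(2) by blast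
    obtain N where N: "\<And>z. z \<in> cube_cone \<Longrightarrow> snd (F z) \<le> M \<Longrightarrow> snd z \<le> N"
      using R unfolding height_proper_def by blast
    have "norm z \<le> (real CARD('n) + 1) * N" if "z \<in> cube_cone" "F z \<in> D" for z
      using norm_cube_cone[OF that(1)] N[OF that(1) M[OF that(2)]]
      by (smt (verit) mult_left_mono of_nat_0_le_iff)
    then show "bounded {z \<in> cube_cone. F z \<in> D}" by (intro boundedI) auto
  qed
  show ?thesis
  proof (cases ?in)
    case True
    show ?thesis
      unfolding coarse_rel_maps_def coarse_map_def cone_ray_def mem_Collect_eq image_subset_iff
        controlled_on_convex_iff[OF convex_cube_cone] pr[OF True]
      by (simp only: conj_assoc)
  next
    case False
    then show ?thesis
      unfolding coarse_rel_maps_def coarse_map_def mem_Collect_eq image_subset_iff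
      by (simp only: simp_thms)
  qed
qed

lemma coarse_mapsD:
  assumes "F \<in> coarse_maps"
  shows "z \<in> cube_cone \<Longrightarrow> F z \<in> metric_cone X" "ls_lipschitz_on cube_cone F"
    "height_proper (\<lambda>z. snd (F z))"
    "z \<in> metric_cone (frontier unit_cube) \<Longrightarrow> F z \<in> metric_cone X0"
    "z \<in> metric_cone boundary_plus \<Longrightarrow> F z = (snd z *\<^sub>R x0, snd z)"
proof -
  note F = iffD1[OF coarse_maps_iff assms]
  show "z \<in> cube_cone \<Longrightarrow> F z \<in> metric_cone X" using F by (elim conjE) (erule (1) bspec)
  show "ls_lipschitz_on cube_cone F" using F by (elim conjE)
  show "height_proper (\<lambda>z. snd (F z))" using F by (elim conjE)
  show "z \<in> metric_cone (frontier unit_cube) \<Longrightarrow> F z \<in> metric_cone X0"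
    using F by (elim conjE) (erule (1) bspec)
  show "z \<in> metric_cone boundary_plus \<Longrightarrow> F z = (snd z *\<^sub>R x0, snd z)"
    using F by (elim conjE) (erule (1) bspec)
qed

text \<open>A coarse homotopy can be prolonged by its final value, and its length is bounded by a linear
  function of the height. This makes it a map on all of \<open>cone_cylinder\<close>, which is convex.\<close>

definition long_homotopy ::
    "real \<Rightarrow> ((real ^ 'n::{finite,linorder}) \<times> real \<Rightarrow> 'b \<times> real) \<Rightarrow>
     ((real ^ 'n::{finite,linorder}) \<times> real \<Rightarrow> 'b \<times> real) \<Rightarrow> (((real ^ 'n::{finite,linorder}) \<times> real) \<times> real \<Rightarrow> 'b \<times> real) \<Rightarrow> bool" where
  "long_homotopy K F G H \<longleftrightarrow>
     (\<forall>z\<in>cube_cone. \<forall>t\<ge>0. H (z, t) \<in> metric_cone X) \<and>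
     ls_lipschitz_on cone_cylinder H \<and>
     (\<forall>M. \<exists>N. \<forall>z\<in>cube_cone. \<forall>t\<ge>0. snd (H (z, t)) \<le> M \<longrightarrow> snd z \<le> N) \<and>
     (\<forall>z\<in>metric_cone (frontier unit_cube). \<forall>t\<ge>0. H (z, t) \<in> metric_cone X0) \<and>
     (\<forall>z\<in>metric_cone boundary_plus. \<forall>t\<ge>0. H (z, t) = (snd z *\<^sub>R x0, snd z)) \<and>
     K \<ge> 1 \<and> (\<forall>z\<in>cube_cone. H (z, 0) = F z) \<and>
     (\<forall>z\<in>cube_cone. \<forall>t\<ge>K * (snd z + 1). H (z, t) = G z)"

lemma long_homotopyD:
  assumes "long_homotopy K F G H"
  shows "z \<in> cube_cone \<Longrightarrow> t \<ge> 0 \<Longrightarrow> H (z, t) \<in> metric_cone X"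
    "ls_lipschitz_on cone_cylinder H"
    "\<exists>N. \<forall>z\<in>cube_cone. \<forall>t\<ge>0. snd (H (z, t)) \<le> M \<longrightarrow> snd z \<le> N"
    "z \<in> metric_cone (frontier unit_cube) \<Longrightarrow> t \<ge> 0 \<Longrightarrow> H (z, t) \<in> metric_cone X0"
    "z \<in> metric_cone boundary_plus \<Longrightarrow> t \<ge> 0 \<Longrightarrow> H (z, t) = (snd z *\<^sub>R x0, snd z)"
    "K \<ge> 1" "z \<in> cube_cone \<Longrightarrow> H (z, 0) = F z"
    "z \<in> cube_cone \<Longrightarrow> t \<ge> K * (snd z + 1) \<Longrightarrow> H (z, t) = G z"
proof -
  note F = assms[unfolded long_homotopy_def]
  show "z \<in> cube_cone \<Longrightarrow> t \<ge> 0 \<Longrightarrow> H (z, t) \<in> metric_cone X" using F by (elim conjE) simp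
  show "ls_lipschitz_on cone_cylinder H" using F by (elim conjE)
  show "\<exists>N. \<forall>z\<in>cube_cone. \<forall>t\<ge>0. snd (H (z, t)) \<le> M \<longrightarrow> snd z \<le> N"
    using F by (elim conjE) (erule spec)
  show "z \<in> metric_cone (frontier unit_cube) \<Longrightarrow> t \<ge> 0 \<Longrightarrow> H (z, t) \<in> metric_cone X0"
    using F by (elim conjE) simp
  show "z \<in> metric_cone boundary_plus \<Longrightarrow> t \<ge> 0 \<Longrightarrow> H (z, t) = (snd z *\<^sub>R x0, snd z)"
    using F by (elim conjE) simp
  show "K \<ge> 1" using F by (elim conjE)
  show "z \<in> cube_cone \<Longrightarrow> H (z, 0) = F z" using F by (elim conjE) simp
  show "z \<in> cube_cone \<Longrightarrow> t \<ge> K * (snd z + 1) \<Longrightarrow> H (z, t) = G z" using F by (elim conjE) simp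
qed

lemma long_homotopy_mono:
  assumes H: "long_homotopy K F G H" and K: "K \<le> K'"
  shows "long_homotopy K' F G H"
proof -
  have "H (z, t) = G z" if "z \<in> cube_cone" "t \<ge> K' * (snd z + 1)" for z t
  proof -
    have "K * (snd z + 1) \<le> K' * (snd z + 1)" using K cube_coneD(1)[OF that(1)] by (intro mult_right_mono) auto
    then show ?thesis using long_homotopyD(8)[OF H that(1)] that(2) by simp
  qed
  moreover have "1 \<le> K'" using long_homotopyD(6)[OF H] K by simp
  ultimately show ?thesis using H unfolding long_homotopy_def by blast
qed

lemma long_homotopy_slice:
  assumes H: "long_homotopy K F G H" and \<tau>: "ls_lipschitz_on cube_cone \<tau>" "\<And>z. z \<in> cube_cone \<Longrightarrow> \<tau> z \<ge> 0"
    and F': "\<And>z. z \<in> cube_cone \<Longrightarrow> F' z = H (z, \<tau> z)"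
  shows "F' \<in> coarse_maps"
proof -
  note D = long_homotopyD[OF H]
  have "ls_lipschitz_on cube_cone (\<lambda>z. H (z, \<tau> z))"
    by (rule ls_lipschitz_on_compose[OF _ _ D(2)]) (use \<tau> in \<open>auto intro: ls_lipschitz_intros\<close>)
  then have "ls_lipschitz_on cube_cone F'" by (rule ls_lipschitz_on_cong) (simp add: F')
  moreover have "height_proper (\<lambda>z. snd (F' z))"
    unfolding height_proper_def using D(3) F' \<tau>(2) by (metis (no_types, lifting))
  moreover have "F' z \<in> metric_cone X0" if "z \<in> metric_cone (frontier unit_cube)" for z
    using D(4)[OF that, of "\<tau> z"] subsetD[OF cone_frontier_subset that] F' \<tau>(2) by simp
  moreover have "F' z = (snd z *\<^sub>R x0, snd z)" if "z \<in> metric_cone boundary_plus" for z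
    using D(5)[OF that, of "\<tau> z"] F' \<tau>(2)
      subsetD[OF cone_frontier_subset subsetD[OF cone_boundary_plus_subset that]] by simp
  ultimately show ?thesis unfolding coarse_maps_iff using D(1) F' \<tau>(2) by simp
qed

lemma long_homotopy_maps:
  assumes H: "long_homotopy K F G H"
  shows "F \<in> coarse_maps" "G \<in> coarse_maps"
proof -
  note D = long_homotopyD[OF H]
  show "F \<in> coarse_maps"
    by (rule long_homotopy_slice[OF H, of "\<lambda>_. 0"]) (auto simp: D(7) intro: ls_lipschitz_intros)
  show "G \<in> coarse_maps"
  proof (rule long_homotopy_slice[OF H])
    show "ls_lipschitz_on cube_cone (\<lambda>z. K * (snd z + 1))" by (intro ls_lipschitz_intros)
    show "0 \<le> K * (snd z + 1)" if "z \<in> cube_cone" for z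
      using D(6) cube_coneD(1)[OF that] by simp
  qed (simp add: D(8))
qed

text \<open>From left to right, \<open>H\<close> is prolonged by \<open>H (z, min t (q z + 1))\<close>; this is controlled although
  \<open>q\<close> need not be continuous. From right to left, \<open>q z = K * (snd z + 1)\<close> serves as the length.\<close>

lemma coarse_htpy_iff:
  fixes F :: "(real ^ 'n::{finite,linorder}) \<times> real \<Rightarrow> 'b \<times> real"
  shows "(F, G) \<in> coarse_htpy \<longleftrightarrow> (\<exists>K H. long_homotopy K F G H)"
proof
  assume "(F, G) \<in> coarse_htpy"
  then obtain q H where q: "coarse_map cube_cone {0..} q" and Hc: "coarse_map (q_cylinder q cube_cone) (metric_cone X) H"
    and ends: "\<And>z. z \<in> cube_cone \<Longrightarrow> H (z, 0) = F z \<and> H (z, q z + 1) = G z"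
    and fr: "\<And>z t. z \<in> metric_cone (frontier unit_cube) \<Longrightarrow> 0 \<le> t \<Longrightarrow> t \<le> q z + 1 \<Longrightarrow> H (z, t) \<in> metric_cone X0"
    and bp: "\<And>z t. z \<in> metric_cone boundary_plus \<Longrightarrow> 0 \<le> t \<Longrightarrow> t \<le> q z + 1 \<Longrightarrow> H (z, t) = cone_ray x0 (snd z)"
    unfolding coarse_rel_homotopy_def coarse_homotopy_def by auto
  have q0: "q z \<ge> 0" if "z \<in> cube_cone" for z using q that unfolding coarse_map_def by auto
  have qls: "ls_lipschitz_on cube_cone q"
    using q controlled_on_convex_iff[OF convex_cube_cone] unfolding coarse_map_def by blast
  then obtain c where c: "c \<ge> 0" "\<And>z. z \<in> cube_cone \<Longrightarrow> norm (q z) \<le> c * (snd z + 1)"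
    using ls_lipschitz_growth by blast
  define g where "g p = (fst p, min (snd p) (q (fst p) + 1))" for p :: "(((real ^ 'n::{finite,linorder}) \<times> real) \<times> real)"
  have g_in: "g ` cone_cylinder \<subseteq> q_cylinder q cube_cone"
    unfolding g_def q_cylinder_def using q0 by fastforce
  have gls: "ls_lipschitz_on cone_cylinder g"
    unfolding g_def by (intro ls_lipschitz_intros ls_lipschitz_on_compose[OF _ _ qls]) auto
  obtain Cg where Cg: "Cg \<ge> 0" "\<And>p p'. p \<in> cone_cylinder \<Longrightarrow> p' \<in> cone_cylinder \<Longrightarrow>
      dist (g p) (g p') \<le> Cg * (dist p p' + 1)"
    using gls by (elim ls_lipschitz_onE) blast
  obtain S where S: "\<And>p p'. p \<in> q_cylinder q cube_cone \<Longrightarrow> p' \<in> q_cylinder q cube_cone \<Longrightarrow>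
      dist p p' < Cg * 2 + 1 \<Longrightarrow> dist (H p) (H p') < S"
  proof -
    have "controlled_on (q_cylinder q cube_cone) H" using Hc unfolding coarse_map_def by (elim conjE)
    moreover have "Cg * 2 + 1 > 0" using Cg(1) by simp
    ultimately show thesis using that unfolding controlled_on_def by blast
  qed
  have ls: "ls_lipschitz_on cone_cylinder (\<lambda>p. H (g p))"
  proof (rule ls_lipschitz_on_convexI[OF convex_cone_cylinder, of _ S])
    fix p p' :: "(((real ^ 'n::{finite,linorder}) \<times> real) \<times> real)" assume p: "p \<in> cone_cylinder" "p' \<in> cone_cylinder" "dist p p' \<le> 1"
    have "dist (g p) (g p') \<le> Cg * 2"
      using Cg(2)[OF p(1,2)] mult_left_mono[of "dist p p' + 1" 2 Cg] p(3) Cg(1) by linarith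
    then show "dist (H (g p)) (H (g p')) \<le> S"
      using subsetD[OF g_in imageI[OF p(1)]] subsetD[OF g_in imageI[OF p(2)]] by (intro less_imp_le S) auto
  qed
  have "long_homotopy (c + 1) F G (\<lambda>p. H (g p))"
    unfolding long_homotopy_def
  proof (intro conjI ballI allI impI ls)
    show "H (g (z, t)) \<in> metric_cone X" if "z \<in> cube_cone" "0 \<le> t" for z t
    proof -
      have "g (z, t) \<in> q_cylinder q cube_cone" using that by (intro subsetD[OF g_in] imageI) simp
      then show ?thesis using Hc unfolding coarse_map_def by blast
    qed
    show "\<exists>N. \<forall>z\<in>cube_cone. \<forall>t\<ge>0. snd (H (g (z, t))) \<le> M \<longrightarrow> snd z \<le> N" for M
    proof -
      let ?D = "{w \<in> metric_cone X. snd w \<le> M}"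
      have "bounded {p \<in> q_cylinder q cube_cone. H p \<in> ?D}"
        using Hc bounded_cone_iff[of ?D] unfolding coarse_map_def by auto
      then obtain N where N: "\<And>p. p \<in> q_cylinder q cube_cone \<Longrightarrow> H p \<in> ?D \<Longrightarrow> norm p \<le> N"
        unfolding bounded_iff by auto
      have "snd z \<le> N" if "z \<in> cube_cone" "0 \<le> t" "snd (H (g (z, t))) \<le> M" for z t
      proof -
        have p: "g (z, t) \<in> q_cylinder q cube_cone" using that by (intro subsetD[OF g_in] imageI) simp
        moreover from p have "H (g (z, t)) \<in> metric_cone X" using Hc unfolding coarse_map_def by blast
        ultimately have "norm (g (z, t)) \<le> N" using N[OF p] that(3) by simp
        moreover have "snd z \<le> norm z" using norm_snd_le[of "snd z" "fst z"] by simp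
        moreover have "norm z \<le> norm (g (z, t))" unfolding g_def by (simp add: norm_fst_le)
        ultimately show ?thesis by linarith
      qed
      then show ?thesis by blast
    qed
    show "H (g (z, t)) \<in> metric_cone X0" if "z \<in> metric_cone (frontier unit_cube)" "0 \<le> t" for z t
      using fr[OF that(1), of "min t (q z + 1)"] that(2) q0[OF subsetD[OF cone_frontier_subset that(1)]]
      unfolding g_def by simp
    show "H (g (z, t)) = (snd z *\<^sub>R x0, snd z)" if "z \<in> metric_cone boundary_plus" "0 \<le> t" for z t
      using bp[OF that(1), of "min t (q z + 1)"] that(2)
        q0[OF subsetD[OF cone_frontier_subset subsetD[OF cone_boundary_plus_subset that(1)]]]
      unfolding g_def cone_ray_def by simp
    show "1 \<le> c + 1" using c by simp
    show "H (g (z, 0)) = F z" if "z \<in> cube_cone" for z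
      using ends[OF that] q0[OF that] unfolding g_def by (simp add: min_def)
    show "H (g (z, t)) = G z" if "z \<in> cube_cone" "(c + 1) * (snd z + 1) \<le> t" for z t
    proof -
      have "q z + 1 \<le> (c + 1) * (snd z + 1)"
        using c(2)[OF that(1)] cube_coneD(1)[OF that(1)] by (simp add: algebra_simps)
      then have "min t (q z + 1) = q z + 1" using that(2) by simp
      then show ?thesis using ends[OF that(1)] unfolding g_def by simp
    qed
  qed
  then show "\<exists>K H. long_homotopy K F G H" by blast
next
  assume "\<exists>K H. long_homotopy K F G H"
  then obtain K H where H: "long_homotopy K F G H" by blast
  note D = long_homotopyD[OF H]
  define q where "q z = K * (snd z + 1)" for z :: "(real ^ 'n::{finite,linorder}) \<times> real"
  have q0: "q z \<ge> 0" "snd z \<le> q z" if "z \<in> cube_cone" for z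
  proof -
    have "1 * (snd z + 1) \<le> q z" unfolding q_def
      using D(6) cube_coneD(1)[OF that] by (intro mult_right_mono) auto
    then show "q z \<ge> 0" "snd z \<le> q z" using cube_coneD(1)[OF that] by auto
  qed
  have sub: "q_cylinder q cube_cone \<subseteq> cone_cylinder" unfolding q_cylinder_def by auto
  have "coarse_map cube_cone {0..} q" unfolding coarse_map_def
  proof (intro conjI allI impI)
    show "q ` cube_cone \<subseteq> {0..}" using q0 by auto
    show "controlled_on cube_cone q"
      unfolding q_def by (intro ls_lipschitz_on_controlled ls_lipschitz_intros)
    fix S :: "real set" assume "bounded S"
    then obtain B where B: "\<And>s. s \<in> S \<Longrightarrow> \<bar>s\<bar> \<le> B" unfolding bounded_iff by auto
    have "norm z \<le> (real CARD('n) + 1) * B" if "z \<in> cube_cone" "q z \<in> S" for z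
    proof -
      have "snd z \<le> B" using q0[OF that(1)] B[OF that(2)] by simp
      then show ?thesis using norm_cube_cone[OF that(1)]
        by (smt (verit) mult_left_mono of_nat_0_le_iff)
    qed
    then show "bounded {z \<in> cube_cone. q z \<in> S}" by (intro boundedI) auto
  qed
  moreover have "coarse_map (q_cylinder q cube_cone) (metric_cone X) H" unfolding coarse_map_def
  proof (intro conjI allI impI)
    show "H ` q_cylinder q cube_cone \<subseteq> metric_cone X" using D(1) sub by auto
    show "controlled_on (q_cylinder q cube_cone) H"
      by (rule ls_lipschitz_on_controlled[OF ls_lipschitz_on_subset[OF D(2) sub]])
    fix S assume S: "S \<subseteq> metric_cone X" "bounded S"
    obtain M where M: "\<And>w. w \<in> S \<Longrightarrow> snd w \<le> M" using bounded_cone_iff[OF S(1)] S(2) by blast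
    obtain N where N: "\<And>z t. z \<in> cube_cone \<Longrightarrow> t \<ge> 0 \<Longrightarrow> snd (H (z, t)) \<le> M \<Longrightarrow> snd z \<le> N"
      using D(3) by blast
    have "norm p \<le> (real CARD('n) + 1) * N + (K * (N + 1) + 1)"
      if p: "p \<in> q_cylinder q cube_cone" "H p \<in> S" for p
    proof -
      obtain z t where eq: "p = (z, t)" by (cases p)
      have z: "z \<in> cube_cone" "0 \<le> t" "t \<le> q z + 1" using p eq unfolding q_cylinder_def by auto
      have h: "snd z \<le> N" using N z M p(2) eq by auto
      have "norm p \<le> norm z + norm t" unfolding eq by (rule norm_Pair_le)
      moreover have "norm z \<le> (real CARD('n) + 1) * N"
        using norm_cube_cone[OF z(1)] h by (smt (verit) mult_left_mono of_nat_0_le_iff)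
      moreover have "q z \<le> K * (N + 1)" unfolding q_def using h D(6) by (intro mult_left_mono) auto
      ultimately show ?thesis using z by simp
    qed
    then show "bounded {p \<in> q_cylinder q cube_cone. H p \<in> S}" by (intro boundedI) auto
  qed
  ultimately have "coarse_homotopy cube_cone (metric_cone X) q H F G"
    unfolding coarse_homotopy_def using D(7,8) by (auto simp: q_def)
  then show "(F, G) \<in> coarse_htpy"
    unfolding coarse_rel_homotopy_def mem_Collect_eq case_prod_conv
    using long_homotopy_maps[OF H] D(4,5) by (auto simp: cone_ray_def intro!: exI[of _ q] exI[of _ H])
qed

lemma coarse_htpyI: "long_homotopy K F G H \<Longrightarrow> (F, G) \<in> coarse_htpy"
  using coarse_htpy_iff by blast

lemma coarse_htpy_maps: "(F, G) \<in> coarse_htpy \<Longrightarrow> F \<in> coarse_maps \<and> G \<in> coarse_maps"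
  unfolding coarse_rel_homotopy_def by blast

lemma coarse_htpy_refl:
  fixes F :: "(real ^ 'n::{finite,linorder}) \<times> real \<Rightarrow> 'b \<times> real"
  assumes F: "F \<in> coarse_maps"
  shows "(F, F) \<in> coarse_htpy"
proof (rule coarse_htpyI)
  show "long_homotopy 1 F F (\<lambda>p. F (fst p))"
    unfolding long_homotopy_def fst_conv
  proof (intro conjI ballI allI impI)
    show "ls_lipschitz_on cone_cylinder (\<lambda>p. F (fst p))"
      by (rule ls_lipschitz_on_compose[OF _ _ coarse_mapsD(2)[OF F]]) (auto intro: ls_lipschitz_intros)
    show "\<exists>N. \<forall>z\<in>cube_cone. \<forall>t\<ge>0. snd (F z) \<le> M \<longrightarrow> snd z \<le> N" for M
      using coarse_mapsD(3)[OF F] unfolding height_proper_def by blast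
  qed (use coarse_mapsD[OF F] in auto)
qed

lemma coarse_htpy_sym:
  fixes F :: "(real ^ 'n::{finite,linorder}) \<times> real \<Rightarrow> 'b \<times> real"
  assumes "(F, G) \<in> coarse_htpy"
  shows "(G, F) \<in> coarse_htpy"
proof -
  obtain K H where H: "long_homotopy K F G H" using assms coarse_htpy_iff by blast
  note D = long_homotopyD[OF H]
  define s where "s z t = max 0 (K * (snd z + 1) - t)" for z :: "(real ^ 'n::{finite,linorder}) \<times> real" and t
  have s0: "s z t \<ge> 0" for z t unfolding s_def by simp
  show ?thesis
  proof (rule coarse_htpyI)
    show "long_homotopy K G F (\<lambda>p. H (fst p, s (fst p) (snd p)))"
      unfolding long_homotopy_def fst_conv snd_conv
    proof (intro conjI ballI allI impI)
      show "ls_lipschitz_on cone_cylinder (\<lambda>p. H (fst p, s (fst p) (snd p)))"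
      proof (rule ls_lipschitz_on_compose[OF _ _ D(2)])
        show "ls_lipschitz_on cone_cylinder (\<lambda>p. (fst p, s (fst p) (snd p)))"
          unfolding s_def by (intro ls_lipschitz_intros)
      qed (use s0 in auto)
      show "\<exists>N. \<forall>z\<in>cube_cone. \<forall>t\<ge>0. snd (H (z, s z t)) \<le> M \<longrightarrow> snd z \<le> N" for M
        using D(3)[of M] s0 by meson
      show "H (z, s z 0) = G z" if z: "z \<in> cube_cone" for z
      proof (rule D(8)[OF z])
        show "K * (snd z + 1) \<le> s z 0" unfolding s_def by simp
      qed
      show "H (z, s z t) = F z" if z: "z \<in> cube_cone" "K * (snd z + 1) \<le> t" for z t
        using D(7)[OF z(1)] z(2) unfolding s_def by simp
    qed (use D(1,4,5,6) s0 in simp_all)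
  qed
qed

text \<open>The two homotopies are traversed one after the other. In the vector space containing the
  cone the concatenation is a sum of large-scale Lipschitz maps.\<close>

lemma coarse_htpy_trans:
  fixes F :: "(real ^ 'n::{finite,linorder}) \<times> real \<Rightarrow> 'b \<times> real"
  assumes "(F1, F) \<in> coarse_htpy" "(F, F2) \<in> coarse_htpy"
  shows "(F1, F2) \<in> coarse_htpy"
proof -
  obtain K1 H1' K2 H2' where "long_homotopy K1 F1 F H1'" "long_homotopy K2 F F2 H2'"
    using assms coarse_htpy_iff by metis
  then obtain K H1 H2 where H1: "long_homotopy K F1 F H1" and H2: "long_homotopy K F F2 H2"
    using long_homotopy_mono by (metis max.cobounded1 max.cobounded2)
  note D1 = long_homotopyD[OF H1] and D2 = long_homotopyD[OF H2]
  define T where "T z = K * (snd z + 1)" for z :: "(real ^ 'n::{finite,linorder}) \<times> real"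
  have T0: "T z \<ge> 0" if "z \<in> cube_cone" for z
    using D1(6) cube_coneD(1)[OF that] unfolding T_def by simp
  define H where "H p = (if snd p \<le> T (fst p) then H1 p else H2 (fst p, snd p - T (fst p)))" for p
  show ?thesis
  proof (rule coarse_htpyI)
    show "long_homotopy (2 * K) F1 F2 H" unfolding long_homotopy_def
    proof (intro conjI ballI allI impI)
      show "ls_lipschitz_on cone_cylinder H"
      proof (rule ls_lipschitz_on_cong)
        have F: "ls_lipschitz_on cube_cone F"
          by (rule coarse_mapsD(2)[OF long_homotopy_maps(1)[OF H2]])
        show "ls_lipschitz_on cone_cylinder
            (\<lambda>p. H1 (fst p, min (snd p) (T (fst p))) + H2 (fst p, max 0 (snd p - T (fst p))) - F (fst p))"
        proof (intro ls_lipschitz_on_add ls_lipschitz_on_diff)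
          show "ls_lipschitz_on cone_cylinder (\<lambda>p. H1 (fst p, min (snd p) (T (fst p))))"
            by (rule ls_lipschitz_on_compose[OF _ _ D1(2)])
              (use T0 in \<open>auto simp: T_def intro!: ls_lipschitz_intros\<close>)
          show "ls_lipschitz_on cone_cylinder (\<lambda>p. H2 (fst p, max 0 (snd p - T (fst p))))"
            by (rule ls_lipschitz_on_compose[OF _ _ D2(2)])
              (auto simp: T_def intro!: ls_lipschitz_intros)
          show "ls_lipschitz_on cone_cylinder (\<lambda>p. F (fst p))"
            by (rule ls_lipschitz_on_compose[OF _ _ F]) (auto intro: ls_lipschitz_intros)
        qed
        fix p :: "((real ^ 'n::{finite,linorder}) \<times> real) \<times> real" assume "p \<in> cone_cylinder"
        then have p: "fst p \<in> cube_cone" by auto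
        show "H1 (fst p, min (snd p) (T (fst p))) + H2 (fst p, max 0 (snd p - T (fst p))) - F (fst p) = H p"
          using D1(8)[OF p, of "T (fst p)"] D2(7)[OF p] unfolding H_def by (auto simp: T_def)
      qed
      show "\<exists>N. \<forall>z\<in>cube_cone. \<forall>t\<ge>0. snd (H (z, t)) \<le> M \<longrightarrow> snd z \<le> N" for M
      proof -
        obtain N1 N2 where
          N: "\<And>z t. z \<in> cube_cone \<Longrightarrow> t \<ge> 0 \<Longrightarrow> snd (H1 (z, t)) \<le> M \<Longrightarrow> snd z \<le> N1"
            "\<And>z t. z \<in> cube_cone \<Longrightarrow> t \<ge> 0 \<Longrightarrow> snd (H2 (z, t)) \<le> M \<Longrightarrow> snd z \<le> N2"
          using D1(3)[of M] D2(3)[of M] by metis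
        have "snd z \<le> max N1 N2" if "z \<in> cube_cone" "t \<ge> 0" "snd (H (z, t)) \<le> M" for z t
          using N(1)[OF that(1,2)] N(2)[OF that(1), of "t - T z"] that(3)
          by (auto simp: H_def max_def split: if_splits)
        then show ?thesis by blast
      qed
      show "H (z, 0) = F1 z" if "z \<in> cube_cone" for z
        using D1(7)[OF that] T0[OF that] unfolding H_def by simp
      show "H (z, t) = F2 z" if z: "z \<in> cube_cone" "2 * K * (snd z + 1) \<le> t" for z t
      proof -
        have "t - T z \<ge> K * (snd z + 1)" using z(2) unfolding T_def by (simp add: algebra_simps)
        moreover from this have "t > T z \<or> (t = T z \<and> T z = 0)"
          using T0[OF z(1)] unfolding T_def by linarith
        moreover have "T z > 0" using D1(6) cube_coneD(1)[OF z(1)] unfolding T_def by simp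
        ultimately show ?thesis using D2(8)[OF z(1)] unfolding H_def by simp
      qed
    qed (use D1(1,4,5,6) D2(1,4,5,6) in \<open>simp_all add: H_def\<close>)
  qed
qed

text \<open>Above height \<open>h0\<close> the homotopy runs along segments, which grow at most linearly with the
  height and are therefore traversed with bounded speed; below height \<open>h0\<close> everything is bounded,
  and a jump does no harm.\<close>

lemma coarse_htpy_linear:
  fixes F :: "(real ^ 'n::{finite,linorder}) \<times> real \<Rightarrow> 'b \<times> real"
  assumes F: "F \<in> coarse_maps" and G: "G \<in> coarse_maps"
    and seg: "\<And>z. z \<in> cube_cone \<Longrightarrow> snd z \<ge> h0 \<Longrightarrow> closed_segment (F z) (G z) \<subseteq> metric_cone X"
    and seg0: "\<And>z. z \<in> metric_cone (frontier unit_cube) \<Longrightarrow> snd z \<ge> h0 \<Longrightarrow>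
      closed_segment (F z) (G z) \<subseteq> metric_cone X0"
  shows "(F, G) \<in> coarse_htpy"
proof -
  note DF = coarse_mapsD[OF F] and DG = coarse_mapsD[OF G]
  define L where "L p = F (fst p) + ramp (snd (fst p)) (snd p) *\<^sub>R (G (fst p) - F (fst p))"
    for p :: "((real ^ 'n::{finite,linorder}) \<times> real) \<times> real"
  define H where "H p = (if snd (fst p) \<ge> h0 then L p else if snd p < snd (fst p) + 1 then F (fst p) else G (fst p))"
    for p :: "((real ^ 'n::{finite,linorder}) \<times> real) \<times> real"
  have Lseg: "L (z, t) \<in> closed_segment (F z) (G z)" if "z \<in> cube_cone" "t \<ge> 0" for z t
    unfolding L_def in_segment using ramp_range[OF cube_coneD(1)[OF that(1)] that(2)]
    by (intro exI[of _ "ramp (snd z) t"]) (simp add: algebra_simps)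
  have H_cases: "H (z, t) \<in> closed_segment (F z) (G z)" if "z \<in> cube_cone" "t \<ge> 0" for z t
    using Lseg[OF that] unfolding H_def by auto
  have GF: "ls_lipschitz_on cube_cone (\<lambda>z. G z - F z)" by (intro ls_lipschitz_on_diff DF(2) DG(2))
  obtain c where c: "c \<ge> 0" "\<And>z. z \<in> cube_cone \<Longrightarrow> norm (G z - F z) \<le> c * (snd z + 1)"
    using ls_lipschitz_growth[OF GF] by blast
  have Lls: "ls_lipschitz_on cone_cylinder L"
    unfolding L_def
  proof (rule ls_lipschitz_on_add)
    show "ls_lipschitz_on cone_cylinder (\<lambda>p. F (fst p))"
      by (rule ls_lipschitz_on_compose[OF _ _ DF(2)]) (auto intro: ls_lipschitz_intros)
  qed (rule ls_lipschitz_on_ramp[OF GF])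
  show ?thesis
  proof (rule coarse_htpyI)
    show "long_homotopy 1 F G H" unfolding long_homotopy_def
    proof (intro conjI ballI allI impI)
      show "ls_lipschitz_on cone_cylinder H"
      proof (rule ls_lipschitz_on_close[OF Lls])
        fix p :: "((real ^ 'n::{finite,linorder}) \<times> real) \<times> real" assume "p \<in> cone_cylinder"
        then obtain z t where p: "p = (z, t)" "z \<in> cube_cone" "t \<ge> 0" by auto
        show "dist (L p) (H p) \<le> c * (\<bar>h0\<bar> + 1)"
        proof (cases "snd z \<ge> h0")
          case True
          then show ?thesis using c(1) unfolding H_def p by simp
        next
          case False
          have "dist (L p) (H p) \<le> dist (F z) (G z)"
          proof -
            have "H p = F z \<or> H p = G z" using False unfolding H_def p by simp
            then show ?thesis using Lseg[OF p(2,3)] dist_in_closed_segment[of "L p" "F z" "G z"]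
              unfolding p by (auto simp: dist_commute)
          qed
          also have "\<dots> \<le> c * (snd z + 1)" using c(2)[OF p(2)] by (simp add: dist_norm norm_minus_commute)
          also have "\<dots> \<le> c * (\<bar>h0\<bar> + 1)" using False c(1) by (intro mult_left_mono) auto
          finally show ?thesis .
        qed
      qed
      show "\<exists>N. \<forall>z\<in>cube_cone. \<forall>t\<ge>0. snd (H (z, t)) \<le> M \<longrightarrow> snd z \<le> N" for M
      proof -
        obtain N1 N2 where N: "\<And>z. z \<in> cube_cone \<Longrightarrow> snd (F z) \<le> M \<Longrightarrow> snd z \<le> N1"
            "\<And>z. z \<in> cube_cone \<Longrightarrow> snd (G z) \<le> M \<Longrightarrow> snd z \<le> N2"
          using DF(3) DG(3) unfolding height_proper_def by metis
        have "snd z \<le> max N1 N2" if z: "z \<in> cube_cone" "t \<ge> 0" "snd (H (z, t)) \<le> M" for z t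
        proof -
          obtain u where u: "0 \<le> u" "u \<le> 1" "H (z, t) = (1 - u) *\<^sub>R F z + u *\<^sub>R G z"
            using H_cases[OF z(1,2)] unfolding in_segment by blast
          have "min (snd (F z)) (snd (G z)) \<le> (1 - u) * snd (F z) + u * snd (G z)"
          proof -
            have "(1 - u) * min (snd (F z)) (snd (G z)) + u * min (snd (F z)) (snd (G z))
                \<le> (1 - u) * snd (F z) + u * snd (G z)"
              using u by (intro add_mono mult_left_mono) auto
            then show ?thesis by (simp add: algebra_simps)
          qed
          then have "snd (F z) \<le> M \<or> snd (G z) \<le> M" using z(3) u(3) by auto
          then show ?thesis using N[OF z(1)] by (auto simp: max_def)
        qed
        then show ?thesis by blast
      qed
      show "H (z, t) \<in> metric_cone X" if z: "z \<in> cube_cone" "t \<ge> 0" for z t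
        using Lseg[OF z] seg[OF z(1)] DF(1)[OF z(1)] DG(1)[OF z(1)] unfolding H_def by auto
      show "H (z, t) \<in> metric_cone X0" if z: "z \<in> metric_cone (frontier unit_cube)" "t \<ge> 0" for z t
        using Lseg[OF subsetD[OF cone_frontier_subset z(1)] z(2)] seg0[OF z(1)] DF(4)[OF z(1)] DG(4)[OF z(1)]
        unfolding H_def by auto
      show "H (z, t) = (snd z *\<^sub>R x0, snd z)" if z: "z \<in> metric_cone boundary_plus" "t \<ge> 0" for z t
        using DF(5)[OF z(1)] DG(5)[OF z(1)] unfolding H_def L_def by simp
      show "H (z, 0) = F z" if z: "z \<in> cube_cone" for z
        using cube_coneD(1)[OF z] unfolding H_def L_def by (simp add: ramp_0)
      show "H (z, t) = G z" if z: "z \<in> cube_cone" "1 * (snd z + 1) \<le> t" for z t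
        using cube_coneD(1)[OF z(1)] z(2) unfolding H_def L_def by (simp add: ramp_1)
    qed simp
  qed
qed

text \<open>A motion of the base point at constant height is controlled if it is slow in comparison with
  the inverse of the height. At the apex all base points give the same point of the cone, hence the
  case distinction over \<open>boundary_plus\<close>.\<close>

lemma coarse_htpy_constant_height:
  fixes A :: "(real ^ 'n::{finite,linorder}) \<times> real \<Rightarrow> real" and \<omega> :: "_ \<Rightarrow> 'b"
  assumes A: "ls_lipschitz_on cube_cone A" "\<And>z. z \<in> cube_cone \<Longrightarrow> 0 \<le> A z" "height_proper A"
    and slow: "\<And>z t z' t'. z \<in> cube_cone \<Longrightarrow> z' \<in> cube_cone \<Longrightarrow> 0 \<le> t \<Longrightarrow> 0 \<le> t' \<Longrightarrow>
        dist z z' \<le> 1 \<Longrightarrow> \<bar>t - t'\<bar> \<le> 1 \<Longrightarrow> A z * dist (\<omega> (z, t)) (\<omega> (z', t')) \<le> C"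
    and X: "\<And>z t. z \<in> cube_cone \<Longrightarrow> 0 \<le> t \<Longrightarrow> \<omega> (z, t) \<in> X"
    and X0: "\<And>z t. z \<in> metric_cone (frontier unit_cube) \<Longrightarrow> 0 \<le> t \<Longrightarrow> \<omega> (z, t) \<in> X0"
    and bp: "\<And>z t. z \<in> metric_cone boundary_plus \<Longrightarrow> 0 \<le> t \<Longrightarrow>
        A z = snd z \<and> (snd z \<noteq> 0 \<longrightarrow> \<omega> (z, t) = x0)"
    and fin: "K \<ge> 1" "\<And>z t. z \<in> cube_cone \<Longrightarrow> K * (snd z + 1) \<le> t \<Longrightarrow> \<omega> (z, t) = \<omega>' z"
  shows "((\<lambda>z. (A z *\<^sub>R \<omega> (z, 0), A z)), (\<lambda>z. (A z *\<^sub>R \<omega>' z, A z))) \<in> coarse_htpy"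
proof (rule coarse_htpyI)
  let ?H = "\<lambda>p. (A (fst p) *\<^sub>R \<omega> p, A (fst p))"
  obtain B where B: "\<And>x. x \<in> X \<Longrightarrow> norm x \<le> B" "B > 0" using bounded_X bounded_pos by metis
  obtain CA where CA: "CA \<ge> 0" "\<And>z z'. z \<in> cube_cone \<Longrightarrow> z' \<in> cube_cone \<Longrightarrow>
      dist (A z) (A z') \<le> CA * (dist z z' + 1)"
    using A(1) by (elim ls_lipschitz_onE) blast
  show "long_homotopy K (\<lambda>z. (A z *\<^sub>R \<omega> (z, 0), A z)) (\<lambda>z. (A z *\<^sub>R \<omega>' z, A z)) ?H"
    unfolding long_homotopy_def fst_conv snd_conv
  proof (intro conjI ballI allI impI)
    show "ls_lipschitz_on cone_cylinder ?H"
    proof (rule ls_lipschitz_on_convexI[OF convex_cone_cylinder])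
      fix p p' :: "((real ^ 'n::{finite,linorder}) \<times> real) \<times> real"
      assume p: "p \<in> cone_cylinder" "p' \<in> cone_cylinder" "dist p p' \<le> 1"
      obtain z t z' t' where eq: "p = (z, t)" "p' = (z', t')" by (metis surj_pair)
      have z: "z \<in> cube_cone" "z' \<in> cube_cone" "0 \<le> t" "0 \<le> t'" using p eq by auto
      have d: "dist z z' \<le> 1" "\<bar>t - t'\<bar> \<le> 1"
        using dist_fst_le[of p p'] dist_snd_le[of p p'] p(3) unfolding eq by (auto simp: dist_real_def)
      have dA: "dist (A z) (A z') \<le> CA * 2"
        using CA(2)[OF z(1,2)] mult_left_mono[of "dist z z' + 1" 2 CA] d(1) CA(1) by linarith
      have "A z *\<^sub>R \<omega> p - A z' *\<^sub>R \<omega> p' = A z *\<^sub>R (\<omega> p - \<omega> p') + (A z - A z') *\<^sub>R \<omega> p'"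
        by (simp add: algebra_simps)
      then have "dist (A z *\<^sub>R \<omega> p) (A z' *\<^sub>R \<omega> p') \<le> A z * dist (\<omega> p) (\<omega> p') + dist (A z) (A z') * norm (\<omega> p')"
        using A(2)[OF z(1)] unfolding dist_norm by (metis abs_of_nonneg norm_scaleR norm_triangle_ineq real_norm_def)
      also have "\<dots> \<le> C + CA * 2 * B"
        using slow[OF z d] dA CA(1) B(1)[OF X[OF z(2,4)]] unfolding eq
        by (intro add_mono mult_mono) auto
      finally show "dist (?H p) (?H p') \<le> (C + CA * 2 * B) + CA * 2"
        using dA dist_Pair_le[of "A z *\<^sub>R \<omega> p" "A z" "A z' *\<^sub>R \<omega> p'" "A z'"] unfolding eq by simp
    qed
    show "\<exists>N. \<forall>z\<in>cube_cone. \<forall>t\<ge>0. A z \<le> M \<longrightarrow> snd z \<le> N" for M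
      using A(3) unfolding height_proper_def by blast
    show "(A z *\<^sub>R \<omega> (z, t), A z) \<in> metric_cone X" if "z \<in> cube_cone" "0 \<le> t" for z t
      by (intro scaled_in_metric_cone A(2) X that)
    show "(A z *\<^sub>R \<omega> (z, t), A z) \<in> metric_cone X0" if "z \<in> metric_cone (frontier unit_cube)" "0 \<le> t" for z t
      by (intro scaled_in_metric_cone A(2) X0 that subsetD[OF cone_frontier_subset])
    show "(A z *\<^sub>R \<omega> (z, t), A z) = (snd z *\<^sub>R x0, snd z)" if "z \<in> metric_cone boundary_plus" "0 \<le> t" for z t
      using bp[OF that] by (cases "snd z = 0") auto
    show "(A z *\<^sub>R \<omega> (z, t), A z) = (A z *\<^sub>R \<omega>' z, A z)" if "z \<in> cube_cone" "K * (snd z + 1) \<le> t" for z t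
      using fin(2)[OF that] by simp
  qed (use fin(1) in auto)
qed

lemma closed_segment_in_cone:
  assumes a: "0 \<le> a" "0 \<le> a'" and seg: "closed_segment y y' \<subseteq> Y"
  shows "closed_segment (a *\<^sub>R y, a) (a' *\<^sub>R y', a') \<subseteq> metric_cone Y"
proof
  fix w assume "w \<in> closed_segment (a *\<^sub>R y, a) (a' *\<^sub>R y', a')"
  then obtain u where u: "0 \<le> u" "u \<le> 1" "w = (1 - u) *\<^sub>R (a *\<^sub>R y, a) + u *\<^sub>R (a' *\<^sub>R y', a')"
    unfolding in_segment by blast
  define b where "b = (1 - u) * a + u * a'"
  have w: "w = (((1 - u) * a) *\<^sub>R y + (u * a') *\<^sub>R y', b)" unfolding u b_def by simp
  have nn: "(1 - u) * a \<ge> 0" "u * a' \<ge> 0" using u a by auto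
  show "w \<in> metric_cone Y"
  proof (cases "b = 0")
    case True
    then have z: "(1 - u) * a = 0" "u * a' = 0" using nn unfolding b_def by linarith+
    have "w = (0 *\<^sub>R y, 0)" unfolding w z True by simp
    moreover have "y \<in> Y" using seg by auto
    ultimately show ?thesis using scaled_in_metric_cone by (metis order_refl)
  next
    case False
    then have b: "b > 0" using nn unfolding b_def by linarith
    define v where "v = u * a' / b"
    have v: "0 \<le> v" "v \<le> 1" "1 - v = (1 - u) * a / b"
      using nn b unfolding v_def b_def by (auto simp: field_simps)
    have "b *\<^sub>R ((1 - v) *\<^sub>R y + v *\<^sub>R y') = ((1 - u) * a) *\<^sub>R y + (u * a') *\<^sub>R y'"
      unfolding v(3) using b unfolding v_def by (simp add: scaleR_add_right)
    then have "w = (b *\<^sub>R ((1 - v) *\<^sub>R y + v *\<^sub>R y'), b)" unfolding w by simp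
    moreover have "(1 - v) *\<^sub>R y + v *\<^sub>R y' \<in> Y"
      using v seg unfolding in_segment subset_iff by blast
    ultimately show ?thesis using b scaled_in_metric_cone by (metis less_imp_le)
  qed
qed

end

section \<open>Classical relative maps and their homotopies\<close>

lemma rel_maps_iff:
  "u \<in> rel_maps X X0 x0 \<longleftrightarrow>
     continuous_on unit_cube u \<and> (\<forall>x\<in>unit_cube. u x \<in> X) \<and>
     (\<forall>x\<in>frontier unit_cube. u x \<in> X0) \<and> (\<forall>x\<in>boundary_plus. u x = x0)"
  unfolding rel_maps_def is_rel_map_def by blast

lemma rel_mapsD:
  assumes "u \<in> rel_maps X X0 x0"
  shows "continuous_on unit_cube u" "x \<in> unit_cube \<Longrightarrow> u x \<in> X"
    "x \<in> frontier unit_cube \<Longrightarrow> u x \<in> X0" "x \<in> boundary_plus \<Longrightarrow> u x = x0"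
  using assms unfolding rel_maps_iff by blast+

lemma rel_homotopy_iff:
  fixes u v :: "real ^ 'n::{finite,linorder} \<Rightarrow> 'b::euclidean_space"
  shows "(u, v) \<in> rel_homotopy X X0 x0 \<longleftrightarrow>
    (\<exists>k. continuous_on ({0..1::real} \<times> unit_cube) k \<and>
       (\<forall>t\<in>{0..1}. \<forall>x\<in>unit_cube. k (t, x) \<in> X) \<and>
       (\<forall>t\<in>{0..1}. \<forall>x\<in>frontier unit_cube. k (t, x) \<in> X0) \<and>
       (\<forall>t\<in>{0..1}. \<forall>x\<in>boundary_plus. k (t, x) = x0) \<and>
       (\<forall>x\<in>unit_cube. k (0, x) = u x \<and> k (1, x) = v x))"
  (is "_ \<longleftrightarrow> ?R")
proof -
  have resp: "is_rel_map X0 x0 h \<longleftrightarrow> is_rel_map X0 x0 k" if "\<And>x. x \<in> topspace (top_of_set unit_cube) \<Longrightarrow> h x = k x"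
    for h k :: "real ^ 'n::{finite,linorder} \<Rightarrow> 'b"
  proof -
    have e: "h x = k x" if "x \<in> frontier unit_cube" for x
      using \<open>\<And>x. x \<in> topspace (top_of_set unit_cube) \<Longrightarrow> h x = k x\<close> subsetD[OF frontier_cube_subset that] by simp
    have "h ` frontier unit_cube = k ` frontier unit_cube" using e by (rule image_cong[OF refl])
    moreover have "h ` boundary_plus = k ` boundary_plus"
      by (rule image_cong[OF refl]) (use e boundary_plus_subset in blast)
    ultimately show ?thesis unfolding is_rel_map_def by simp
  qed
  have hw: "homotopic_with (is_rel_map X0 x0) (top_of_set unit_cube) (top_of_set X) u v \<longleftrightarrow>
      (\<exists>k. continuous_map (prod_topology (top_of_set {0..1::real}) (top_of_set unit_cube)) (top_of_set X) k \<and>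
        (\<forall>x\<in>topspace (top_of_set unit_cube). k (0, x) = u x) \<and>
        (\<forall>x\<in>topspace (top_of_set unit_cube). k (1, x) = v x) \<and>
        (\<forall>t\<in>{0..1}. is_rel_map X0 x0 (\<lambda>x. k (t, x))))"
    by (rule homotopic_with) (rule resp)
  have top: "continuous_map (prod_topology (top_of_set {0..1::real}) (top_of_set unit_cube)) (top_of_set X) k \<longleftrightarrow>
      continuous_on ({0..1} \<times> unit_cube) k \<and> (\<forall>t\<in>{0..1}. \<forall>x\<in>unit_cube. k (t, x) \<in> X)"
    for k :: "real \<times> (real ^ 'n::{finite,linorder}) \<Rightarrow> 'b"
    by (auto simp: prod_topology_subtopology_eu image_subset_iff)
  show ?thesis
  proof
    assume "(u, v) \<in> rel_homotopy X X0 x0"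
    then have "homotopic_with (is_rel_map X0 x0) (top_of_set unit_cube) (top_of_set X) u v"
      unfolding rel_homotopy_def by blast
    from iffD1[OF hw this] obtain k where
      k: "continuous_map (prod_topology (top_of_set {0..1::real}) (top_of_set unit_cube)) (top_of_set X) k"
      "\<forall>x\<in>topspace (top_of_set unit_cube). k (0, x) = u x"
      "\<forall>x\<in>topspace (top_of_set unit_cube). k (1, x) = v x"
      "\<forall>t\<in>{0..1}. is_rel_map X0 x0 (\<lambda>x. k (t, x))"
      by (elim exE conjE)
    show ?R
      by (rule exI[of _ k]) (use k(1)[unfolded top] k(2-4) in \<open>simp add: is_rel_map_def image_subset_iff\<close>)
  next
    assume ?R
    then obtain k where kc: "continuous_on ({0..1::real} \<times> unit_cube) k"
      and k': "\<forall>t\<in>{0..1}. \<forall>x\<in>unit_cube. k (t, x) \<in> X"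
      "\<forall>t\<in>{0..1}. \<forall>x\<in>frontier unit_cube. k (t, x) \<in> X0"
      "\<forall>t\<in>{0..1}. \<forall>x\<in>boundary_plus. k (t, x) = x0"
      "\<forall>x\<in>unit_cube. k (0, x) = u x \<and> k (1, x) = v x"
      by (elim exE conjE)
    have k: "continuous_on ({0..1::real} \<times> unit_cube) k"
      "\<And>t x. t \<in> {0..1} \<Longrightarrow> x \<in> unit_cube \<Longrightarrow> k (t, x) \<in> X"
      "\<And>t x. t \<in> {0..1} \<Longrightarrow> x \<in> frontier unit_cube \<Longrightarrow> k (t, x) \<in> X0"
      "\<And>t x. t \<in> {0..1} \<Longrightarrow> x \<in> boundary_plus \<Longrightarrow> k (t, x) = x0"
      "\<And>x. x \<in> unit_cube \<Longrightarrow> k (0, x) = u x" "\<And>x. x \<in> unit_cube \<Longrightarrow> k (1, x) = v x"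
      using kc k' by simp_all
    have slice: "w \<in> rel_maps X X0 x0" if "t \<in> {0..1}" "\<And>x. x \<in> unit_cube \<Longrightarrow> k (t, x) = w x" for w t
    proof -
      have "continuous_on unit_cube (\<lambda>x. k (t, x))"
        by (rule continuous_on_compose2[OF k(1)]) (use that(1) in \<open>auto intro!: continuous_intros\<close>)
      then have "continuous_on unit_cube w" by (rule continuous_on_eq) (rule that(2))
      moreover have "w x \<in> X" if "x \<in> unit_cube" for x
        using k(2)[OF \<open>t \<in> {0..1}\<close> that] \<open>\<And>x. x \<in> unit_cube \<Longrightarrow> k (t, x) = w x\<close>[OF that] by simp
      moreover have "w x \<in> X0" if "x \<in> frontier unit_cube" for x
        using k(3)[OF \<open>t \<in> {0..1}\<close> that]
          \<open>\<And>x. x \<in> unit_cube \<Longrightarrow> k (t, x) = w x\<close>[OF subsetD[OF frontier_cube_subset that]] by simp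
      moreover have "w x = x0" if "x \<in> boundary_plus" for x
        using k(4)[OF \<open>t \<in> {0..1}\<close> that] \<open>\<And>x. x \<in> unit_cube \<Longrightarrow> k (t, x) = w x\<close>[OF
            subsetD[OF frontier_cube_subset subsetD[OF boundary_plus_subset that]]] by simp
      ultimately show ?thesis unfolding rel_maps_iff by simp
    qed
    have "homotopic_with (is_rel_map X0 x0) (top_of_set unit_cube) (top_of_set X) u v"
      unfolding hw top unfolding is_rel_map_def image_subset_iff topspace_euclidean_subtopology singleton_iff
      by (intro exI[of _ k] conjI ballI k) auto
    then show "(u, v) \<in> rel_homotopy X X0 x0"
      unfolding rel_homotopy_def using slice[of 0 u] slice[of 1 v] k(5,6) by auto
  qed
qed

lemma rel_homotopyI:
  fixes k :: "real \<times> (real ^ 'n::{finite,linorder}) \<Rightarrow> 'b::euclidean_space"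
  assumes "continuous_on ({0..1} \<times> unit_cube) k"
    "\<And>t x. t \<in> {0..1} \<Longrightarrow> x \<in> unit_cube \<Longrightarrow> k (t, x) \<in> X"
    "\<And>t x. t \<in> {0..1} \<Longrightarrow> x \<in> frontier unit_cube \<Longrightarrow> k (t, x) \<in> X0"
    "\<And>t x. t \<in> {0..1} \<Longrightarrow> x \<in> boundary_plus \<Longrightarrow> k (t, x) = x0"
    "\<And>x. x \<in> unit_cube \<Longrightarrow> k (0, x) = u x" "\<And>x. x \<in> unit_cube \<Longrightarrow> k (1, x) = v x"
  shows "(u, v) \<in> rel_homotopy X X0 x0"
  by (rule iffD2[OF rel_homotopy_iff], intro exI[of _ k] conjI ballI assms)

lemma rel_homotopyE:
  fixes u :: "real ^ 'n::{finite,linorder} \<Rightarrow> 'b::euclidean_space"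
  assumes "(u, v) \<in> rel_homotopy X X0 x0"
  obtains k where "continuous_on ({0..1::real} \<times> unit_cube) k"
    "\<forall>t\<in>{0..1}. \<forall>x\<in>unit_cube. k (t, x) \<in> X"
    "\<forall>t\<in>{0..1}. \<forall>x\<in>frontier unit_cube. k (t, x) \<in> X0"
    "\<forall>t\<in>{0..1}. \<forall>x\<in>boundary_plus. k (t, x) = x0"
    "\<forall>x\<in>unit_cube. k (0, x) = u x \<and> k (1, x) = v x"
  using iffD1[OF rel_homotopy_iff assms] by (elim exE conjE)

lemma rel_homotopy_maps: "(u, v) \<in> rel_homotopy X X0 x0 \<Longrightarrow> u \<in> rel_maps X X0 x0 \<and> v \<in> rel_maps X X0 x0"
  unfolding rel_homotopy_def by blast

lemma equiv_rel_homotopy: "equiv (rel_maps X X0 x0) (rel_homotopy X X0 x0)"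
proof (rule equivI)
  show "rel_homotopy X X0 x0 \<subseteq> rel_maps X X0 x0 \<times> rel_maps X X0 x0"
    unfolding rel_homotopy_def by blast
  show "refl_on (rel_maps X X0 x0) (rel_homotopy X X0 x0)"
    unfolding refl_on_def rel_homotopy_def by (auto simp: rel_maps_def)
  show "sym (rel_homotopy X X0 x0)"
    unfolding sym_def rel_homotopy_def using homotopic_with_symD by auto
  show "trans (rel_homotopy X X0 x0)"
    unfolding trans_def rel_homotopy_def using homotopic_with_trans by auto
qed

lemma rel_homotopy_linear:
  assumes u: "u \<in> rel_maps X X0 x0" and v: "continuous_on unit_cube v"
    and seg: "\<And>x. x \<in> unit_cube \<Longrightarrow> closed_segment (u x) (v x) \<subseteq> X"
    and seg0: "\<And>x. x \<in> frontier unit_cube \<Longrightarrow> closed_segment (u x) (v x) \<subseteq> X0"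
    and bp: "\<And>x. x \<in> boundary_plus \<Longrightarrow> v x = x0"
  shows "(u, v) \<in> rel_homotopy X X0 x0"
proof (rule rel_homotopyI)
  let ?k = "\<lambda>p. (1 - fst p) *\<^sub>R u (snd p) + fst p *\<^sub>R v (snd p)"
  have in_seg: "?k (t, x) \<in> closed_segment (u x) (v x)" if "t \<in> {0..1}" for t x
    using that unfolding in_segment by auto
  show "continuous_on ({0..1} \<times> unit_cube) ?k"
    by (intro continuous_intros continuous_on_compose2[OF rel_mapsD(1)[OF u]] continuous_on_compose2[OF v]) auto
  show "?k (t, x) \<in> X" if "t \<in> {0..1}" "x \<in> unit_cube" for t x using in_seg that seg by blast
  show "?k (t, x) \<in> X0" if "t \<in> {0..1}" "x \<in> frontier unit_cube" for t x using in_seg that seg0 by blast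
  show "?k (t, x) = x0" if "x \<in> boundary_plus" for t x
    using bp[OF that] rel_mapsD(4)[OF u that] by (simp add: algebra_simps)
qed auto

lemma rel_homotopy_cong:
  assumes u: "u \<in> rel_maps X X0 x0" and eq: "\<And>x. x \<in> unit_cube \<Longrightarrow> u x = v x"
  shows "(u, v) \<in> rel_homotopy X X0 x0"
proof (rule rel_homotopyI)
  show "continuous_on ({0..1} \<times> unit_cube) (\<lambda>p. u (snd p))"
    by (rule continuous_on_compose2[OF rel_mapsD(1)[OF u]]) (auto intro: continuous_intros)
qed (use rel_mapsD[OF u] eq in auto)

section \<open>The comparison of Lipschitz maps and their cones\<close>

text \<open>What is needed of the polyhedral structure of \<open>X\<close>: an error below \<open>\<epsilon>\<close> can be corrected by
  \<open>\<rho>\<close>, and the corrected point is joined to the original one by a segment in \<open>X\<close> or, starting from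
  a point of \<open>X0\<close>, in \<open>X0\<close>.\<close>

locale approximable_pair = pointed_pair X X0 x0
  for X X0 :: "'b::euclidean_space set" and x0 :: 'b +
  fixes \<epsilon> L :: real and \<rho> :: "'b \<Rightarrow> 'b"
  assumes eps: "\<epsilon> > 0"
    and lipschitz_\<rho>: "L-lipschitz_on {y. \<exists>x\<in>X. dist x y < \<epsilon>} \<rho>"
    and segment_X: "x \<in> X \<Longrightarrow> dist x y < \<epsilon> \<Longrightarrow> closed_segment x (\<rho> y) \<subseteq> X"
    and segment_X0: "x \<in> X0 \<Longrightarrow> dist x y < \<epsilon> \<Longrightarrow> closed_segment x (\<rho> y) \<subseteq> X0"
    and \<rho>_x0: "dist x0 y < \<epsilon> \<Longrightarrow> \<rho> y = x0"
begin

lemma \<rho>_in_X: "x \<in> X \<Longrightarrow> dist x y < \<epsilon> \<Longrightarrow> \<rho> y \<in> X"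
  using segment_X by blast

lemma \<rho>_in_X0: "x \<in> X0 \<Longrightarrow> dist x y < \<epsilon> \<Longrightarrow> \<rho> y \<in> X0"
  using segment_X0 by blast

text \<open>The homotopy runs along the segments provided by the locale.\<close>

lemma rel_homotopy_approx:
  assumes u: "u \<in> rel_maps X X0 x0" and v: "continuous_on unit_cube (\<lambda>x. \<rho> (g x))"
    and near: "\<And>x. x \<in> unit_cube \<Longrightarrow> dist (u x) (g x) < \<epsilon>"
  shows "(u, \<lambda>x. \<rho> (g x)) \<in> rel_homotopy X X0 x0"
proof (rule rel_homotopy_linear[OF u v])
  show "closed_segment (u x) (\<rho> (g x)) \<subseteq> X" if "x \<in> unit_cube" for x
    by (rule segment_X[OF rel_mapsD(2)[OF u that] near[OF that]])
  show "closed_segment (u x) (\<rho> (g x)) \<subseteq> X0" if "x \<in> frontier unit_cube" for x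
    by (rule segment_X0[OF rel_mapsD(3)[OF u that] near[OF subsetD[OF frontier_cube_subset that]]])
  show "\<rho> (g x) = x0" if "x \<in> boundary_plus" for x
    using near[of x] rel_mapsD(4)[OF u that] that boundary_plus_subset frontier_cube_subset
    by (intro \<rho>_x0) auto
qed

lemma lipschitz_\<rho>_compose:
  assumes "C-lipschitz_on A g" "\<And>x. x \<in> A \<Longrightarrow> \<exists>y\<in>X. dist y (g x) < \<epsilon>"
  shows "(L * C)-lipschitz_on A (\<lambda>x. \<rho> (g x))"
proof -
  have "g ` A \<subseteq> {y. \<exists>x\<in>X. dist x y < \<epsilon>}" using assms(2) by blast
  then have "L-lipschitz_on (g ` A) \<rho>" by (rule lipschitz_on_subset[OF lipschitz_\<rho>])
  then show ?thesis using lipschitz_on_compose2[OF assms(1)] by blast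
qed

lemma lipschitz_representative:
  assumes u: "u \<in> rel_maps X X0 x0"
  obtains v C where "(u, v) \<in> rel_homotopy X X0 x0" "C-lipschitz_on unit_cube v"
proof -
  obtain M g where g: "M-lipschitz_on unit_cube g" "\<And>x. x \<in> unit_cube \<Longrightarrow> dist (u x) (g x) < \<epsilon>"
    using continuous_lipschitz_approx[OF compact_cbox rel_mapsD(1)[OF u] eps] by blast
  have lip: "(L * M)-lipschitz_on unit_cube (\<lambda>x. \<rho> (g x))"
    by (rule lipschitz_\<rho>_compose[OF g(1)]) (use g(2) rel_mapsD(2)[OF u] in blast)
  moreover have "(u, \<lambda>x. \<rho> (g x)) \<in> rel_homotopy X X0 x0"
    by (rule rel_homotopy_approx[OF u lipschitz_on_continuous_on[OF lip] g(2)])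
  ultimately show thesis using that by blast
qed

lemma radial_map_base_point: "radial_map u = (\<lambda>z. (snd z *\<^sub>R u (base_point z), snd z))"
  unfolding radial_map_def base_point_def by (auto simp: fun_eq_iff)

lemma height_proper_snd: "height_proper snd"
  unfolding height_proper_def by blast

text \<open>Carried out in time \<open>h + 1\<close> at height \<open>h\<close>, a Lipschitz homotopy moves the base point with a
  speed of order \<open>1 / (h + 1)\<close>, hence the point of the cone with bounded speed.\<close>

lemma radial_homotopy:
  fixes k :: "real \<times> (real ^ 'n::{finite,linorder}) \<Rightarrow> 'b"
  assumes lip: "C-lipschitz_on ({0..1} \<times> unit_cube) k"
    and X: "\<And>t x. t \<in> {0..1} \<Longrightarrow> x \<in> unit_cube \<Longrightarrow> k (t, x) \<in> X"
    and X0: "\<And>t x. t \<in> {0..1} \<Longrightarrow> x \<in> frontier unit_cube \<Longrightarrow> k (t, x) \<in> X0"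
    and bp: "\<And>t x. t \<in> {0..1} \<Longrightarrow> x \<in> boundary_plus \<Longrightarrow> k (t, x) = x0"
  shows "(radial_map (\<lambda>x. k (0, x)), radial_map (\<lambda>x. k (1, x))) \<in> coarse_htpy"
proof -
  have C: "C \<ge> 0" using lip unfolding lipschitz_on_def by blast
  define \<omega> where "\<omega> p = k (ramp (snd (fst p)) (snd p), base_point (fst p))"
    for p :: "((real ^ 'n::{finite,linorder}) \<times> real) \<times> real"
  have r01: "ramp (snd z) t \<in> {0..1}" if "z \<in> cube_cone" "0 \<le> t" for z :: "(real ^ 'n::{finite,linorder}) \<times> real" and t
    using ramp_range[OF cube_coneD(1)[OF that(1)] that(2)] by simp
  have "((\<lambda>z. (snd z *\<^sub>R \<omega> (z, 0), snd z)), (\<lambda>z. (snd z *\<^sub>R k (1, base_point z), snd z))) \<in> coarse_htpy"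
  proof (rule coarse_htpy_constant_height[where K = 1 and \<omega> = \<omega> and A = snd and \<omega>' = "\<lambda>z. k (1, base_point z)"
        and C = "C * (3 + (real CARD('n) + 1))"])
    show "ls_lipschitz_on cube_cone snd" by (intro ls_lipschitz_on_snd ls_lipschitz_on_id)
    show "0 \<le> snd z" if "z \<in> cube_cone" for z :: "(real ^ 'n::{finite,linorder}) \<times> real"
      by (rule cube_coneD(1)[OF that])
    fix z z' :: "(real ^ 'n::{finite,linorder}) \<times> real" and t t' :: real
    assume z: "z \<in> cube_cone" "z' \<in> cube_cone" "0 \<le> t" "0 \<le> t'" and d: "dist z z' \<le> 1" "\<bar>t - t'\<bar> \<le> 1"
    have h: "0 \<le> snd z" "0 \<le> snd z'" using cube_coneD(1) z(1,2) by blast+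
    have dh: "\<bar>snd z' - snd z\<bar> \<le> 1" using dist_snd_le[of z' z] d(1) by (simp add: dist_real_def dist_commute)
    define r r' where "r = ramp (snd z) t" and "r' = ramp (snd z') t'"
    have "snd z * dist (\<omega> (z, t)) (\<omega> (z', t')) \<le> snd z * (C * (\<bar>r - r'\<bar> + dist (base_point z) (base_point z')))"
    proof (rule mult_left_mono[OF _ h(1)])
      have "dist (\<omega> (z, t)) (\<omega> (z', t')) \<le> C * dist (r, base_point z) (r', base_point z')"
        unfolding \<omega>_def r_def r'_def fst_conv snd_conv
        by (rule lipschitz_onD[OF lip]) (use r01 z cube_coneD(3) in blast)+
      also have "\<dots> \<le> C * (\<bar>r - r'\<bar> + dist (base_point z) (base_point z'))"
        using dist_Pair_le[of r "base_point z" r' "base_point z'"] C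
        by (intro mult_left_mono) (auto simp: dist_real_def)
      finally show "dist (\<omega> (z, t)) (\<omega> (z', t')) \<le> C * (\<bar>r - r'\<bar> + dist (base_point z) (base_point z'))" .
    qed
    also have "\<dots> = C * (snd z * \<bar>r - r'\<bar> + snd z * dist (base_point z) (base_point z'))"
      by (simp add: algebra_simps)
    also have "\<dots> \<le> C * (3 + (real CARD('n) + 1))"
    proof (intro mult_left_mono add_mono C)
      have "(snd z + 1) * \<bar>r' - r\<bar> \<le> \<bar>t' - t\<bar> + 2 * \<bar>snd z' - snd z\<bar>"
        unfolding r_def r'_def by (rule ramp_lipschitz[OF h(2,1) z(4,3)])
      also have "\<dots> \<le> 3" using dh d(2) by argo
      finally show "snd z * \<bar>r - r'\<bar> \<le> 3" by (simp add: algebra_simps abs_minus_commute[of r])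
      have "(real CARD('n) + 1) * dist z z' \<le> (real CARD('n) + 1) * 1"
        using d(1) by (intro mult_left_mono) auto
      then show "snd z * dist (base_point z) (base_point z') \<le> real CARD('n) + 1"
        using order_trans[OF base_point_lipschitz[OF z(1,2)]] unfolding dist_norm by simp
    qed
    finally show "snd z * dist (\<omega> (z, t)) (\<omega> (z', t')) \<le> C * (3 + (real CARD('n) + 1))" .
  next
    fix z :: "(real ^ 'n::{finite,linorder}) \<times> real" and t :: real
    show "\<omega> (z, t) \<in> X" if "z \<in> cube_cone" "0 \<le> t"
      unfolding \<omega>_def using X r01[OF that] cube_coneD(3)[OF that(1)] by simp
    show "\<omega> (z, t) \<in> X0" if "z \<in> metric_cone (frontier unit_cube)" "0 \<le> t"
      unfolding \<omega>_def using X0 r01[OF subsetD[OF cone_frontier_subset that(1)] that(2)] base_point_frontier[OF that(1)] by simp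
    show "snd z = snd z \<and> (snd z \<noteq> 0 \<longrightarrow> \<omega> (z, t) = x0)" if z: "z \<in> metric_cone boundary_plus" "0 \<le> t"
    proof -
      have "z \<in> cube_cone" using z(1) cone_boundary_plus_subset cone_frontier_subset by blast
      then show ?thesis unfolding \<omega>_def using bp r01[OF _ z(2)] base_point_boundary_plus[OF z(1)] by simp
    qed
    show "\<omega> (z, t) = k (1, base_point z)" if "z \<in> cube_cone" "1 * (snd z + 1) \<le> t"
      unfolding \<omega>_def using ramp_1[OF cube_coneD(1)[OF that(1)]] that(2) by simp
  qed (auto simp: height_proper_snd)
  moreover have "\<omega> (z, 0) = k (0, base_point z)" for z unfolding \<omega>_def by (simp add: ramp_0)
  ultimately show ?thesis unfolding radial_map_base_point by simp
qed

lemma radial_map_coarse: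
  fixes u :: "real ^ 'n::{finite,linorder} \<Rightarrow> 'b"
  assumes u: "u \<in> rel_maps X X0 x0" and lip: "C-lipschitz_on unit_cube u"
  shows "radial_map u \<in> coarse_maps"
proof -
  have "C-lipschitz_on ({0..1::real} \<times> unit_cube) (\<lambda>p. u (snd p))"
  proof (rule lipschitz_onI)
    fix p p' :: "real \<times> (real ^ 'n::{finite,linorder})" assume p: "p \<in> {0..1} \<times> unit_cube" "p' \<in> {0..1} \<times> unit_cube"
    have "dist (u (snd p)) (u (snd p')) \<le> C * dist (snd p) (snd p')"
      by (rule lipschitz_onD[OF lip]) (use p in auto)
    also have "\<dots> \<le> C * dist p p'"
      using lipschitz_on_nonneg[OF lip] by (intro mult_left_mono dist_snd_le)
    finally show "dist (u (snd p)) (u (snd p')) \<le> C * dist p p'" .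
  qed (rule lipschitz_on_nonneg[OF lip])
  from radial_homotopy[OF this] rel_mapsD[OF u] have "(radial_map u, radial_map u) \<in> coarse_htpy"
    by simp
  then show ?thesis using coarse_htpy_maps by blast
qed

text \<open>Segments between points of the base span segments between points of the same height of the
  cone.\<close>

lemma radial_map_approx:
  fixes u :: "real ^ 'n::{finite,linorder} \<Rightarrow> 'b"
  assumes u: "u \<in> rel_maps X X0 x0" "C-lipschitz_on unit_cube u"
    and v: "v \<in> rel_maps X X0 x0" "C'-lipschitz_on unit_cube v"
    and near: "\<And>x. x \<in> unit_cube \<Longrightarrow> dist (u x) (g x) < \<epsilon>" "\<And>x. x \<in> unit_cube \<Longrightarrow> v x = \<rho> (g x)"
  shows "(radial_map u, radial_map v) \<in> coarse_htpy"
proof (rule coarse_htpy_linear[OF radial_map_coarse[OF u] radial_map_coarse[OF v], of 0])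
  show "closed_segment (radial_map u z) (radial_map v z) \<subseteq> metric_cone X"
    if z: "z \<in> cube_cone" for z :: "(real ^ 'n::{finite,linorder}) \<times> real"
  proof -
    have x: "base_point z \<in> unit_cube" by (rule cube_coneD(3)[OF z])
    show ?thesis
      unfolding radial_map_base_point near(2)[OF x]
      by (intro closed_segment_in_cone cube_coneD(1)[OF z] segment_X[OF _ near(1)[OF x]] rel_mapsD(2)[OF u(1) x])
  qed
  show "closed_segment (radial_map u z) (radial_map v z) \<subseteq> metric_cone X0"
    if z: "z \<in> metric_cone (frontier unit_cube)" for z :: "(real ^ 'n::{finite,linorder}) \<times> real"
  proof -
    have zc: "z \<in> cube_cone" by (rule subsetD[OF cone_frontier_subset z])
    have x: "base_point z \<in> unit_cube" by (rule cube_coneD(3)[OF zc])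
    show ?thesis
      unfolding radial_map_base_point near(2)[OF x]
      by (intro closed_segment_in_cone cube_coneD(1)[OF zc] segment_X0[OF _ near(1)[OF x]]
          rel_mapsD(3)[OF u(1)] base_point_frontier[OF z])
  qed
qed

text \<open>The homotopy is approximated by a Lipschitz map and corrected by \<open>\<rho>\<close>. This moves its two ends
  away from \<open>u\<close> and \<open>v\<close>, but only along short segments.\<close>

lemma radial_map_homotopic:
  fixes u v :: "real ^ 'n::{finite,linorder} \<Rightarrow> 'b"
  assumes u: "C-lipschitz_on unit_cube u" and v: "C'-lipschitz_on unit_cube v"
    and uv: "(u, v) \<in> rel_homotopy X X0 x0"
  shows "(radial_map u, radial_map v) \<in> coarse_htpy"
proof -
  obtain k where kc: "continuous_on ({0..1::real} \<times> unit_cube) k"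
    and k': "\<forall>t\<in>{0..1}. \<forall>x\<in>unit_cube. k (t, x) \<in> X"
    "\<forall>t\<in>{0..1}. \<forall>x\<in>frontier unit_cube. k (t, x) \<in> X0"
    "\<forall>t\<in>{0..1}. \<forall>x\<in>boundary_plus. k (t, x) = x0"
    "\<forall>x\<in>unit_cube. k (0, x) = u x \<and> k (1, x) = v x"
    using uv by (rule rel_homotopyE)
  have k: "continuous_on ({0..1::real} \<times> unit_cube) k"
    "\<And>t x. t \<in> {0..1} \<Longrightarrow> x \<in> unit_cube \<Longrightarrow> k (t, x) \<in> X"
    "\<And>t x. t \<in> {0..1} \<Longrightarrow> x \<in> frontier unit_cube \<Longrightarrow> k (t, x) \<in> X0"
    "\<And>t x. t \<in> {0..1} \<Longrightarrow> x \<in> boundary_plus \<Longrightarrow> k (t, x) = x0"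
    "\<And>x. x \<in> unit_cube \<Longrightarrow> k (0, x) = u x" "\<And>x. x \<in> unit_cube \<Longrightarrow> k (1, x) = v x"
    using kc k' by simp_all
  have "compact ({0..1::real} \<times> (unit_cube :: (real ^ 'n::{finite,linorder}) set))"
    by (intro compact_Times compact_cbox compact_Icc)
  then obtain M g where g: "M-lipschitz_on ({0..1} \<times> unit_cube) g"
    "\<And>p. p \<in> {0..1} \<times> unit_cube \<Longrightarrow> dist (k p) (g p) < \<epsilon>"
    using continuous_lipschitz_approx[OF _ k(1) eps] by blast
  have lip: "(L * M)-lipschitz_on ({0..1} \<times> unit_cube) (\<lambda>p. \<rho> (g p))"
    by (rule lipschitz_\<rho>_compose[OF g(1)]) (use g(2) k(2) in blast)
  have X: "\<rho> (g (t, x)) \<in> X" if "t \<in> {0..1}" "x \<in> unit_cube" for t x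
    using k(2)[OF that] g(2)[of "(t, x)"] that by (intro \<rho>_in_X[of "k (t, x)"]) auto
  have fr: "\<rho> (g (t, x)) \<in> X0" if "t \<in> {0..1}" "x \<in> frontier unit_cube" for t x
    using k(3)[OF that] g(2)[of "(t, x)"] that subsetD[OF frontier_cube_subset that(2)]
    by (intro \<rho>_in_X0[of "k (t, x)"]) auto
  have bp: "\<rho> (g (t, x)) = x0" if "t \<in> {0..1}" "x \<in> boundary_plus" for t x
    using k(4)[OF that] g(2)[of "(t, x)"] that subsetD[OF frontier_cube_subset subsetD[OF boundary_plus_subset that(2)]]
    by (intro \<rho>_x0) auto
  have slice_lip: "(L * M)-lipschitz_on unit_cube (\<lambda>x. \<rho> (g (t, x)))" if "t \<in> {0..1}" for t
  proof (rule lipschitz_onI)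
    fix x y :: "real ^ 'n::{finite,linorder}" assume "x \<in> unit_cube" "y \<in> unit_cube"
    then show "dist (\<rho> (g (t, x))) (\<rho> (g (t, y))) \<le> L * M * dist x y"
      using lipschitz_onD[OF lip, of "(t, x)" "(t, y)"] that by (simp add: dist_Pair_Pair)
  qed (rule lipschitz_on_nonneg[OF lip])
  have slice_map: "(\<lambda>x. \<rho> (g (t, x))) \<in> rel_maps X X0 x0" if "t \<in> {0..1}" for t
    unfolding rel_maps_iff using lipschitz_on_continuous_on[OF slice_lip[OF that]] X fr bp that by blast
  have "(radial_map u, radial_map (\<lambda>x. \<rho> (g (0, x)))) \<in> coarse_htpy"
  proof (rule radial_map_approx[OF _ u slice_map slice_lip])
    show "u \<in> rel_maps X X0 x0" using rel_homotopy_maps[OF uv] by blast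
    show "dist (u x) (g (0, x)) < \<epsilon>" if "x \<in> unit_cube" for x using g(2)[of "(0, x)"] k(5) that by simp
  qed auto
  moreover have "(radial_map v, radial_map (\<lambda>x. \<rho> (g (1, x)))) \<in> coarse_htpy"
  proof (rule radial_map_approx[OF _ v slice_map slice_lip])
    show "v \<in> rel_maps X X0 x0" using rel_homotopy_maps[OF uv] by blast
    show "dist (v x) (g (1, x)) < \<epsilon>" if "x \<in> unit_cube" for x using g(2)[of "(1, x)"] k(6) that by simp
  qed auto
  moreover have "(radial_map (\<lambda>x. \<rho> (g (0, x))), radial_map (\<lambda>x. \<rho> (g (1, x)))) \<in> coarse_htpy"
    by (rule radial_homotopy[OF lip]) (use X fr bp in auto)
  ultimately show ?thesis using coarse_htpy_trans coarse_htpy_sym by blast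
qed

text \<open>Seen from the apex, an error that is small in comparison with the height subtends a small
  angle.\<close>

lemma central_projection_near:
  obtains \<kappa> where "\<kappa> > 0"
    "\<And>y a p. y \<in> X \<Longrightarrow> 0 < a \<Longrightarrow> dist p (a *\<^sub>R y, a) \<le> \<kappa> * a \<Longrightarrow>
       a / 2 \<le> snd p \<and> dist y (fst p /\<^sub>R snd p) < \<epsilon>"
proof -
  obtain B where B: "\<And>x. x \<in> X \<Longrightarrow> norm x \<le> B" "B > 0" using bounded_X bounded_pos by metis
  define \<kappa> where "\<kappa> = min (1 / 2) (\<epsilon> / (4 * (1 + B)))"
  have \<kappa>: "\<kappa> > 0" "\<kappa> \<le> 1 / 2" "2 * \<kappa> * (1 + B) < \<epsilon>"
  proof -
    show "\<kappa> > 0" unfolding \<kappa>_def using eps B(2) by simp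
    show "\<kappa> \<le> 1 / 2" unfolding \<kappa>_def by (rule min.cobounded1)
    have "2 * \<kappa> * (1 + B) \<le> 2 * (\<epsilon> / (4 * (1 + B))) * (1 + B)"
      unfolding \<kappa>_def using B(2) by (intro mult_right_mono mult_left_mono) auto
    also have "\<dots> = \<epsilon> / 2" using B(2) by (simp add: divide_simps)
    finally show "2 * \<kappa> * (1 + B) < \<epsilon>" using eps by linarith
  qed
  show thesis
  proof (rule that[OF \<kappa>(1)])
    fix y :: 'b and a :: real and p :: "'b \<times> real"
    assume y: "y \<in> X" and a: "0 < a" and d: "dist p (a *\<^sub>R y, a) \<le> \<kappa> * a"
    have d1: "norm (a *\<^sub>R y - fst p) \<le> \<kappa> * a" and d2: "\<bar>snd p - a\<bar> \<le> \<kappa> * a"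
      using dist_fst_le[of p "(a *\<^sub>R y, a)"] dist_snd_le[of p "(a *\<^sub>R y, a)"] d
      by (auto simp: dist_norm norm_minus_commute)
    have "\<kappa> * a \<le> 1 / 2 * a" using \<kappa>(2) a by (intro mult_right_mono) auto
    then have s: "a / 2 \<le> snd p" using d2 by argo
    then have s0: "snd p > 0" using a by linarith
    have "y - fst p /\<^sub>R snd p = ((snd p - a) *\<^sub>R y + (a *\<^sub>R y - fst p)) /\<^sub>R snd p"
      using s0 by (simp add: algebra_simps)
    then have "dist y (fst p /\<^sub>R snd p) = norm ((snd p - a) *\<^sub>R y + (a *\<^sub>R y - fst p)) / snd p"
      unfolding dist_norm using s0 by (simp add: divide_inverse mult.commute)
    also have "\<dots> \<le> (\<kappa> * a * B + \<kappa> * a) / snd p"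
    proof (rule divide_right_mono)
      have "norm ((snd p - a) *\<^sub>R y) \<le> \<kappa> * a * B"
        using d2 B(1)[OF y] B(2) \<kappa>(1) a by (simp add: mult_mono)
      then show "norm ((snd p - a) *\<^sub>R y + (a *\<^sub>R y - fst p)) \<le> \<kappa> * a * B + \<kappa> * a"
        using d1 by (rule norm_triangle_mono)
    qed (use s0 in simp)
    also have "\<dots> \<le> (\<kappa> * a * B + \<kappa> * a) / (a / 2)"
      using s s0 a \<kappa>(1) B(2) by (intro divide_left_mono) auto
    also have "\<dots> = 2 * \<kappa> * (1 + B)" using a by (simp add: field_simps)
    finally show "a / 2 \<le> snd p \<and> dist y (fst p /\<^sub>R snd p) < \<epsilon>" using s \<kappa>(3) by linarith
  qed
qed

text \<open>Conversely, a single slice at large height of a coarse homotopy between cones is, up to a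
  small error and after central projection, a homotopy in \<open>X\<close>.\<close>

lemma radial_map_reflects_homotopy:
  fixes u v :: "real ^ 'n::{finite,linorder} \<Rightarrow> 'b"
  assumes u: "u \<in> rel_maps X X0 x0" and v: "v \<in> rel_maps X X0 x0"
    and uv: "(radial_map u, radial_map v) \<in> coarse_htpy"
  shows "(u, v) \<in> rel_homotopy X X0 x0"
proof -
  from iffD1[OF coarse_htpy_iff uv] obtain K H where H: "long_homotopy K (radial_map u) (radial_map v) H"
    by (elim exE)
  note DH = long_homotopyD[OF H]
  obtain M D Ht where Ht: "M-lipschitz_on cone_cylinder Ht" and D: "D \<ge> 0"
    "\<And>p. p \<in> cone_cylinder \<Longrightarrow> dist (H p) (Ht p) \<le> D"
    using ls_lipschitz_approx[OF DH(2)] by metis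
  obtain \<kappa> where \<kappa>: "\<kappa> > 0" "\<And>y a p. y \<in> X \<Longrightarrow> 0 < a \<Longrightarrow> dist p (a *\<^sub>R y, a) \<le> \<kappa> * a \<Longrightarrow>
       a / 2 \<le> snd p \<and> dist y (fst p /\<^sub>R snd p) < \<epsilon>"
    using central_projection_near by blast
  obtain N where N: "\<And>z t. z \<in> cube_cone \<Longrightarrow> 0 \<le> t \<Longrightarrow> snd (H (z, t)) \<le> max 2 (D / \<kappa>) \<Longrightarrow> snd z \<le> N"
    using DH(3)[of "max 2 (D / \<kappa>)"] by blast
  define h where "h = max 1 (N + 1)"
  have h: "h > 0" "h > N" unfolding h_def by auto
  \<comment> \<open>at height \<open>h\<close> the coarse homotopy has ended by the time \<open>T\<close>\<close>
  define T where "T = K * (h + 1)"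
  have T: "T \<ge> 0" unfolding T_def using DH(6) h by simp
  define P where "P = (\<lambda>q::real \<times> (real ^ 'n::{finite,linorder}). ((h *\<^sub>R snd q, h), fst q * T))"
  have zc: "(h *\<^sub>R x, h) \<in> cube_cone" if "x \<in> unit_cube" for x :: "real ^ 'n::{finite,linorder}"
    using scaled_in_metric_cone h that by (metis less_imp_le)
  have PC: "P q \<in> cone_cylinder" if "q \<in> {0..1} \<times> unit_cube" for q
    using that zc T unfolding P_def by auto
  define w where "w q = fst (Ht (P q)) /\<^sub>R snd (Ht (P q))" for q
  have near: "1 \<le> snd (Ht (P (t, x))) \<and> dist y (w (t, x)) < \<epsilon>"
    if tx: "t \<in> {0..1}" "x \<in> unit_cube" and y: "y \<in> X" "fst (H (P (t, x))) = snd (H (P (t, x))) *\<^sub>R y" for t x y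
  proof -
    define a where "a = snd (H (P (t, x)))"
    have q: "P (t, x) \<in> cone_cylinder" using PC tx by blast
    have "\<not> a \<le> max 2 (D / \<kappa>)"
      using N[OF zc[OF tx(2)], of "t * T"] tx(1) T h unfolding a_def P_def by auto
    then have a: "a \<ge> 2" "D / \<kappa> \<le> a" by auto
    have Ha: "H (P (t, x)) = (a *\<^sub>R y, a)" using y(2) unfolding a_def by (simp add: prod_eq_iff)
    have "dist (Ht (P (t, x))) (a *\<^sub>R y, a) \<le> D" using D(2)[OF q] unfolding Ha by (simp add: dist_commute)
    also have "D \<le> \<kappa> * a" using a(2) \<kappa>(1) by (simp add: divide_simps mult.commute)
    finally show ?thesis using \<kappa>(2)[OF y(1), of a "Ht (P (t, x))"] a(1) unfolding w_def by auto
  qed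
  have inX: "\<exists>y\<in>X. fst (H (P (t, x))) = snd (H (P (t, x))) *\<^sub>R y" if "t \<in> {0..1}" "x \<in> unit_cube" for t x
    using DH(1)[OF zc[OF that(2)], of "t * T"] that(1) T unfolding P_def metric_cone_iff by auto
  have inX0: "\<exists>y\<in>X0. fst (H (P (t, x))) = snd (H (P (t, x))) *\<^sub>R y" if "t \<in> {0..1}" "x \<in> frontier unit_cube" for t x
    using DH(4)[OF scaled_in_metric_cone[OF less_imp_le[OF h(1)] that(2)], of "t * T"] that(1) T
    unfolding P_def metric_cone_iff by auto
  have atx0: "fst (H (P (t, x))) = snd (H (P (t, x))) *\<^sub>R x0" if "t \<in> {0..1}" "x \<in> boundary_plus" for t x
    using DH(5)[OF scaled_in_metric_cone[OF less_imp_le[OF h(1)] that(2)], of "t * T"] that(1) T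
    unfolding P_def by auto
  have ends: "dist (u x) (w (0, x)) < \<epsilon>" "dist (v x) (w (1, x)) < \<epsilon>" if x: "x \<in> unit_cube" for x
  proof -
    have "H (P (0, x)) = radial_map u (h *\<^sub>R x, h)" unfolding P_def using DH(7)[OF zc[OF x]] by simp
    then show "dist (u x) (w (0, x)) < \<epsilon>"
      using near[of 0 x "u x"] x rel_mapsD(2)[OF u x] h by (simp add: radial_map_def)
    have "H (P (1, x)) = radial_map v (h *\<^sub>R x, h)" unfolding P_def using DH(8)[OF zc[OF x], of T] by (simp add: T_def)
    then show "dist (v x) (w (1, x)) < \<epsilon>"
      using near[of 1 x "v x"] x rel_mapsD(2)[OF v x] h by (simp add: radial_map_def)
  qed
  have cont: "continuous_on ({0..1} \<times> unit_cube) (\<lambda>q. \<rho> (w q))"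
  proof (rule continuous_on_compose2[OF lipschitz_on_continuous_on[OF lipschitz_\<rho>]])
    have HtP: "continuous_on ({0..1} \<times> unit_cube) (\<lambda>q. Ht (P q))"
      by (rule continuous_on_compose2[OF lipschitz_on_continuous_on[OF Ht]])
        (use PC in \<open>auto simp: P_def intro!: continuous_intros\<close>)
    show "continuous_on ({0..1} \<times> unit_cube) w"
      unfolding w_def
      by (intro continuous_intros HtP) (use near inX in fastforce)
    show "w ` ({0..1} \<times> unit_cube) \<subseteq> {y. \<exists>x\<in>X. dist x y < \<epsilon>}"
      using near inX by fastforce
  qed
  have "((\<lambda>x. \<rho> (w (0, x))), (\<lambda>x. \<rho> (w (1, x)))) \<in> rel_homotopy X X0 x0"
  proof (rule rel_homotopyI[OF cont])
    show "\<rho> (w (t, x)) \<in> X" if tx: "t \<in> {0..1}" "x \<in> unit_cube" for t x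
      using inX[OF tx] near[OF tx] \<rho>_in_X by blast
    show "\<rho> (w (t, x)) \<in> X0" if tx: "t \<in> {0..1}" "x \<in> frontier unit_cube" for t x
      using inX0[OF tx] near[OF tx(1) subsetD[OF frontier_cube_subset tx(2)]] \<rho>_in_X0 X0_subset by blast
    show "\<rho> (w (t, x)) = x0" if tx: "t \<in> {0..1}" "x \<in> boundary_plus" for t x
      using near[OF tx(1) subsetD[OF frontier_cube_subset subsetD[OF boundary_plus_subset tx(2)]] _ atx0[OF tx]]
        \<rho>_x0 X0_subset x0_in by blast
  qed auto
  moreover have slice: "continuous_on unit_cube (\<lambda>x. \<rho> (w (t, x)))" if "t \<in> {0..1}" for t
    by (rule continuous_on_compose2[OF cont]) (use that in \<open>auto intro!: continuous_intros\<close>)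
  have "(u, \<lambda>x. \<rho> (w (0, x))) \<in> rel_homotopy X X0 x0"
    by (rule rel_homotopy_approx[OF u slice ends(1)]) auto
  moreover have "(v, \<lambda>x. \<rho> (w (1, x))) \<in> rel_homotopy X X0 x0"
    by (rule rel_homotopy_approx[OF v slice ends(2)]) auto
  ultimately show ?thesis
    using equivE[OF equiv_rel_homotopy[of X X0 x0]] by (meson symD transD)
qed

end

section \<open>Every coarse map is homotopic to a cone\<close>

lemma lipschitz_imp_ls_radial:
  fixes f :: "real ^ 'n::{finite,linorder} \<Rightarrow> 'b::real_normed_vector"
  assumes lip: "C-lipschitz_on unit_cube f"
  shows "ls_lipschitz_on cube_cone (\<lambda>z. snd z *\<^sub>R f (base_point z))"
proof -
  have C: "C \<ge> 0" by (rule lipschitz_on_nonneg[OF lip])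
  define B where "B = norm (f 0) + C * real CARD('n)"
  have B: "norm (f x) \<le> B" if x: "x \<in> unit_cube" for x
  proof -
    have "dist (f x) (f 0) \<le> C * dist x 0" by (rule lipschitz_onD[OF lip x]) (simp add: mem_unit_cube)
    also have "\<dots> \<le> C * real CARD('n)" using norm_unit_cube[OF x] C by (intro mult_left_mono) auto
    finally show ?thesis unfolding B_def using norm_triangle_sub[of "f x" "f 0"] by (simp add: dist_norm)
  qed
  show ?thesis
  proof (rule ls_lipschitz_onI)
    fix z z' :: "(real ^ 'n::{finite,linorder}) \<times> real" assume z: "z \<in> cube_cone" "z' \<in> cube_cone"
    let ?x = "base_point z" and ?x' = "base_point z'"
    have x: "?x \<in> unit_cube" "?x' \<in> unit_cube" using cube_coneD(3) z by blast+
    have "snd z *\<^sub>R f ?x - snd z' *\<^sub>R f ?x' = snd z *\<^sub>R (f ?x - f ?x') + (snd z - snd z') *\<^sub>R f ?x'"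
      by (simp add: algebra_simps)
    then have "dist (snd z *\<^sub>R f ?x) (snd z' *\<^sub>R f ?x') \<le> snd z * dist (f ?x) (f ?x') + dist (snd z) (snd z') * norm (f ?x')"
      unfolding dist_norm using cube_coneD(1)[OF z(1)]
      by (metis abs_of_nonneg norm_scaleR norm_triangle_ineq real_norm_def)
    also have "\<dots> \<le> snd z * (C * dist ?x ?x') + dist z z' * B"
      using lipschitz_onD[OF lip x] cube_coneD(1)[OF z(1)] B[OF x(2)]
      by (intro add_mono mult_left_mono mult_mono dist_snd_le) auto
    also have "\<dots> = C * (snd z * norm (?x - ?x')) + dist z z' * B" by (simp add: dist_norm)
    also have "\<dots> \<le> C * ((real CARD('n) + 1) * dist z z') + dist z z' * B"
      by (rule add_right_mono[OF mult_left_mono[OF base_point_lipschitz[OF z] C]])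
    also have "C * ((real CARD('n) + 1) * dist z z') + dist z z' * B
        = (C * (real CARD('n) + 1) + B) * dist z z'" by (simp add: algebra_simps)
    also have "\<dots> \<le> (C * (real CARD('n) + 1) + B) * (dist z z' + 1)"
    proof (rule mult_left_mono)
      have "0 \<le> B" using B[OF x(1)] norm_ge_zero order_trans by blast
      then show "0 \<le> C * (real CARD('n) + 1) + B" using C by simp
    qed simp
    finally show "dist (snd z *\<^sub>R f ?x) (snd z' *\<^sub>R f ?x') \<le> (C * (real CARD('n) + 1) + B) * (dist z z' + 1)" .
  qed
qed

text \<open>A minorant \<open>m\<close> of a proper function \<open>a\<close> on the cone which still tends to infinity, but at
  most like the square root: \<open>m h / sqrt h\<close> is nonincreasing. It is the largest nondecreasing minorant with this
  property, the infimum of the functions \<open>h \<mapsto> a z * max 1 (sqrt (h / snd z))\<close>.\<close>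

lemma slow_minorant:
  fixes a :: "(real ^ 'n::{finite,linorder}) \<times> real \<Rightarrow> real"
  assumes h0: "1 \<le> h0" and a1: "\<And>z. z \<in> cube_cone \<Longrightarrow> h0 \<le> snd z \<Longrightarrow> 1 \<le> a z"
    and proper: "\<And>M. \<exists>N. \<forall>z\<in>cube_cone. h0 \<le> snd z \<and> a z \<le> M \<longrightarrow> snd z \<le> N"
    and growth: "\<And>z. z \<in> cube_cone \<Longrightarrow> a z \<le> c * (snd z + 1)"
  shows "\<exists>m :: real \<Rightarrow> real. (\<forall>z\<in>cube_cone. h0 \<le> snd z \<longrightarrow> m (snd z) \<le> a z) \<and> (\<forall>h. 1 \<le> m h) \<and>
    (\<forall>r h s. 0 \<le> r \<longrightarrow> r \<le> 1 \<longrightarrow> 0 \<le> h \<longrightarrow> r\<^sup>2 * h \<le> s \<longrightarrow> r * m h \<le> m s) \<and>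
    (\<forall>M. \<exists>N. \<forall>h\<ge>0. m h \<le> M \<longrightarrow> h \<le> N) \<and>
    (\<forall>h h'. h0 \<le> h \<longrightarrow> h0 \<le> h' \<longrightarrow> \<bar>h - h'\<bar> \<le> 1 \<longrightarrow> \<bar>m h - m h'\<bar> \<le> 2 * c)"
proof -
  define Z where "Z = {z \<in> (cube_cone :: ((real ^ 'n::{finite,linorder}) \<times> real) set). h0 \<le> snd z}"
  have top: "(0, h) \<in> Z" if "h0 \<le> h" for h using that h0 unfolding Z_def mem_Collect_eq mem_cube_cone by simp
  have Z: "z \<in> cube_cone" "h0 \<le> snd z" "1 \<le> a z" "0 < snd z" if "z \<in> Z" for z
    using that a1 h0 unfolding Z_def by auto
  define g where "g h z = a z * max 1 (sqrt (h / snd z))" for h z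
  define m where "m h = (INF z\<in>Z. g h z)" for h
  have ne: "Z \<noteq> {}" using top by blast
  have g1: "a z \<le> g h z" if "z \<in> Z" for h z
    unfolding g_def using Z(3)[OF that] mult_left_mono[of 1 "max 1 (sqrt (h / snd z))" "a z"] by simp
  have bdd: "bdd_below (g h ` Z)" for h
    using g1 Z(3) by (intro bdd_belowI2[of _ 1]) (meson order_trans)
  have m_le: "m h \<le> g h z" if "z \<in> Z" for h z unfolding m_def by (rule cINF_lower[OF bdd that])
  have m_a: "m (snd z) \<le> a z" if "z \<in> cube_cone" "h0 \<le> snd z" for z
  proof -
    have "z \<in> Z" using that unfolding Z_def by blast
    from m_le[OF this, of "snd z"] Z(4)[OF this] show ?thesis unfolding g_def by simp
  qed
  have m1: "1 \<le> m h" for h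
    unfolding m_def using g1 Z(3) by (intro cINF_greatest[OF ne]) (meson order_trans)
  have mr: "r * m h \<le> m s" if r: "0 \<le> r" "r \<le> 1" and hs: "0 \<le> h" "r\<^sup>2 * h \<le> s" for r h s
    unfolding m_def[of s]
  proof (rule cINF_greatest[OF ne])
    fix z assume z: "z \<in> Z"
    have "r * m h \<le> r * g h z" by (rule mult_left_mono[OF m_le[OF z] r(1)])
    also have "\<dots> = a z * (r * max 1 (sqrt (h / snd z)))" unfolding g_def by simp
    also have "\<dots> \<le> a z * max 1 (sqrt (s / snd z))"
    proof (rule mult_left_mono)
      have "r * sqrt (h / snd z) = sqrt (r\<^sup>2 * h / snd z)"
        using r(1) by (simp add: real_sqrt_mult real_sqrt_divide)
      also have "\<dots> \<le> sqrt (s / snd z)"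
        using hs(2) Z(4)[OF z] by (simp add: divide_right_mono)
      finally have "max (r * 1) (r * sqrt (h / snd z)) \<le> max 1 (sqrt (s / snd z))"
        using r by (intro max.mono) auto
      then show "r * max 1 (sqrt (h / snd z)) \<le> max 1 (sqrt (s / snd z))"
        using r by (simp add: max_mult_distrib_left)
    qed (use Z(3)[OF z] in simp)
    finally show "r * m h \<le> g s z" unfolding g_def .
  qed
  have m_proper: "\<exists>N. \<forall>h\<ge>0. m h \<le> M \<longrightarrow> h \<le> N" for M
  proof -
    define M1 where "M1 = max 1 (M + 1)"
    obtain N where N: "\<And>z. z \<in> cube_cone \<Longrightarrow> h0 \<le> snd z \<Longrightarrow> a z \<le> M1 \<Longrightarrow> snd z \<le> N"
      using proper[of M1] by blast
    have "h \<le> M1\<^sup>2 * N" if h: "0 \<le> h" "m h \<le> M" for h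
    proof -
      have "m h < M1" using h(2) unfolding M1_def by simp
      then obtain z where z: "z \<in> Z" "g h z < M1"
        unfolding m_def using cINF_less_iff[OF ne bdd] by blast
      have "a z < M1" using g1[OF z(1), of h] z(2) by simp
      then have n: "snd z \<le> N" using N[of z] Z[OF z(1)] by simp
      have "sqrt (h / snd z) \<le> g h z"
        unfolding g_def using mult_mono[OF Z(3)[OF z(1)], of "sqrt (h / snd z)" "max 1 (sqrt (h / snd z))"]
          Z[OF z(1)] h(1) by simp
      then have "sqrt (h / snd z) \<le> M1" using z(2) by simp
      then have "h / snd z \<le> M1\<^sup>2" by (rule sqrt_le_D)
      then have "h \<le> M1\<^sup>2 * snd z" using Z(4)[OF z(1)] by (simp add: divide_simps)
      also have "\<dots> \<le> M1\<^sup>2 * N" using n by (intro mult_left_mono) auto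
      finally show ?thesis .
    qed
    then show ?thesis by blast
  qed
  have m_lip: "\<bar>m h - m h'\<bar> \<le> 2 * c" if h: "h0 \<le> h" "h \<le> h'" "h' - h \<le> 1" for h h'
  proof -
    have pos: "h > 0" "h' > 0" "h' \<ge> 1" using h h0 by auto
    have "h \<le> h'" by fact
    then have up: "m h \<le> m h'" using mr[of 1 h h'] pos by simp
    \<comment> \<open>then \<open>r\<^sup>2 * h' \<le> h\<close>, while \<open>1 - r \<le> 1 / h'\<close>\<close>
    define r where "r = h / h'"
    have r: "0 \<le> r" "r \<le> 1" unfolding r_def using h pos by auto
    have "r\<^sup>2 * h' \<le> h"
    proof -
      have "r * h' = h" unfolding r_def using pos by simp
      then have "r\<^sup>2 * h' = r * h" by (simp add: power2_eq_square)
      then show ?thesis using r pos by (simp add: mult_left_le_one_le)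
    qed
    then have "r * m h' \<le> m h" using mr[of r h' h] r pos by simp
    then have "m h' - m h \<le> (1 - r) * m h'" by (simp add: algebra_simps)
    also have "\<dots> = (h' - h) * (m h' / h')" unfolding r_def using pos by (simp add: field_simps)
    also have "\<dots> \<le> 1 * (2 * c)"
    proof (rule mult_mono)
      have t: "(0, h') \<in> Z" using top h by simp
      have "m h' \<le> a (0, h')" using m_a[of "(0, h')"] Z[OF t] by simp
      also have "\<dots> \<le> c * (h' + 1)" using growth[OF Z(1)[OF t]] by simp
      finally have mc: "m h' \<le> c * (h' + 1)" .
      moreover from this have "0 \<le> c * (h' + 1)" using m1[of h'] by simp
      then have "c \<ge> 0" using pos by (simp add: zero_le_mult_iff)
      then have "c * 1 \<le> c * h'" using pos by (intro mult_left_mono) auto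
      ultimately have "m h' \<le> 2 * c * h'" by (simp add: algebra_simps)
      then show "m h' / h' \<le> 2 * c" using pos by (simp add: divide_simps)
      show "0 \<le> m h' / h'" using m1[of h'] pos by simp
    qed (use h in auto)
    finally show ?thesis using up by simp
  qed
  have "\<bar>m h - m h'\<bar> \<le> 2 * c" if "h0 \<le> h" "h0 \<le> h'" "\<bar>h - h'\<bar> \<le> 1" for h h'
    using m_lip[of h h'] m_lip[of h' h] that by (cases "h \<le> h'") (auto simp: abs_minus_commute)
  with m_a m1 mr m_proper show ?thesis by (intro exI[of _ m] conjI ballI allI impI)
qed

context approximable_pair
begin

text \<open>For large heights the base coordinate of a coarse map \<open>F\<close>, made continuous by Lipschitz
  approximation and pushed into \<open>X\<close>, is a family \<open>\<Omega> s\<close> of relative maps. Since the height of \<open>F\<close>,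
  which is comparable with \<open>a\<close>, may grow slowly, \<open>\<Omega>\<close> is Lipschitz only with a constant of order
  \<open>1 / a\<close> in the metric of the cone. The last clause compares \<open>\<Omega>\<close> with \<open>F\<close>: if \<open>z\<close> is high enough and
  \<open>F z\<close> lies over \<open>y\<close>, then \<open>y\<close> can be joined to \<open>\<Omega> s (base_point z)\<close> within \<open>X\<close>, and within \<open>X0\<close> if
  \<open>y \<in> X0\<close>, even when \<open>s\<close> differs from the height of \<open>z\<close> by up to \<open>R\<close>.\<close>

definition base_family ::
    "((real ^ 'n::{finite,linorder}) \<times> real \<Rightarrow> 'b \<times> real) \<Rightarrow> real \<Rightarrow>
     (real \<Rightarrow> real ^ 'n::{finite,linorder} \<Rightarrow> 'b) \<Rightarrow> ((real ^ 'n::{finite,linorder}) \<times> real \<Rightarrow> real) \<Rightarrow>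
     real \<Rightarrow> real \<Rightarrow> real \<Rightarrow> bool" where
  "base_family F h0 \<Omega> a C c \<delta> \<longleftrightarrow>
     1 \<le> h0 \<and> 0 \<le> C \<and> 0 < \<delta> \<and>
     (\<forall>z\<in>cube_cone. h0 \<le> snd z \<longrightarrow> 1 \<le> a z) \<and>
     (\<forall>M. \<exists>N. \<forall>z\<in>cube_cone. h0 \<le> snd z \<and> a z \<le> M \<longrightarrow> snd z \<le> N) \<and>
     (\<forall>z\<in>cube_cone. a z \<le> c * (snd z + 1)) \<and>
     (\<forall>x\<in>unit_cube. \<forall>x'\<in>unit_cube. \<forall>s\<ge>h0. \<forall>s'\<ge>h0.
        dist (\<Omega> s x) (\<Omega> s' x') \<le> C * (\<bar>s - s'\<bar> + s * dist x x') / a (s *\<^sub>R x, s)) \<and>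
     (\<forall>s\<ge>h0. \<Omega> s \<in> rel_maps X X0 x0) \<and>
     (\<forall>x\<in>unit_cube. \<forall>s\<ge>h0. infdist x boundary_plus < \<delta> \<longrightarrow> \<Omega> s x = x0) \<and>
     (\<forall>R. \<exists>h1. \<forall>z\<in>cube_cone. h1 \<le> snd z \<longrightarrow>
       (\<forall>Y y. (Y = X \<or> Y = X0) \<longrightarrow> y \<in> Y \<longrightarrow> fst (F z) = snd (F z) *\<^sub>R y \<longrightarrow>
         (\<forall>s. h0 \<le> s \<and> \<bar>s - snd z\<bar> \<le> R \<longrightarrow> closed_segment y (\<Omega> s (base_point z)) \<subseteq> Y)))"

lemma coarse_map_base_family:
  fixes F :: "(real ^ 'n::{finite,linorder}) \<times> real \<Rightarrow> 'b \<times> real"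
  assumes F: "F \<in> coarse_maps"
  obtains h0 \<Omega> a C c \<delta> where "base_family F h0 \<Omega> a C c \<delta>"
proof -
  note DF = coarse_mapsD[OF F]
  define n where "n = real CARD('n)"
  have n: "n \<ge> 0" unfolding n_def by simp
  obtain B where B: "\<And>x. x \<in> X \<Longrightarrow> norm x \<le> B" "B > 0" using bounded_X bounded_pos by metis
  obtain M D Ft where Ft: "M-lipschitz_on cube_cone Ft" and D: "D \<ge> 0"
    "\<And>z. z \<in> cube_cone \<Longrightarrow> dist (F z) (Ft z) \<le> D"
    using ls_lipschitz_approx[OF DF(2)] by metis
  have M: "M \<ge> 0" by (rule lipschitz_on_nonneg[OF Ft])
  obtain \<kappa> where \<kappa>: "\<kappa> > 0" "\<And>y a p. y \<in> X \<Longrightarrow> 0 < a \<Longrightarrow> dist p (a *\<^sub>R y, a) \<le> \<kappa> * a \<Longrightarrow>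
       a / 2 \<le> snd p \<and> dist y (fst p /\<^sub>R snd p) < \<epsilon>"
    using central_projection_near by metis
  define a where "a z = snd (Ft z)" for z
  define w where "w z = fst (Ft z) /\<^sub>R a z" for z
  define \<Omega> where "\<Omega> s x = \<rho> (w (s *\<^sub>R x, s))" for s x
  \<comment> \<open>within \<open>\<delta>\<close> of \<open>boundary_plus\<close>, scaled by the height, \<open>F\<close> is close to the ray over \<open>x0\<close>\<close>
  define \<delta> where "\<delta> = \<kappa> / (2 * (M + 1))"
  have \<delta>: "\<delta> > 0" unfolding \<delta>_def using \<kappa>(1) M by simp
  \<comment> \<open>far out, a given error \<open>E\<close> is at most \<open>\<kappa>\<close> times the height of \<open>F\<close>\<close>
  have large: "\<exists>h1. \<forall>z\<in>cube_cone. h1 \<le> snd z \<longrightarrow> max 2 (E / \<kappa>) < snd (F z)" for E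
  proof -
    obtain N where "\<forall>z\<in>cube_cone. snd (F z) \<le> max 2 (E / \<kappa>) \<longrightarrow> snd z \<le> N"
      using DF(3) unfolding height_proper_def by metis
    then have "\<forall>z\<in>cube_cone. N + 1 \<le> snd z \<longrightarrow> max 2 (E / \<kappa>) < snd (F z)" by force
    then show ?thesis by blast
  qed
  obtain h1 where h1: "\<forall>z\<in>cube_cone. h1 \<le> snd z \<longrightarrow> max 2 (D / \<kappa>) < snd (F z)"
    using large[of D] by blast
  define h0 where "h0 = max (max 1 h1) (2 * D / \<kappa>)"
  have h0: "h0 \<ge> 1" "h0 \<ge> h1" "D \<le> \<kappa> * (h0 / 2)"
  proof -
    have "2 * D / \<kappa> \<le> h0" unfolding h0_def by simp
    then show "D \<le> \<kappa> * (h0 / 2)" using \<kappa>(1) by (simp add: divide_simps mult.commute)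
  qed (simp_all add: h0_def)
  have near_gen: "1 \<le> snd p \<and> dist y (fst p /\<^sub>R snd p) < \<epsilon>"
    if y: "y \<in> X" "fst (F z) = snd (F z) *\<^sub>R y" and s: "max 2 (E / \<kappa>) < snd (F z)" and d: "dist p (F z) \<le> E"
    for y z E p
  proof -
    have s2: "2 < snd (F z)" "E / \<kappa> < snd (F z)" using s by auto
    have "F z = (snd (F z) *\<^sub>R y, snd (F z))" using y(2) by (simp add: prod_eq_iff)
    moreover have "E \<le> \<kappa> * snd (F z)" using s2(2) \<kappa>(1) by (simp add: divide_simps mult.commute)
    ultimately have "dist p (snd (F z) *\<^sub>R y, snd (F z)) \<le> \<kappa> * snd (F z)" using d by simp
    then show ?thesis using \<kappa>(2)[OF y(1), of "snd (F z)" p] s2(1) by auto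
  qed
  have near: "1 \<le> a z \<and> dist y (w z) < \<epsilon>"
    if z: "z \<in> cube_cone" "h0 \<le> snd z" and y: "y \<in> X" "fst (F z) = snd (F z) *\<^sub>R y" for z y
    unfolding w_def a_def
  proof (rule near_gen[OF y])
    show "max 2 (D / \<kappa>) < snd (F z)" using h1 z h0(2) by (meson order_trans)
    show "dist (Ft z) (F z) \<le> D" using D(2)[OF z(1)] by (simp add: dist_commute)
  qed
  have FX: "\<exists>y\<in>X. fst (F z) = snd (F z) *\<^sub>R y" if "z \<in> cube_cone" for z
    using DF(1)[OF that] unfolding metric_cone_iff by blast
  have a1: "1 \<le> a z" and wX: "\<exists>y\<in>X. dist y (w z) < \<epsilon>" if "z \<in> cube_cone" "h0 \<le> snd z" for z
    using FX[OF that(1)] near[OF that] by blast+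
  have sc: "(s *\<^sub>R x, s) \<in> cube_cone" if "x \<in> unit_cube" "h0 \<le> s" for x :: "real ^ 'n::{finite,linorder}" and s
    using that h0(1) by (intro scaled_in_metric_cone) auto
  have dsc: "dist (s *\<^sub>R x, s) (s' *\<^sub>R x', s') \<le> (n + 1) * (\<bar>s - s'\<bar> + s * dist x x')"
    if x: "x' \<in> unit_cube" and s: "0 \<le> s" for x x' :: "real ^ 'n::{finite,linorder}" and s s' :: real
  proof -
    have "s *\<^sub>R x - s' *\<^sub>R x' = s *\<^sub>R (x - x') + (s - s') *\<^sub>R x'" by (simp add: algebra_simps)
    then have "dist (s *\<^sub>R x) (s' *\<^sub>R x') \<le> s * dist x x' + \<bar>s - s'\<bar> * norm x'"
      unfolding dist_norm using s by (metis abs_of_nonneg norm_scaleR norm_triangle_ineq)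
    also have "\<dots> \<le> s * dist x x' + \<bar>s - s'\<bar> * n"
      using norm_unit_cube[OF x] s unfolding n_def by (intro add_mono mult_left_mono) auto
    finally have "dist (s *\<^sub>R x, s) (s' *\<^sub>R x', s') \<le> (s * dist x x' + \<bar>s - s'\<bar> * n) + \<bar>s - s'\<bar>"
      using dist_Pair_le[of "s *\<^sub>R x" s "s' *\<^sub>R x'" s'] by (simp add: dist_real_def)
    also have "\<dots> \<le> (n + 1) * (\<bar>s - s'\<bar> + s * dist x x')"
      using mult_nonneg_nonneg[OF n mult_nonneg_nonneg[OF s zero_le_dist[of x x']]] by (simp add: algebra_simps)
    finally show ?thesis .
  qed
  have w_lip: "dist (w z) (w z') \<le> M * (1 + B + \<epsilon>) * dist z z' / a z"
    if z: "z \<in> cube_cone" "h0 \<le> snd z" "z' \<in> cube_cone" "h0 \<le> snd z'" for z z'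
  proof -
    have a: "a z > 0" "a z' > 0" using a1[OF z(1,2)] a1[OF z(3,4)] by auto
    obtain y where y: "y \<in> X" "dist y (w z') < \<epsilon>" using wX[OF z(3,4)] by blast
    have "norm (w z') \<le> norm y + norm (w z' - y)" by (rule norm_triangle_sub)
    then have nw: "norm (w z') \<le> B + \<epsilon>" using B(1)[OF y(1)] y(2) by (simp add: dist_norm norm_minus_commute)
    have FL: "dist (Ft z) (Ft z') \<le> M * dist z z'" by (rule lipschitz_onD[OF Ft z(1,3)])
    have "fst (Ft z') = a z' *\<^sub>R w z'" using a unfolding w_def by simp
    then have "w z - w z' = ((fst (Ft z) - fst (Ft z')) + (a z' - a z) *\<^sub>R w z') /\<^sub>R a z"
      using a unfolding w_def[of z] by (simp add: algebra_simps)
    then have "dist (w z) (w z') = norm ((fst (Ft z) - fst (Ft z')) + (a z' - a z) *\<^sub>R w z') / a z"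
      unfolding dist_norm using a by (simp add: divide_inverse mult.commute)
    also have "\<dots> \<le> (M * dist z z' + M * dist z z' * (B + \<epsilon>)) / a z"
    proof (rule divide_right_mono)
      have "norm (fst (Ft z) - fst (Ft z')) \<le> M * dist z z'"
        using dist_fst_le[of "Ft z" "Ft z'"] FL by (simp add: dist_norm)
      moreover have "\<bar>a z' - a z\<bar> \<le> M * dist z z'"
        using dist_snd_le[of "Ft z" "Ft z'"] FL unfolding a_def by (simp add: dist_real_def abs_minus_commute)
      then have "norm ((a z' - a z) *\<^sub>R w z') \<le> M * dist z z' * (B + \<epsilon>)"
        using nw by (simp add: mult_mono)
      ultimately show "norm ((fst (Ft z) - fst (Ft z')) + (a z' - a z) *\<^sub>R w z')
          \<le> M * dist z z' + M * dist z z' * (B + \<epsilon>)" by (rule norm_triangle_mono)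
    qed (use a in simp)
    finally show ?thesis by (simp add: algebra_simps)
  qed
  have L: "L \<ge> 0" by (rule lipschitz_on_nonneg[OF lipschitz_\<rho>])
  define C where "C = L * (M * (1 + B + \<epsilon>) * (n + 1))"
  have MB: "M * (1 + B + \<epsilon>) \<ge> 0" using M B(2) eps by simp
  have C: "C \<ge> 0" unfolding C_def using L MB n by simp
  have \<Omega>_lip: "dist (\<Omega> s x) (\<Omega> s' x') \<le> C * (\<bar>s - s'\<bar> + s * dist x x') / a (s *\<^sub>R x, s)"
    if x: "x \<in> unit_cube" "x' \<in> unit_cube" and s: "h0 \<le> s" "h0 \<le> s'" for s x s' x'
  proof -
    let ?z = "(s *\<^sub>R x, s)" and ?z' = "(s' *\<^sub>R x', s')"
    have z: "?z \<in> cube_cone" "h0 \<le> snd ?z" "?z' \<in> cube_cone" "h0 \<le> snd ?z'" using sc x s by auto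
    have "dist (\<Omega> s x) (\<Omega> s' x') \<le> L * dist (w ?z) (w ?z')"
      unfolding \<Omega>_def by (rule lipschitz_onD[OF lipschitz_\<rho>]) (use wX z in blast)+
    also have "\<dots> \<le> L * (M * (1 + B + \<epsilon>) * dist ?z ?z' / a ?z)"
      by (rule mult_left_mono[OF w_lip[OF z] L])
    also have "\<dots> \<le> L * (M * (1 + B + \<epsilon>) * ((n + 1) * (\<bar>s - s'\<bar> + s * dist x x')) / a ?z)"
      using dsc[OF x(2), of s x s'] a1[OF z(1,2)] L MB s h0(1)
      by (intro mult_left_mono divide_right_mono) auto
    finally show ?thesis unfolding C_def by (simp add: algebra_simps)
  qed
  have \<Omega>_bp: "\<Omega> s x = x0" if x: "x \<in> unit_cube" "infdist x boundary_plus < \<delta>" and s: "h0 \<le> s" for s x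
  proof -
    have "\<exists>y\<in>boundary_plus. dist x y < \<delta>"
      using x(2) cINF_less_iff[OF boundary_plus_nonempty bdd_below_image_dist]
      unfolding infdist_notempty[OF boundary_plus_nonempty] by blast
    then obtain y where y: "y \<in> boundary_plus" "dist x y < \<delta>" by blast
    have yc: "y \<in> unit_cube" using subsetD[OF frontier_cube_subset subsetD[OF boundary_plus_subset y(1)]] .
    have s0: "s > 0" using s h0(1) by linarith
    let ?z = "(s *\<^sub>R x, s)" and ?z' = "(s *\<^sub>R y, s)"
    have z: "?z \<in> cube_cone" "?z' \<in> cube_cone" using sc x s yc by auto
    have Fz': "F ?z' = (s *\<^sub>R x0, s)"
      using DF(5)[of ?z'] scaled_in_metric_cone[OF less_imp_le[OF s0] y(1)] by simp
    have "dist ?z ?z' = s * dist x y" using s0 by (simp add: dist_Pair_Pair dist_norm flip: scaleR_diff_right)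
    also have "\<dots> \<le> s * \<delta>" using y(2) s0 by simp
    finally have dz: "dist ?z ?z' \<le> s * \<delta>" .
    have "dist (Ft ?z) (s *\<^sub>R x0, s) \<le> dist (Ft ?z) (Ft ?z') + dist (F ?z') (Ft ?z')"
      unfolding Fz' by (metis dist_commute dist_triangle)
    also have "\<dots> \<le> M * dist ?z ?z' + D" by (intro add_mono lipschitz_onD[OF Ft z] D(2) z)
    also have "\<dots> \<le> M * (s * \<delta>) + \<kappa> * (s / 2)"
    proof (intro add_mono mult_left_mono dz M)
      have "\<kappa> * (h0 / 2) \<le> \<kappa> * (s / 2)" using s \<kappa>(1) by (intro mult_left_mono) auto
      then show "D \<le> \<kappa> * (s / 2)" using h0(3) by linarith
    qed
    also have "M * (s * \<delta>) \<le> (M + 1) * (s * \<delta>)" using s0 \<delta> by (intro mult_right_mono) auto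
    also have "(M + 1) * (s * \<delta>) = \<kappa> * (s / 2)" unfolding \<delta>_def using M by (simp add: divide_simps)
    finally have "dist (Ft ?z) (s *\<^sub>R x0, s) \<le> \<kappa> * s" by simp
    then have "dist x0 (w ?z) < \<epsilon>"
      using \<kappa>(2)[of x0 s "Ft ?z"] x0_in X0_subset s0 unfolding w_def a_def by auto
    then show ?thesis unfolding \<Omega>_def by (rule \<rho>_x0)
  qed
  have \<Omega>_map: "\<Omega> s \<in> rel_maps X X0 x0" if s: "h0 \<le> s" for s
  proof -
    have s0: "s > 0" using s h0(1) by linarith
    have "(C * s)-lipschitz_on unit_cube (\<Omega> s)"
    proof (rule lipschitz_onI)
      fix x x' :: "real ^ 'n::{finite,linorder}" assume x: "x \<in> unit_cube" "x' \<in> unit_cube"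
      have "dist (\<Omega> s x) (\<Omega> s x') \<le> C * (s * dist x x') / a (s *\<^sub>R x, s)" using \<Omega>_lip[OF x s s] by simp
      also have "\<dots> \<le> C * (s * dist x x') / 1"
        using a1[OF sc[OF x(1) s]] s C s0 by (intro divide_left_mono) auto
      finally show "dist (\<Omega> s x) (\<Omega> s x') \<le> C * s * dist x x'" by simp
    qed (use C s0 in simp)
    then have "continuous_on unit_cube (\<Omega> s)" by (rule lipschitz_on_continuous_on)
    moreover have "\<Omega> s x \<in> X" if "x \<in> unit_cube" for x
      using wX[OF sc[OF that s]] s \<rho>_in_X unfolding \<Omega>_def by auto
    moreover have "\<Omega> s x \<in> X0" if x: "x \<in> frontier unit_cube" for x
    proof -
      have "F (s *\<^sub>R x, s) \<in> metric_cone X0"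
        by (intro DF(4) scaled_in_metric_cone less_imp_le[OF s0] x)
      then obtain y where y: "y \<in> X0" "fst (F (s *\<^sub>R x, s)) = snd (F (s *\<^sub>R x, s)) *\<^sub>R y"
        unfolding metric_cone_iff by blast
      have "dist y (w (s *\<^sub>R x, s)) < \<epsilon>"
        using near[OF sc[OF subsetD[OF frontier_cube_subset x] s] _ subsetD[OF X0_subset y(1)] y(2)] s by simp
      then show ?thesis unfolding \<Omega>_def by (rule \<rho>_in_X0[OF y(1)])
    qed
    moreover have "\<Omega> s x = x0" if x: "x \<in> boundary_plus" for x
      using \<Omega>_bp[OF subsetD[OF frontier_cube_subset subsetD[OF boundary_plus_subset x]] _ s] x \<delta> by simp
    ultimately show ?thesis unfolding rel_maps_iff by simp
  qed
  obtain c where c: "c \<ge> 0" "\<And>z. z \<in> cube_cone \<Longrightarrow> norm (Ft z) \<le> c * (snd z + 1)"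
    using ls_lipschitz_growth[OF lipschitz_on_imp_ls[OF Ft]] by metis
  have growth: "a z \<le> c * (snd z + 1)" if "z \<in> cube_cone" for z
  proof -
    have "a z \<le> norm (Ft z)" unfolding a_def using norm_snd_le[of "snd (Ft z)" "fst (Ft z)"] by simp
    then show ?thesis using c(2)[OF that] by linarith
  qed
  have proper: "\<exists>N. \<forall>z\<in>cube_cone. h0 \<le> snd z \<and> a z \<le> A \<longrightarrow> snd z \<le> N" for A
  proof -
    obtain N where N: "\<forall>z\<in>cube_cone. snd (F z) \<le> A + D \<longrightarrow> snd z \<le> N"
      using DF(3) unfolding height_proper_def by metis
    have "snd z \<le> N" if "z \<in> cube_cone" "a z \<le> A" for z
    proof -
      have "\<bar>snd (F z) - a z\<bar> \<le> D"
        using dist_snd_le[of "F z" "Ft z"] D(2)[OF that(1)] unfolding a_def by (simp add: dist_real_def)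
      then show ?thesis using N that by force
    qed
    then show ?thesis by blast
  qed
  have segs: "\<exists>h1. \<forall>z\<in>cube_cone. h1 \<le> snd z \<longrightarrow>
       (\<forall>Y y. (Y = X \<or> Y = X0) \<longrightarrow> y \<in> Y \<longrightarrow> fst (F z) = snd (F z) *\<^sub>R y \<longrightarrow>
         (\<forall>s. h0 \<le> s \<and> \<bar>s - snd z\<bar> \<le> R \<longrightarrow> closed_segment y (\<Omega> s (base_point z)) \<subseteq> Y))" for R
  proof -
    define E where "E = M * ((n + 1) * \<bar>R\<bar>) + D"
    obtain h2 where h2: "\<forall>z\<in>cube_cone. h2 \<le> snd z \<longrightarrow> max 2 (E / \<kappa>) < snd (F z)"
      using large[of E] by blast
    have "(\<forall>Y y. (Y = X \<or> Y = X0) \<longrightarrow> y \<in> Y \<longrightarrow> fst (F z) = snd (F z) *\<^sub>R y \<longrightarrow>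
         (\<forall>s. h0 \<le> s \<and> \<bar>s - snd z\<bar> \<le> R \<longrightarrow> closed_segment y (\<Omega> s (base_point z)) \<subseteq> Y))"
      if z: "z \<in> cube_cone" "h2 \<le> snd z" for z
    proof (intro allI impI)
      have big: "max 2 (E / \<kappa>) < snd (F z)" using h2 z by blast
      fix Y y s assume Y: "Y = X \<or> Y = X0" and y: "y \<in> Y" "fst (F z) = snd (F z) *\<^sub>R y"
        and s: "h0 \<le> s \<and> \<bar>s - snd z\<bar> \<le> R"
      have x: "base_point z \<in> unit_cube" by (rule cube_coneD(3)[OF z(1)])
      let ?z' = "(s *\<^sub>R base_point z, s)"
      have z': "?z' \<in> cube_cone" using sc[OF x] s by blast
      have yX: "y \<in> X" using y(1) Y X0_subset by blast
      have "dist ?z' z \<le> (n + 1) * \<bar>s - snd z\<bar>"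
        using dsc[OF x, of s "base_point z" "snd z"] s h0(1)
        by (subst cube_coneD(4)[OF z(1)]) simp
      also have "\<dots> \<le> (n + 1) * \<bar>R\<bar>" using s n by (intro mult_left_mono) auto
      finally have "M * dist ?z' z \<le> M * ((n + 1) * \<bar>R\<bar>)" by (rule mult_left_mono[OF _ M])
      then have "dist (Ft ?z') (Ft z) \<le> M * ((n + 1) * \<bar>R\<bar>)" using lipschitz_onD[OF Ft z' z(1)] by linarith
      then have "dist (Ft ?z') (F z) \<le> E"
        unfolding E_def using D(2)[OF z(1)] dist_triangle[of "Ft ?z'" "F z" "Ft z"] by (simp add: dist_commute)
      from near_gen[OF yX y(2) big this] have "dist y (w ?z') < \<epsilon>" unfolding w_def a_def by blast
      then show "closed_segment y (\<Omega> s (base_point z)) \<subseteq> Y"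
        unfolding \<Omega>_def using Y y(1) segment_X segment_X0 by blast
    qed
    then show ?thesis by blast
  qed
  have "base_family F h0 \<Omega> a C c \<delta>"
    unfolding base_family_def
    by (intro conjI ballI allI impI h0(1) C \<delta> a1 proper growth \<Omega>_lip \<Omega>_map \<Omega>_bp segs)
  then show thesis by (rule that)
qed

text \<open>The homotopy from \<open>F\<close> to a cone consists of three parts. First the height of \<open>F\<close> moves
  linearly to a slowly growing height \<open>A\<close>, except near \<open>boundary_plus\<close>, where the height has to stay
  what it is; at the same time the base point \<open>y\<close> of \<open>F z\<close> moves to \<open>\<Omega> (h0 + h) x\<close>. Then the
  parameter \<open>s\<close> of \<open>\<Omega> s x\<close> slides from \<open>h0 + h\<close> down to \<open>h0\<close>, quadratically in time: this has
  bounded speed because the Lipschitz constant of \<open>\<Omega>\<close> at \<open>s\<close> is of order \<open>1 / m s\<close>, because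
  \<open>A\<close> is at most \<open>m (h0 + h)\<close> wherever \<open>\<Omega>\<close> moves, and because \<open>m (h0 + h) / m s\<close> is at most
  \<open>sqrt ((h0 + h) / s)\<close>. Finally the height returns linearly to \<open>h\<close>.\<close>

theorem coarse_map_homotopic_radial_map:
  fixes F :: "(real ^ 'n::{finite,linorder}) \<times> real \<Rightarrow> 'b \<times> real"
  assumes F: "F \<in> coarse_maps"
  obtains u C where "u \<in> rel_maps X X0 x0" "C-lipschitz_on unit_cube u" "(F, radial_map u) \<in> coarse_htpy"
proof -
  obtain h0 \<Omega> a C c \<delta> where fam: "base_family F h0 \<Omega> a C c \<delta>"
    using coarse_map_base_family[OF F] by metis
  note fam = fam[unfolded base_family_def]
  have h0: "1 \<le> h0" and C: "0 \<le> C" and \<delta>: "0 < \<delta>"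
    and a1: "\<And>z. z \<in> cube_cone \<Longrightarrow> h0 \<le> snd z \<Longrightarrow> 1 \<le> a z"
    and a_proper: "\<And>M. \<exists>N. \<forall>z\<in>cube_cone. h0 \<le> snd z \<and> a z \<le> M \<longrightarrow> snd z \<le> N"
    and a_growth: "\<And>z. z \<in> cube_cone \<Longrightarrow> a z \<le> c * (snd z + 1)"
    and \<Omega>_lip: "\<And>s x s' x'. x \<in> unit_cube \<Longrightarrow> x' \<in> unit_cube \<Longrightarrow> h0 \<le> s \<Longrightarrow> h0 \<le> s' \<Longrightarrow>
       dist (\<Omega> s x) (\<Omega> s' x') \<le> C * (\<bar>s - s'\<bar> + s * dist x x') / a (s *\<^sub>R x, s)"
    and \<Omega>_map: "\<And>s. h0 \<le> s \<Longrightarrow> \<Omega> s \<in> rel_maps X X0 x0"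
    and \<Omega>_bp: "\<And>s x. x \<in> unit_cube \<Longrightarrow> infdist x boundary_plus < \<delta> \<Longrightarrow> h0 \<le> s \<Longrightarrow> \<Omega> s x = x0"
    using fam by - (elim conjE, simp)+
  have segs: "\<exists>h1. \<forall>z\<in>cube_cone. h1 \<le> snd z \<longrightarrow>
       (\<forall>Y y. (Y = X \<or> Y = X0) \<longrightarrow> y \<in> Y \<longrightarrow> fst (F z) = snd (F z) *\<^sub>R y \<longrightarrow>
         (\<forall>s. h0 \<le> s \<and> \<bar>s - snd z\<bar> \<le> R \<longrightarrow> closed_segment y (\<Omega> s (base_point z)) \<subseteq> Y))" for R
    using fam by (elim conjE) (erule spec)
  have "\<exists>m :: real \<Rightarrow> real. (\<forall>z\<in>cube_cone. h0 \<le> snd z \<longrightarrow> m (snd z) \<le> a z) \<and> (\<forall>h. 1 \<le> m h) \<and>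
    (\<forall>r h s. 0 \<le> r \<longrightarrow> r \<le> 1 \<longrightarrow> 0 \<le> h \<longrightarrow> r\<^sup>2 * h \<le> s \<longrightarrow> r * m h \<le> m s) \<and>
    (\<forall>M. \<exists>N. \<forall>h\<ge>0. m h \<le> M \<longrightarrow> h \<le> N) \<and>
    (\<forall>h h'. h0 \<le> h \<longrightarrow> h0 \<le> h' \<longrightarrow> \<bar>h - h'\<bar> \<le> 1 \<longrightarrow> \<bar>m h - m h'\<bar> \<le> 2 * c)"
    by (rule slow_minorant[OF h0]) (fact a1 a_proper a_growth)+
  then obtain m :: "real \<Rightarrow> real" where
    m: "\<forall>z\<in>cube_cone. h0 \<le> snd z \<longrightarrow> m (snd z) \<le> a z" "\<forall>h. 1 \<le> m h"
    "\<forall>r h s. 0 \<le> r \<longrightarrow> r \<le> 1 \<longrightarrow> 0 \<le> h \<longrightarrow> r\<^sup>2 * h \<le> s \<longrightarrow> r * m h \<le> m s"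
    "\<forall>M. \<exists>N. \<forall>h\<ge>0. m h \<le> M \<longrightarrow> h \<le> N"
    "\<forall>h h'. h0 \<le> h \<longrightarrow> h0 \<le> h' \<longrightarrow> \<bar>h - h'\<bar> \<le> 1 \<longrightarrow> \<bar>m h - m h'\<bar> \<le> 2 * c"
    by (elim exE conjE)
  have m_a: "\<And>z. z \<in> cube_cone \<Longrightarrow> h0 \<le> snd z \<Longrightarrow> m (snd z) \<le> a z"
    and m1: "\<And>h. 1 \<le> m h"
    and mr: "\<And>r h s. 0 \<le> r \<Longrightarrow> r \<le> 1 \<Longrightarrow> 0 \<le> h \<Longrightarrow> r\<^sup>2 * h \<le> s \<Longrightarrow> r * m h \<le> m s"
    and m_proper: "\<And>M. \<exists>N. \<forall>h\<ge>0. m h \<le> M \<longrightarrow> h \<le> N"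
    and m_lip: "\<And>h h'. h0 \<le> h \<Longrightarrow> h0 \<le> h' \<Longrightarrow> \<bar>h - h'\<bar> \<le> 1 \<Longrightarrow> \<bar>m h - m h'\<bar> \<le> 2 * c"
    using m by simp_all
  note DF = coarse_mapsD[OF F]
  define n where "n = real CARD('n)"
  have n: "n \<ge> 0" unfolding n_def by simp
  obtain B where B: "\<And>x. x \<in> X \<Longrightarrow> norm x \<le> B" "B > 0" using bounded_X bounded_pos by metis
  define d where "d z = infdist (base_point z) boundary_plus" for z :: "(real ^ 'n::{finite,linorder}) \<times> real"
  define A where "A z = max (min (m (h0 + snd z)) (snd z)) (snd z - (1 / \<delta>) * (snd z * d z))" for z
  have A_le: "A z \<le> snd z" and A_ge: "min (m (h0 + snd z)) (snd z) \<le> A z" and A0: "0 \<le> A z"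
    if "z \<in> cube_cone" for z
  proof -
    have "0 \<le> (1 / \<delta>) * (snd z * d z)"
      using \<delta> cube_coneD(1)[OF that] infdist_nonneg unfolding d_def by (intro mult_nonneg_nonneg) auto
    then show "A z \<le> snd z" unfolding A_def by auto
    show "min (m (h0 + snd z)) (snd z) \<le> A z" unfolding A_def by (rule max.cobounded1)
    then show "0 \<le> A z" using m1[of "h0 + snd z"] cube_coneD(1)[OF that] by linarith
  qed
  have d_small: "d z < \<delta>" if z: "z \<in> cube_cone" "m (h0 + snd z) < A z" for z
  proof (rule ccontr)
    assume "\<not> d z < \<delta>"
    then have "1 \<le> d z / \<delta>" using \<delta> by simp
    then have "snd z * 1 \<le> snd z * (d z / \<delta>)" using cube_coneD(1)[OF z(1)] by (intro mult_left_mono) auto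
    then have "A z \<le> max (min (m (h0 + snd z)) (snd z)) 0" unfolding A_def by (intro max.mono) auto
    then show False using z(2) m1[of "h0 + snd z"] by linarith
  qed
  have A_ls: "ls_lipschitz_on cube_cone A"
    unfolding A_def
  proof (intro ls_lipschitz_on_max ls_lipschitz_on_min ls_lipschitz_on_diff ls_lipschitz_on_mult
      ls_lipschitz_on_snd ls_lipschitz_on_id)
    show "ls_lipschitz_on cube_cone (\<lambda>z :: (real ^ 'n::{finite,linorder}) \<times> real. m (h0 + snd z))"
    proof (rule ls_lipschitz_on_convexI[OF convex_cube_cone])
      fix z z' :: "(real ^ 'n::{finite,linorder}) \<times> real"
      assume z: "z \<in> cube_cone" "z' \<in> cube_cone" "dist z z' \<le> 1"
      have "\<bar>snd z - snd z'\<bar> \<le> 1" using dist_snd_le[of z z'] z(3) by (simp add: dist_real_def)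
      then show "dist (m (h0 + snd z)) (m (h0 + snd z')) \<le> 2 * c"
        using m_lip[of "h0 + snd z" "h0 + snd z'"] cube_coneD(1)[OF z(1)] cube_coneD(1)[OF z(2)]
        by (simp add: dist_real_def)
    qed
    have "1-lipschitz_on unit_cube (\<lambda>x :: real ^ 'n::{finite,linorder}. infdist x boundary_plus)"
      by (intro lipschitz_onI) (auto simp: dist_real_def infdist_triangle_abs)
    from lipschitz_imp_ls_radial[OF this]
    show "ls_lipschitz_on cube_cone (\<lambda>z :: (real ^ 'n::{finite,linorder}) \<times> real. snd z * d z)"
      unfolding d_def by simp
  qed
  have A_proper: "height_proper A"
    unfolding height_proper_def
  proof
    fix M
    obtain N where N: "\<forall>h\<ge>0. m h \<le> M \<longrightarrow> h \<le> N" using m_proper by blast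
    have "snd z \<le> max M N" if z: "z \<in> cube_cone" "A z \<le> M" for z
    proof (cases "snd z \<le> M")
      case False
      then have "m (h0 + snd z) \<le> M" using A_ge[OF z(1)] z(2) by linarith
      then have "h0 + snd z \<le> N" using N h0 cube_coneD(1)[OF z(1)] by simp
      then show ?thesis using h0 by linarith
    qed simp
    then show "\<exists>N. \<forall>z\<in>cube_cone. A z \<le> M \<longrightarrow> snd z \<le> N" by blast
  qed
  have A_bp: "A z = snd z" if z: "z \<in> metric_cone boundary_plus" for z
  proof (cases "snd z = 0")
    case True
    then show ?thesis using A_le A0 subsetD[OF cone_frontier_subset subsetD[OF cone_boundary_plus_subset z]]
      by (metis order_antisym)
  next
    case False
    then have "d z = 0" unfolding d_def using base_point_boundary_plus[OF z] by simp
    then show ?thesis unfolding A_def by simp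
  qed
  define S where "S z t = h0 + snd z * (1 - ramp (snd z) t)\<^sup>2"
    for z :: "(real ^ 'n::{finite,linorder}) \<times> real" and t
  have S0: "h0 \<le> S z t" if "z \<in> cube_cone" for z t
    unfolding S_def using cube_coneD(1)[OF that] by simp
  define \<omega> where "\<omega> p = \<Omega> (S (fst p) (snd p)) (base_point (fst p))" for p
  have \<omega>X: "\<omega> (z, t) \<in> X" if "z \<in> cube_cone" for z t
    unfolding \<omega>_def using rel_mapsD(2)[OF \<Omega>_map[OF S0] cube_coneD(3)] that by simp
  have \<omega>_x0: "\<omega> (z, t) = x0" if "z \<in> cube_cone" "d z < \<delta>" for z t
    unfolding \<omega>_def fst_conv snd_conv
    by (rule \<Omega>_bp[OF cube_coneD(3)[OF that(1)] that(2)[unfolded d_def] S0[OF that(1)]])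
  obtain CA where CA: "CA \<ge> 0" "\<And>z z'. z \<in> cube_cone \<Longrightarrow> z' \<in> cube_cone \<Longrightarrow>
      dist (A z) (A z') \<le> CA * (dist z z' + 1)"
    using A_ls by (elim ls_lipschitz_onE) blast
  \<comment> \<open>the two summands bound the effect of the change of \<open>s\<close> and of the change of \<open>x\<close>\<close>
  define C1 where "C1 = C * (19 + (h0 * (2 * n) + (n + 1)))"
  \<comment> \<open>where \<open>A\<close> is slow, the motion of \<open>\<omega>\<close> is compensated by it; elsewhere \<open>\<omega>\<close> is constant\<close>
  have slow1: "A z * dist (\<omega> (z, t)) (\<omega> (z', t')) \<le> C1"
    if z: "z \<in> cube_cone" "z' \<in> cube_cone" and t: "0 \<le> t" "0 \<le> t'" and dz: "dist z z' \<le> 1" "\<bar>t - t'\<bar> \<le> 1"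
      and Am: "A z \<le> m (h0 + snd z)" for z t z' t'
  proof -
    define h h' where "h = snd z" and "h' = snd z'"
    define r r' where "r = 1 - ramp h t" and "r' = 1 - ramp h' t'"
    define x x' where "x = base_point z" and "x' = base_point z'"
    have hh: "0 \<le> h" "0 \<le> h'" unfolding h_def h'_def using cube_coneD(1) z by blast+
    have r: "0 \<le> r" "r \<le> 1" "0 \<le> r'" "r' \<le> 1"
      unfolding r_def r'_def using ramp_range[OF hh(1) t(1)] ramp_range[OF hh(2) t(2)] by auto
    have dh: "\<bar>h - h'\<bar> \<le> 1" unfolding h_def h'_def using dist_snd_le[of z z'] dz(1) by (simp add: dist_real_def)
    have x: "x \<in> unit_cube" "x' \<in> unit_cube" unfolding x_def x'_def using cube_coneD(3) z by blast+
    define g where "g = h0 + h"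
    have g: "g \<ge> 1" "g \<ge> h0" unfolding g_def using h0 hh by auto
    have Sz: "S z t = h0 + h * r\<^sup>2" "S z' t' = h0 + h' * r'\<^sup>2" unfolding S_def h_def h'_def r_def r'_def by auto
    define \<sigma> where "\<sigma> = S z t"
    have r2: "r\<^sup>2 \<le> 1" using r by (simp add: power_le_one)
    have \<sigma>: "h0 \<le> \<sigma>" "\<sigma> \<le> g" "0 < \<sigma>"
    proof -
      show "h0 \<le> \<sigma>" unfolding \<sigma>_def by (rule S0[OF z(1)])
      then show "0 < \<sigma>" using h0 by linarith
      show "\<sigma> \<le> g" unfolding \<sigma>_def Sz g_def using mult_left_mono[OF r2 hh(1)] by simp
    qed
    have m_pos: "0 < m \<sigma>" "0 < m g" using m1[of \<sigma>] m1[of g] by auto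
    \<comment> \<open>three instances of the monotonicity of \<open>m h / sqrt h\<close>\<close>
    have i1: "r * m g \<le> m \<sigma>"
    proof (rule mr[OF r(1,2)])
      have "r\<^sup>2 * h0 \<le> h0" using mult_right_mono[OF r2, of h0] h0 by simp
      then show "r\<^sup>2 * g \<le> \<sigma>" unfolding \<sigma>_def Sz g_def by (simp add: algebra_simps)
    qed (use g in simp)
    have i2: "m g \<le> (h + 1) * m \<sigma>"
    proof -
      have "1 / (h + 1) * m g \<le> m \<sigma>"
      proof (rule mr)
        have "g \<le> h0 * (h + 1)" unfolding g_def using mult_right_mono[OF h0 hh(1)] by (simp add: algebra_simps)
        also have "\<dots> \<le> h0 * (h + 1) * (h + 1)"
          using mult_left_mono[of 1 "h + 1" "h0 * (h + 1)"] h0 hh by simp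
        finally have "(1 / (h + 1))\<^sup>2 * g \<le> h0" using hh by (simp add: power2_eq_square divide_simps)
        then show "(1 / (h + 1))\<^sup>2 * g \<le> \<sigma>" using \<sigma>(1) by linarith
      qed (use hh g in auto)
      then show ?thesis using hh by (simp add: divide_simps mult.commute)
    qed
    have i3: "m g * \<sigma> \<le> m \<sigma> * g"
    proof -
      define q where "q = sqrt (\<sigma> / g)"
      have q: "0 \<le> q" "q \<le> 1" "q\<^sup>2 = \<sigma> / g" unfolding q_def using \<sigma> g by auto
      have "q * m g \<le> m \<sigma>" using q g by (intro mr) auto
      moreover have "\<sigma> = q * (q * g)" using q(3) g by (simp add: power2_eq_square divide_simps)
      ultimately have "m g * \<sigma> \<le> m \<sigma> * (q * g)"
        using mult_right_mono[of "q * m g" "m \<sigma>" "q * g"] q g by (simp add: algebra_simps)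
      also have "\<dots> \<le> m \<sigma> * g"
        using q g m_pos by (intro mult_left_mono) (auto simp: mult_left_le_one_le)
      finally show ?thesis .
    qed
    have dr: "(h + 1) * \<bar>r - r'\<bar> \<le> 3"
    proof -
      have "(h + 1) * \<bar>ramp h' t' - ramp h t\<bar> \<le> \<bar>t' - t\<bar> + 2 * \<bar>h' - h\<bar>"
        by (rule ramp_lipschitz[OF hh(2,1) t(2,1)])
      also have "\<dots> \<le> 3" using dh dz(2) by argo
      finally show ?thesis unfolding r_def r'_def by (simp add: algebra_simps)
    qed
    have b1: "m g * \<bar>S z t - S z' t'\<bar> \<le> 19 * m \<sigma>"
    proof -
      have e: "\<bar>r - r'\<bar> \<le> 3 / (h + 1)" using dr hh by (simp add: divide_simps mult.commute)
      have "S z t - S z' t' = (h * (r - r')) * (r + r') + (h - h') * r'\<^sup>2"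
        unfolding Sz by (simp add: algebra_simps power2_eq_square)
      then have "\<bar>S z t - S z' t'\<bar> \<le> \<bar>h * (r - r')\<bar> * \<bar>r + r'\<bar> + \<bar>h - h'\<bar> * \<bar>r'\<^sup>2\<bar>"
        using abs_triangle_ineq[of "(h * (r - r')) * (r + r')" "(h - h') * r'\<^sup>2"] by (simp add: abs_mult)
      also have "\<dots> \<le> 3 * (r + r') + 1 * r'"
      proof (intro add_mono mult_mono)
        have "\<bar>h * (r - r')\<bar> = h * \<bar>r - r'\<bar>" using hh by (simp add: abs_mult)
        also have "\<dots> \<le> (h + 1) * \<bar>r - r'\<bar>" by (intro mult_right_mono) auto
        finally show "\<bar>h * (r - r')\<bar> \<le> 3" using dr by linarith
        show "\<bar>r'\<^sup>2\<bar> \<le> r'" using r mult_left_le_one_le[of r' r'] by (simp add: power2_eq_square)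
      qed (use r dh in auto)
      also have "\<dots> \<le> 7 * r + 12 / (h + 1)" using e by argo
      finally have "m g * \<bar>S z t - S z' t'\<bar> \<le> m g * (7 * r + 12 / (h + 1))"
        using m_pos by (intro mult_left_mono) auto
      also have "\<dots> = 7 * (r * m g) + 12 * (m g / (h + 1))" by (simp add: algebra_simps)
      also have "\<dots> \<le> 7 * m \<sigma> + 12 * m \<sigma>"
        using i1 i2 hh by (intro add_mono mult_left_mono) (auto simp: divide_simps mult.commute)
      finally show ?thesis by simp
    qed
    have b2: "m g * (\<sigma> * dist x x') \<le> (h0 * (2 * n) + (n + 1)) * m \<sigma>"
    proof -
      have "m g * (\<sigma> * dist x x') = (m g * \<sigma>) * dist x x'" by simp
      also have "\<dots> \<le> (m \<sigma> * g) * dist x x'" by (rule mult_right_mono[OF i3]) simp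
      also have "\<dots> = m \<sigma> * (h0 * dist x x' + h * dist x x')" unfolding g_def by (simp add: algebra_simps)
      also have "\<dots> \<le> m \<sigma> * (h0 * (2 * n) + (n + 1))"
      proof (intro mult_left_mono add_mono)
        have "dist x x' \<le> norm x + norm x'" unfolding dist_norm by (rule norm_triangle_ineq4)
        then show "dist x x' \<le> 2 * n" using norm_unit_cube[OF x(1)] norm_unit_cube[OF x(2)] unfolding n_def by linarith
        have "h * dist x x' \<le> (n + 1) * dist z z'"
          using base_point_lipschitz[OF z] unfolding h_def x_def x'_def n_def dist_norm .
        also have "\<dots> \<le> (n + 1) * 1" using dz(1) n by (intro mult_left_mono) auto
        finally show "h * dist x x' \<le> n + 1" by simp
      qed (use m_pos h0 in auto)
      finally show ?thesis by (simp add: mult.commute)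
    qed
    have asig: "m \<sigma> \<le> a (\<sigma> *\<^sub>R x, \<sigma>)"
      using m_a[of "(\<sigma> *\<^sub>R x, \<sigma>)"] scaled_in_metric_cone[OF less_imp_le[OF \<sigma>(3)] x(1)] \<sigma>(1) by simp
    have "dist (\<omega> (z, t)) (\<omega> (z', t')) \<le> C * (\<bar>\<sigma> - S z' t'\<bar> + \<sigma> * dist x x') / a (\<sigma> *\<^sub>R x, \<sigma>)"
      unfolding \<omega>_def fst_conv snd_conv \<sigma>_def x_def x'_def
      by (rule \<Omega>_lip) (use x S0 z in \<open>auto simp: x_def x'_def\<close>)
    also have "\<dots> \<le> C * (\<bar>\<sigma> - S z' t'\<bar> + \<sigma> * dist x x') / m \<sigma>"
      using asig m_pos C \<sigma> by (intro divide_left_mono) auto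
    finally have "A z * dist (\<omega> (z, t)) (\<omega> (z', t')) \<le> m g * (C * (\<bar>\<sigma> - S z' t'\<bar> + \<sigma> * dist x x') / m \<sigma>)"
      using Am m_pos unfolding g_def h_def by (intro mult_mono) auto
    also have "\<dots> = C * (m g * \<bar>S z t - S z' t'\<bar> + m g * (\<sigma> * dist x x')) / m \<sigma>"
      unfolding \<sigma>_def by (simp add: algebra_simps)
    also have "\<dots> \<le> C * (19 * m \<sigma> + (h0 * (2 * n) + (n + 1)) * m \<sigma>) / m \<sigma>"
      using b1 b2 C m_pos by (intro divide_right_mono mult_left_mono add_mono) auto
    also have "\<dots> = C1" unfolding C1_def using m_pos by (simp add: field_simps)
    finally show ?thesis .
  qed
  have slow: "A z * dist (\<omega> (z, t)) (\<omega> (z', t')) \<le> C1 + CA * 2 * (2 * B)"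
    if z: "z \<in> cube_cone" "z' \<in> cube_cone" and t: "0 \<le> t" "0 \<le> t'" and dz: "dist z z' \<le> 1" "\<bar>t - t'\<bar> \<le> 1"
    for z t z' t'
  proof -
    have nn: "0 \<le> C1" "0 \<le> CA * 2 * (2 * B)" unfolding C1_def using C h0 n CA(1) B(2) by auto
    consider "A z \<le> m (h0 + snd z)" | "m (h0 + snd z) < A z" "m (h0 + snd z') < A z'"
      | "A z' \<le> m (h0 + snd z')" by linarith
    then show ?thesis
    proof cases
      case 1
      then show ?thesis using slow1[OF z t dz] nn by linarith
    next
      case 2
      then show ?thesis using \<omega>_x0 d_small z nn by simp
    next
      case 3
      have "A z' * dist (\<omega> (z', t')) (\<omega> (z, t)) \<le> C1"
        by (rule slow1[OF z(2,1) t(2,1) _ _ 3]) (use dz in \<open>auto simp: dist_commute abs_minus_commute\<close>)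
      moreover have "(A z - A z') * dist (\<omega> (z, t)) (\<omega> (z', t')) \<le> (CA * 2) * (2 * B)"
      proof (rule mult_mono)
        have "CA * (dist z z' + 1) \<le> CA * 2" using dz(1) CA(1) by (intro mult_left_mono) auto
        then show "A z - A z' \<le> CA * 2" using CA(2)[OF z] unfolding dist_real_def by linarith
        have "dist (\<omega> (z, t)) (\<omega> (z', t')) \<le> norm (\<omega> (z, t)) + norm (\<omega> (z', t'))"
          unfolding dist_norm by (rule norm_triangle_ineq4)
        then show "dist (\<omega> (z, t)) (\<omega> (z', t')) \<le> 2 * B"
          using B(1)[OF \<omega>X[OF z(1), of t]] B(1)[OF \<omega>X[OF z(2), of t']] by linarith
      qed (use CA(1) in auto)
      ultimately show ?thesis by (simp add: dist_commute algebra_simps)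
    qed
  qed
  define u where "u = \<Omega> h0"
  have u: "u \<in> rel_maps X X0 x0" unfolding u_def by (rule \<Omega>_map) simp
  have u_lip: "(C * h0)-lipschitz_on unit_cube u"
  proof (rule lipschitz_onI)
    fix x x' :: "real ^ 'n::{finite,linorder}" assume x: "x \<in> unit_cube" "x' \<in> unit_cube"
    have "dist (u x) (u x') \<le> C * (h0 * dist x x') / a (h0 *\<^sub>R x, h0)"
      unfolding u_def using \<Omega>_lip[OF x, of h0 h0] by simp
    also have "\<dots> \<le> C * (h0 * dist x x') / 1"
      using a1[OF scaled_in_metric_cone[OF _ x(1)], of h0] C h0 by (intro divide_left_mono) auto
    finally show "dist (u x) (u x') \<le> C * h0 * dist x x'" by simp
  qed (use C h0 in simp)
  define F1 where "F1 z = (A z *\<^sub>R \<omega> (z, 0), A z)" for z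
  define F2 where "F2 z = (A z *\<^sub>R u (base_point z), A z)" for z
  have slide: "(F1, F2) \<in> coarse_htpy"
    unfolding F1_def F2_def
  proof (rule coarse_htpy_constant_height[where K = 1])
    show "ls_lipschitz_on cube_cone A" by (rule A_ls)
    show "height_proper A" by (rule A_proper)
    show "A z * dist (\<omega> (z, t)) (\<omega> (z', t')) \<le> C1 + CA * 2 * (2 * B)"
      if "z \<in> cube_cone" "z' \<in> cube_cone" "0 \<le> t" "0 \<le> t'" "dist z z' \<le> 1" "\<bar>t - t'\<bar> \<le> 1" for z t z' t'
      by (rule slow[OF that])
    show "\<omega> (z, t) \<in> X0" if z: "z \<in> metric_cone (frontier unit_cube)" for z t
      unfolding \<omega>_def using rel_mapsD(3)[OF \<Omega>_map[OF S0[OF subsetD[OF cone_frontier_subset z]]] base_point_frontier[OF z]]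
      by simp
    show "A z = snd z \<and> (snd z \<noteq> 0 \<longrightarrow> \<omega> (z, t) = x0)" if z: "z \<in> metric_cone boundary_plus" for z t
    proof -
      have zc: "z \<in> cube_cone" using subsetD[OF cone_frontier_subset subsetD[OF cone_boundary_plus_subset z]] .
      show ?thesis
        using A_bp[OF z] rel_mapsD(4)[OF \<Omega>_map[OF S0[OF zc]] base_point_boundary_plus[OF z]]
        unfolding \<omega>_def by simp
    qed
    show "\<omega> (z, t) = u (base_point z)" if "z \<in> cube_cone" "1 * (snd z + 1) \<le> t" for z t
      unfolding \<omega>_def S_def u_def using ramp_1[OF cube_coneD(1)[OF that(1)]] that(2) by simp
  qed (use A0 \<omega>X in auto)
  note maps = coarse_htpy_maps[OF slide]
  have lower: "(F, F1) \<in> coarse_htpy"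
  proof -
    obtain h1 where h1: "\<forall>z\<in>cube_cone. h1 \<le> snd z \<longrightarrow>
       (\<forall>Y y. (Y = X \<or> Y = X0) \<longrightarrow> y \<in> Y \<longrightarrow> fst (F z) = snd (F z) *\<^sub>R y \<longrightarrow>
         (\<forall>s. h0 \<le> s \<and> \<bar>s - snd z\<bar> \<le> h0 \<longrightarrow> closed_segment y (\<Omega> s (base_point z)) \<subseteq> Y))"
      using segs[of h0] by blast
    have seg: "closed_segment (F z) (F1 z) \<subseteq> metric_cone Y"
      if z: "z \<in> cube_cone" "h1 \<le> snd z" and Y: "Y = X \<or> Y = X0" and FY: "F z \<in> metric_cone Y" for z Y
    proof -
      obtain y where y: "0 \<le> snd (F z)" "y \<in> Y" "fst (F z) = snd (F z) *\<^sub>R y"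
        using FY unfolding metric_cone_iff by blast
      have eq: "F z = (snd (F z) *\<^sub>R y, snd (F z))" using y(3) by (simp add: prod_eq_iff)
      have S: "S z 0 = h0 + snd z" unfolding S_def by (simp add: ramp_0)
      have "h0 \<le> S z 0 \<and> \<bar>S z 0 - snd z\<bar> \<le> h0" unfolding S using h0 cube_coneD(1)[OF z(1)] by simp
      then have "closed_segment y (\<omega> (z, 0)) \<subseteq> Y"
        unfolding \<omega>_def fst_conv snd_conv using h1 z Y y(2,3) by blast
      then show ?thesis
        unfolding F1_def by (subst eq) (rule closed_segment_in_cone[OF y(1) A0[OF z(1)]])
    qed
    show ?thesis
    proof (rule coarse_htpy_linear[OF F conjunct1[OF maps], of h1])
      show "closed_segment (F z) (F1 z) \<subseteq> metric_cone X" if "z \<in> cube_cone" "h1 \<le> snd z" for z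
        by (rule seg[OF that _ DF(1)[OF that(1)]]) simp
      show "closed_segment (F z) (F1 z) \<subseteq> metric_cone X0"
        if "z \<in> metric_cone (frontier unit_cube)" "h1 \<le> snd z" for z
        by (rule seg[OF subsetD[OF cone_frontier_subset that(1)] that(2) _ DF(4)[OF that(1)]]) simp
    qed
  qed
  have raise: "(F2, radial_map u) \<in> coarse_htpy"
  proof (rule coarse_htpy_linear[OF conjunct2[OF maps] radial_map_coarse[OF u u_lip], of 0])
    show "closed_segment (F2 z) (radial_map u z) \<subseteq> metric_cone X" if z: "z \<in> cube_cone" for z
      unfolding F2_def radial_map_base_point
      by (rule closed_segment_in_cone[OF A0[OF z] cube_coneD(1)[OF z]])
        (use rel_mapsD(2)[OF u cube_coneD(3)[OF z]] in simp)
    show "closed_segment (F2 z) (radial_map u z) \<subseteq> metric_cone X0"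
      if z: "z \<in> metric_cone (frontier unit_cube)" for z
    proof -
      have zc: "z \<in> cube_cone" by (rule subsetD[OF cone_frontier_subset z])
      show ?thesis unfolding F2_def radial_map_base_point
        by (rule closed_segment_in_cone[OF A0[OF zc] cube_coneD(1)[OF zc]])
          (use rel_mapsD(3)[OF u base_point_frontier[OF z]] in simp)
    qed
  qed
  from coarse_htpy_trans[OF lower coarse_htpy_trans[OF slide raise]] u u_lip
  show thesis by (intro that)
qed

end

section \<open>Reparametrization and concatenation in the first coordinate\<close>

definition set_first :: "real \<Rightarrow> real ^ 'n::{finite,linorder} \<Rightarrow> real ^ 'n::{finite,linorder}" where
  "set_first s x = (\<chi> i. if i = first_index then s else x $ i)"

lemma set_first_nth: "set_first s x $ i = (if i = first_index then s else x $ i)"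
  unfolding set_first_def by simp

lemma set_first_set_first: "set_first s (set_first s' x) = set_first s x"
  unfolding set_first_def by (simp add: vec_eq_iff)

lemma set_first_self: "set_first (x $ first_index) x = x"
  unfolding set_first_def by (simp add: vec_eq_iff)

lemma rel_concat_set_first:
  "rel_concat u v x =
     (if x $ first_index \<le> 1 / 2 then u (set_first (2 * x $ first_index) x)
      else v (set_first (2 * x $ first_index - 1) x))"
proof -
  have "(\<chi> i. if i = first_index then 2 * x $ i else x $ i) = set_first (2 * x $ first_index) x"
    "(\<chi> i. if i = first_index then 2 * x $ i - 1 else x $ i) = set_first (2 * x $ first_index - 1) x"
    unfolding set_first_def by (auto simp: vec_eq_iff)
  then show ?thesis unfolding rel_concat_def by simp
qed

lemma coarse_concat_set_first:
  fixes z :: "(real ^ 'n::{finite,linorder}) \<times> real"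
  shows "coarse_concat F G z =
     (if fst z $ first_index \<le> snd z / 2 then F (set_first (2 * fst z $ first_index) (fst z), snd z)
      else G (set_first (2 * fst z $ first_index - snd z) (fst z), snd z))"
proof -
  have "(\<chi> i. if i = first_index then 2 * x $ i else x $ i) = set_first (2 * x $ first_index) x"
    "(\<chi> i. if i = first_index then 2 * x $ i - h else x $ i) = set_first (2 * x $ first_index - h) x"
    for x :: "real ^ 'n::{finite,linorder}" and h :: real
    unfolding set_first_def by (auto simp: vec_eq_iff)
  then show ?thesis unfolding coarse_concat_def by (simp add: split_beta)
qed

lemma set_first_cube:
  assumes "x \<in> unit_cube" "0 \<le> s" "s \<le> 1"
  shows "set_first s x \<in> unit_cube"
  using assms unfolding mem_unit_cube set_first_nth by simp

lemma set_first_frontier: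
  assumes x: "x \<in> frontier unit_cube" and s: "0 \<le> s" "s \<le> 1"
    and ends: "x $ first_index = 0 \<or> x $ first_index = 1 \<Longrightarrow> s = 0 \<or> s = 1"
  shows "set_first s x \<in> frontier unit_cube"
proof -
  obtain i where i: "x $ i = 0 \<or> x $ i = 1" and xc: "x \<in> unit_cube"
    using x unfolding mem_frontier_cube by blast
  have "set_first s x $ i = 0 \<or> set_first s x $ i = 1"
    using i ends unfolding set_first_nth by auto
  then show ?thesis unfolding mem_frontier_cube using set_first_cube[OF xc s] by blast
qed

lemma first_neq_last:
  assumes "CARD('n::{finite,linorder}) \<ge> 2"
  shows "(first_index :: 'n) \<noteq> last_index"
proof
  assume eq: "(first_index :: 'n) = last_index"
  have "i = first_index" for i :: 'n
    using Min_le[of UNIV i] Max_ge[of UNIV i] unfolding eq[symmetric] by (simp add: order_antisym)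
  then have "(UNIV :: 'n set) = {first_index}" by blast
  then have "CARD('n) = 1" by (metis card_1_singleton_iff One_nat_def)
  then show False using assms by simp
qed

lemma set_first_boundary_plus:
  fixes x :: "real ^ 'n::{finite,linorder}"
  assumes n: "CARD('n) \<ge> 2" and x: "x \<in> boundary_plus" and s: "0 \<le> s" "s \<le> 1"
    and ends: "x $ first_index = 0 \<or> x $ first_index = 1 \<Longrightarrow> s = 0 \<or> s = 1"
  shows "set_first s x \<in> boundary_plus"
  using set_first_frontier[OF subsetD[OF boundary_plus_subset x] s ends] x first_neq_last[OF n]
  unfolding boundary_plus_def mem_Collect_eq set_first_nth by simp

lemma continuous_on_set_first:
  assumes "continuous_on S f" "continuous_on S g"
  shows "continuous_on S (\<lambda>p. set_first (f p) (g p))"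
  unfolding set_first_def
proof (rule continuous_on_vec_lambda)
  show "continuous_on S (\<lambda>p. if i = first_index then f p else g p $ i)" for i
    using assms by (cases "i = first_index") (auto intro: continuous_on_component)
qed

text \<open>The faces \<open>x\<^sub>1 = 0\<close> and \<open>x\<^sub>1 = 1\<close> lie in the closure of \<open>boundary_plus\<close>: move the last
  coordinate away from \<open>0\<close>.\<close>

lemma rel_maps_first_face:
  fixes w :: "real ^ 'n::{finite,linorder} \<Rightarrow> 'b::euclidean_space"
  assumes n: "CARD('n) \<ge> 2" and w: "w \<in> rel_maps X X0 x0"
    and x: "x \<in> unit_cube" "x $ first_index = 0 \<or> x $ first_index = 1"
  shows "w x = x0"
proof -
  define y where "y s = (\<chi> i. if i = last_index then s else x $ i)" for s
  have yc: "y s \<in> unit_cube" if "s \<in> {0..1}" for s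
    using x that unfolding y_def mem_unit_cube by simp
  have ybp: "y s \<in> boundary_plus" if s: "s \<in> {0<..1}" for s
  proof -
    have "y s $ first_index = 0 \<or> y s $ first_index = 1"
      using x(2) first_neq_last[OF n] unfolding y_def by simp
    then have "y s \<in> frontier unit_cube" using yc[of s] s unfolding mem_frontier_cube by auto
    then show ?thesis using s unfolding boundary_plus_def by (simp add: y_def)
  qed
  have "continuous_on {0..1} (\<lambda>s. w (y s))"
  proof (rule continuous_on_compose2[OF rel_mapsD(1)[OF w]])
    have "continuous_on {0..1} (\<lambda>s. if i = last_index then s else x $ i)" for i
      by (cases "i = last_index") (auto intro: continuous_intros)
    then show "continuous_on {0..1} y" unfolding y_def by (rule continuous_on_vec_lambda)
  qed (use yc in blast)
  moreover have "closure {0<..1::real} = {0..1}" by simp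
  ultimately have "w (y (x $ last_index)) = x0"
    using continuous_constant_on_closure[of "{0<..1::real}" "\<lambda>s. w (y s)" x0 "x $ last_index"]
      rel_mapsD(4)[OF w ybp] x(1) by (auto simp: mem_unit_cube)
  moreover have "y (x $ last_index) = x" unfolding y_def by (simp add: vec_eq_iff)
  ultimately show ?thesis by simp
qed

definition reparam :: "(real \<Rightarrow> real) \<Rightarrow> (real ^ 'n::{finite,linorder} \<Rightarrow> 'b) \<Rightarrow> real ^ 'n::{finite,linorder} \<Rightarrow> 'b" where
  "reparam \<phi> u x = u (set_first (\<phi> (x $ first_index)) x)"

text \<open>All the homotopies needed for the group axioms are reparametrizations of the first coordinate
  which are joined by a straight line. The parameter need not be monotone: for inverses it runs back
  and forth.\<close>

lemma reparam_homotopic: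
  fixes u :: "real ^ 'n::{finite,linorder} \<Rightarrow> 'b::euclidean_space"
  assumes n: "CARD('n) \<ge> 2" and u: "u \<in> rel_maps X X0 x0"
    and \<phi>: "continuous_on {0..1} \<phi>" "\<And>s. s \<in> {0..1} \<Longrightarrow> \<phi> s \<in> {0..1}" "\<phi> 0 \<in> {0, 1}" "\<phi> 1 \<in> {0, 1}"
    and \<psi>: "continuous_on {0..1} \<psi>" "\<And>s. s \<in> {0..1} \<Longrightarrow> \<psi> s \<in> {0..1}" "\<psi> 0 = \<phi> 0" "\<psi> 1 = \<phi> 1"
  shows "(reparam \<phi> u, reparam \<psi> u) \<in> rel_homotopy X X0 x0"
proof (rule rel_homotopyI)
  define f where "f t s = (1 - t) * \<phi> s + t * \<psi> s" for t s
  have f01: "0 \<le> f t s" "f t s \<le> 1" if "t \<in> {0..1}" "s \<in> {0..1}" for t s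
    using \<phi>(2)[OF that(2)] \<psi>(2)[OF that(2)] that(1) convex_bound_le[of "\<phi> s" 1 "\<psi> s" "1 - t" t]
    unfolding f_def by auto
  have f_ends: "f t s = 0 \<or> f t s = 1" if "s = 0 \<or> s = 1" for t s
    using that \<phi>(3,4) \<psi>(3,4) unfolding f_def by (auto simp: algebra_simps)
  let ?k = "\<lambda>p. u (set_first (f (fst p) (snd p $ first_index)) (snd p))"
  have x1: "x $ first_index \<in> {0..1}" if "x \<in> unit_cube" for x :: "real ^ 'n::{finite,linorder}"
    using that unfolding mem_unit_cube by simp
  show "continuous_on ({0..1} \<times> unit_cube) ?k"
  proof (rule continuous_on_compose2[OF rel_mapsD(1)[OF u]])
    have c: "continuous_on ({0..1} \<times> unit_cube) (\<lambda>p::real \<times> (real ^ 'n::{finite,linorder}). snd p $ first_index)"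
      by (intro continuous_intros)
    have comp: "continuous_on ({0..1} \<times> unit_cube) (\<lambda>p::real \<times> (real ^ 'n::{finite,linorder}). \<phi> (snd p $ first_index))"
      "continuous_on ({0..1} \<times> unit_cube) (\<lambda>p::real \<times> (real ^ 'n::{finite,linorder}). \<psi> (snd p $ first_index))"
      by (rule continuous_on_compose2[OF \<phi>(1) c], use x1 in force)
        (rule continuous_on_compose2[OF \<psi>(1) c], use x1 in force)
    have fst_c: "continuous_on ({0..1} \<times> unit_cube) (\<lambda>p::real \<times> (real ^ 'n::{finite,linorder}). fst p)"
      "continuous_on ({0..1} \<times> unit_cube) (\<lambda>p::real \<times> (real ^ 'n::{finite,linorder}). snd p)"
      by (intro continuous_intros)+
    show "continuous_on ({0..1} \<times> unit_cube)
        (\<lambda>p::real \<times> (real ^ 'n::{finite,linorder}). set_first (f (fst p) (snd p $ first_index)) (snd p))"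
      unfolding f_def
      by (intro continuous_on_set_first continuous_on_add continuous_on_mult continuous_on_diff
          continuous_on_const comp fst_c)
    show "(\<lambda>p::real \<times> (real ^ 'n::{finite,linorder}). set_first (f (fst p) (snd p $ first_index)) (snd p)) ` ({0..1} \<times> unit_cube) \<subseteq> unit_cube"
      using set_first_cube f01 x1 by fastforce
  qed
  show "?k (t, x) \<in> X" if "t \<in> {0..1}" "x \<in> unit_cube" for t x
    using rel_mapsD(2)[OF u set_first_cube[OF that(2) f01[OF that(1) x1[OF that(2)]]]] by simp
  show "?k (t, x) \<in> X0" if t: "t \<in> {0..1}" and x: "x \<in> frontier unit_cube" for t x
  proof -
    have "set_first (f t (x $ first_index)) x \<in> frontier unit_cube"
      by (rule set_first_frontier[OF x f01[OF t x1[OF subsetD[OF frontier_cube_subset x]]] f_ends])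
    then show ?thesis using rel_mapsD(3)[OF u] by simp
  qed
  show "?k (t, x) = x0" if t: "t \<in> {0..1}" and x: "x \<in> boundary_plus" for t x
  proof -
    have xc: "x \<in> unit_cube" using subsetD[OF frontier_cube_subset subsetD[OF boundary_plus_subset x]] .
    have "set_first (f t (x $ first_index)) x \<in> boundary_plus"
      by (rule set_first_boundary_plus[OF n x f01[OF t x1[OF xc]] f_ends])
    then show ?thesis using rel_mapsD(4)[OF u] by simp
  qed
  show "?k (0, x) = reparam \<phi> u x" "?k (1, x) = reparam \<psi> u x" for x
    unfolding reparam_def f_def by simp_all
qed

lemma rel_homotopy_slice:
  fixes k :: "real \<times> (real ^ 'n::{finite,linorder}) \<Rightarrow> 'b::euclidean_space"
  assumes k: "continuous_on ({0..1} \<times> unit_cube) k"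
    "\<forall>t\<in>{0..1}. \<forall>x\<in>unit_cube. k (t, x) \<in> X"
    "\<forall>t\<in>{0..1}. \<forall>x\<in>frontier unit_cube. k (t, x) \<in> X0"
    "\<forall>t\<in>{0..1}. \<forall>x\<in>boundary_plus. k (t, x) = x0"
    and t: "t \<in> {0..1}"
  shows "(\<lambda>x. k (t, x)) \<in> rel_maps X X0 x0"
proof -
  have "continuous_on unit_cube (\<lambda>x. k (t, x))"
    by (rule continuous_on_compose2[OF k(1)]) (use t in \<open>auto intro!: continuous_intros\<close>)
  then show ?thesis unfolding rel_maps_iff using k(2-4) t by simp
qed

text \<open>Continuity of a concatenation is seen from the formula \<open>k + l - x0\<close>, in which \<open>k\<close> stops at the
  face where the first coordinate is \<open>1\<close> and \<open>l\<close> waits at the face where it is \<open>0\<close>; on both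
  faces the value is \<open>x0\<close>.\<close>

lemma rel_concat_homotopic:
  fixes u v :: "real ^ 'n::{finite,linorder} \<Rightarrow> 'b::euclidean_space"
  assumes n: "CARD('n) \<ge> 2"
    and uu: "(u, u') \<in> rel_homotopy X X0 x0" and vv: "(v, v') \<in> rel_homotopy X X0 x0"
  shows "(rel_concat u v, rel_concat u' v') \<in> rel_homotopy X X0 x0"
proof -
  obtain k where k: "continuous_on ({0..1::real} \<times> unit_cube) k"
    "\<forall>t\<in>{0..1}. \<forall>x\<in>unit_cube. k (t, x) \<in> X"
    "\<forall>t\<in>{0..1}. \<forall>x\<in>frontier unit_cube. k (t, x) \<in> X0"
    "\<forall>t\<in>{0..1}. \<forall>x\<in>boundary_plus. k (t, x) = x0"
    "\<forall>x\<in>unit_cube. k (0, x) = u x \<and> k (1, x) = u' x"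
    using uu by (rule rel_homotopyE)
  obtain l where l: "continuous_on ({0..1::real} \<times> unit_cube) l"
    "\<forall>t\<in>{0..1}. \<forall>x\<in>unit_cube. l (t, x) \<in> X"
    "\<forall>t\<in>{0..1}. \<forall>x\<in>frontier unit_cube. l (t, x) \<in> X0"
    "\<forall>t\<in>{0..1}. \<forall>x\<in>boundary_plus. l (t, x) = x0"
    "\<forall>x\<in>unit_cube. l (0, x) = v x \<and> l (1, x) = v' x"
    using vv by (rule rel_homotopyE)
  define K where "K p = rel_concat (\<lambda>y. k (fst p, y)) (\<lambda>y. l (fst p, y)) (snd p)" for p
  have K: "K (t, x) = (if x $ first_index \<le> 1 / 2 then k (t, set_first (2 * x $ first_index) x)
      else l (t, set_first (2 * x $ first_index - 1) x))" for t x
    unfolding K_def rel_concat_set_first by simp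
  have x1: "0 \<le> x $ first_index" "x $ first_index \<le> 1" if "x \<in> unit_cube" for x :: "real ^ 'n::{finite,linorder}"
    using that unfolding mem_unit_cube by auto
  let ?a = "\<lambda>x::real ^ 'n::{finite,linorder}. min 1 (2 * x $ first_index)"
  let ?b = "\<lambda>x::real ^ 'n::{finite,linorder}. max 0 (2 * x $ first_index - 1)"
  have ab: "set_first (?a x) x \<in> unit_cube" "set_first (?b x) x \<in> unit_cube"
    if x: "x \<in> unit_cube" for x
    by (rule set_first_cube[OF x]; use x1[OF x] in simp)+
  have K_sum: "k (t, set_first (?a x) x) + l (t, set_first (?b x) x) - x0 = K (t, x)"
    if t: "t \<in> {0..1}" and x: "x \<in> unit_cube" for t x
  proof -
    have f: "k (t, set_first 1 x) = x0" "l (t, set_first 0 x) = x0"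
      using rel_maps_first_face[OF n rel_homotopy_slice[OF k(1-4) t], of "set_first 1 x"]
        rel_maps_first_face[OF n rel_homotopy_slice[OF l(1-4) t], of "set_first 0 x"]
        set_first_cube[OF x] by (simp_all add: set_first_nth)
    consider "x $ first_index < 1 / 2" | "x $ first_index = 1 / 2" | "1 / 2 < x $ first_index" by linarith
    then show ?thesis
    proof cases
      case 2
      then have e: "2 * x $ first_index = 1" by simp
      show ?thesis using f 2 unfolding K e by simp
    qed (simp_all add: K min_def max_def f)
  qed
  show ?thesis
  proof (rule rel_homotopyI)
    have "continuous_on ({0..1} \<times> unit_cube)
        (\<lambda>p. k (fst p, set_first (?a (snd p)) (snd p)) + l (fst p, set_first (?b (snd p)) (snd p)) - x0)"
    proof (intro continuous_on_diff continuous_on_add continuous_on_const)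
      have c: "continuous_on ({0..1} \<times> unit_cube) (\<lambda>p::real \<times> (real ^ 'n::{finite,linorder}). snd p $ first_index)"
        by (intro continuous_intros)
      show "continuous_on ({0..1} \<times> unit_cube) (\<lambda>p. k (fst p, set_first (?a (snd p)) (snd p)))"
        by (rule continuous_on_compose2[OF k(1)])
          (use ab c in \<open>auto intro!: continuous_intros continuous_on_set_first\<close>)
      show "continuous_on ({0..1} \<times> unit_cube) (\<lambda>p. l (fst p, set_first (?b (snd p)) (snd p)))"
        by (rule continuous_on_compose2[OF l(1)])
          (use ab c in \<open>auto intro!: continuous_intros continuous_on_set_first\<close>)
    qed
    then show "continuous_on ({0..1} \<times> unit_cube) K"
      by (rule continuous_on_eq) (use K_sum in auto)
    show "K (t, x) \<in> X" if "t \<in> {0..1}" "x \<in> unit_cube" for t x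
      using k(2) l(2) that set_first_cube[OF that(2)] x1[OF that(2)] unfolding K by auto
    show "K (t, x) \<in> X0" if t: "t \<in> {0..1}" and x: "x \<in> frontier unit_cube" for t x
      using k(3) l(3) t set_first_frontier[OF x] x1[OF subsetD[OF frontier_cube_subset x]] unfolding K by auto
    show "K (t, x) = x0" if t: "t \<in> {0..1}" and x: "x \<in> boundary_plus" for t x
      using k(4) l(4) t set_first_boundary_plus[OF n x]
        x1[OF subsetD[OF frontier_cube_subset subsetD[OF boundary_plus_subset x]]] unfolding K by auto
    show "K (0, x) = rel_concat u v x" if x: "x \<in> unit_cube" for x
      using k(5) l(5) set_first_cube[OF x] x1[OF x] unfolding K rel_concat_set_first by auto
    show "K (1, x) = rel_concat u' v' x" if x: "x \<in> unit_cube" for x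
      using k(5) l(5) set_first_cube[OF x] x1[OF x] unfolding K rel_concat_set_first by auto
  qed
qed

section \<open>The relative homotopy group\<close>

lemma quotient_operation:
  assumes R: "equiv A R" and a: "a \<in> A" "b \<in> A"
    and cong: "\<And>a a' b b'. (a, a') \<in> R \<Longrightarrow> (b, b') \<in> R \<Longrightarrow> (f a b, f a' b') \<in> R"
  shows "(\<Union>a'\<in>R `` {a}. \<Union>b'\<in>R `` {b}. R `` {f a' b'}) = R `` {f a b}"
proof -
  have "R `` {f a' b'} = R `` {f a b}" if "a' \<in> R `` {a}" "b' \<in> R `` {b}" for a' b'
    using equiv_class_eq[OF R cong] that by blast
  moreover have "a \<in> R `` {a}" "b \<in> R `` {b}" using equiv_class_self[OF R] a by blast+
  ultimately show ?thesis by blast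
qed

lemma rel_const: "x0 \<in> X \<Longrightarrow> x0 \<in> X0 \<Longrightarrow> (\<lambda>x. x0) \<in> rel_maps X X0 x0"
  unfolding rel_maps_iff by simp

lemma rel_homotopy_refl: "u \<in> rel_maps X X0 x0 \<Longrightarrow> (u, u) \<in> rel_homotopy X X0 x0"
  by (rule rel_homotopy_cong) simp_all

text \<open>Each axiom compares two reparametrizations of one and the same map. The constant map is the
  reparametrization by a constant, because \<open>u\<close> is \<open>x0\<close> on the face where the first coordinate is
  \<open>1\<close>; and \<open>u'\<close> followed by \<open>u\<close> is the reparametrization by \<open>\<bar>2 s - 1\<bar>\<close>, which begins and ends at
  \<open>1\<close>.\<close>

lemma rel_homotopy_group_group:
  fixes X X0 :: "'b::euclidean_space set"
  assumes n: "CARD('n::{finite,linorder}) \<ge> 2" and x0: "x0 \<in> X" "x0 \<in> X0"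
  shows "group (rel_homotopy_group X X0 x0 :: (real ^ 'n::{finite,linorder} \<Rightarrow> 'b) set monoid)"
proof -
  let ?M = "rel_maps X X0 x0 :: (real ^ 'n::{finite,linorder} \<Rightarrow> 'b) set"
  let ?R = "rel_homotopy X X0 x0 :: ((real ^ 'n::{finite,linorder} \<Rightarrow> 'b) \<times> (real ^ 'n::{finite,linorder} \<Rightarrow> 'b)) set"
  let ?G = "rel_homotopy_group X X0 x0 :: (real ^ 'n::{finite,linorder} \<Rightarrow> 'b) set monoid"
  note R = equiv_rel_homotopy[of X X0 x0, where ?'a = 'n]
  have mult: "mult ?G (?R `` {u}) (?R `` {v}) = ?R `` {rel_concat u v}" if "u \<in> ?M" "v \<in> ?M" for u v
    unfolding rel_homotopy_group_def monoid.simps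
    by (rule quotient_operation[OF R that]) (rule rel_concat_homotopic[OF n])
  have concat_in: "rel_concat u v \<in> ?M" if "u \<in> ?M" "v \<in> ?M" for u v
    using rel_homotopy_maps[OF rel_concat_homotopic[OF n rel_homotopy_refl[OF that(1)] rel_homotopy_refl[OF that(2)]]]
    by blast
  have carrier: "carrier ?G = ?M // ?R" and one: "one ?G = ?R `` {\<lambda>x. x0}"
    unfolding rel_homotopy_group_def by simp_all
  have const: "(\<lambda>x. x0) \<in> ?M" by (rule rel_const[OF x0])
  have class_eqI: "?R `` {u} = ?R `` {v}" if "(u, v) \<in> ?R" for u v by (rule equiv_class_eq[OF R that])
  have via: "?R `` {u} = ?R `` {v}" if "u \<in> ?M" "\<And>x. x \<in> unit_cube \<Longrightarrow> u x = w x" "(w, v) \<in> ?R" for u v w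
    using class_eqI[OF rel_homotopy_cong[OF that(1,2)]] class_eqI[OF that(3)] by simp
  have x1: "0 \<le> x $ first_index" "x $ first_index \<le> 1" if "x \<in> unit_cube" for x :: "real ^ 'n::{finite,linorder}"
    using that unfolding mem_unit_cube by auto
  have reparam_id: "reparam (\<lambda>s. s) u = u" for u :: "real ^ 'n::{finite,linorder} \<Rightarrow> 'b"
    by (rule ext) (simp add: reparam_def set_first_self)
  show ?thesis
  proof (rule groupI)
    fix U V assume UV: "U \<in> carrier ?G" "V \<in> carrier ?G"
    obtain u v where u: "U = ?R `` {u}" "u \<in> ?M" and v: "V = ?R `` {v}" "v \<in> ?M"
      using UV unfolding carrier by (elim quotientE) metis
    show "U \<otimes>\<^bsub>?G\<^esub> V \<in> carrier ?G"
      unfolding u v mult[OF u(2) v(2)] unfolding carrier by (rule quotientI[OF concat_in[OF u(2) v(2)]])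
    fix W assume "W \<in> carrier ?G"
    then obtain w where w: "W = ?R `` {w}" "w \<in> ?M" unfolding carrier by (elim quotientE) metis
    \<comment> \<open>stretches the first quarter to a half, shifts the second one, compresses the last half\<close>
    define \<phi> where "\<phi> s = min (2 * s) (min (s + 1 / 4) ((s + 1) / 2))" for s :: real
    have "?R `` {rel_concat (rel_concat u v) w} = ?R `` {rel_concat u (rel_concat v w)}"
    proof (rule via[of _ "reparam \<phi> (rel_concat u (rel_concat v w))"])
      show "rel_concat (rel_concat u v) w \<in> ?M" by (intro concat_in u v w)
      show "rel_concat (rel_concat u v) w x = reparam \<phi> (rel_concat u (rel_concat v w)) x" if "x \<in> unit_cube" for x
      proof -
        define s where "s = x $ first_index"
        have f: "set_first r x $ first_index = r" for r by (simp add: set_first_nth)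
        consider "s \<le> 1 / 4" | "1 / 4 < s" "s \<le> 1 / 2" | "1 / 2 < s" by linarith
        then show ?thesis
        proof cases
          case 1
          then have "\<phi> s = 2 * s" unfolding \<phi>_def by simp
          then show ?thesis using 1
            unfolding reparam_def rel_concat_set_first set_first_set_first f s_def[symmetric] by simp
        next
          case 2
          then have p: "\<phi> s = s + 1 / 4" unfolding \<phi>_def by simp
          have e: "2 * (2 * s) - 1 = 2 * (2 * (s + 1 / 4) - 1)" by simp
          show ?thesis using 2 e
            unfolding reparam_def rel_concat_set_first set_first_set_first f s_def[symmetric] p by simp
        next
          case 3
          then have p: "\<phi> s = (s + 1) / 2" unfolding \<phi>_def by simp
          have e: "2 * (2 * ((s + 1) / 2) - 1) - 1 = 2 * s - 1" by (simp add: field_simps)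
          have c: "\<not> s \<le> 1 / 2" "\<not> (s + 1) / 2 \<le> 1 / 2" "\<not> 2 * ((s + 1) / 2) - 1 \<le> 1 / 2"
            using 3 by (simp_all add: field_simps)
          show ?thesis
            unfolding reparam_def rel_concat_set_first set_first_set_first f s_def[symmetric] p
            by (simp only: c e if_False)
        qed
      qed
      have "(reparam \<phi> (rel_concat u (rel_concat v w)), reparam (\<lambda>s. s) (rel_concat u (rel_concat v w))) \<in> ?R"
      proof (rule reparam_homotopic[OF n])
        show "continuous_on {0..1} \<phi>" unfolding \<phi>_def by (intro continuous_intros) auto
      qed (auto simp: \<phi>_def min_def intro!: concat_in u v w continuous_intros)
      then show "(reparam \<phi> (rel_concat u (rel_concat v w)), rel_concat u (rel_concat v w)) \<in> ?R"
        unfolding reparam_id .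
    qed
    then show "U \<otimes>\<^bsub>?G\<^esub> V \<otimes>\<^bsub>?G\<^esub> W = U \<otimes>\<^bsub>?G\<^esub> (V \<otimes>\<^bsub>?G\<^esub> W)"
      unfolding u v w mult[OF u(2) v(2)] mult[OF v(2) w(2)] mult[OF concat_in[OF u(2) v(2)] w(2)]
        mult[OF u(2) concat_in[OF v(2) w(2)]] .
  next
    show "\<one>\<^bsub>?G\<^esub> \<in> carrier ?G" unfolding one carrier by (rule quotientI[OF const])
  next
    fix U assume "U \<in> carrier ?G"
    then obtain u where u: "U = ?R `` {u}" "u \<in> ?M" unfolding carrier by (elim quotientE) metis
    have "?R `` {rel_concat (\<lambda>x. x0) u} = ?R `` {u}"
    proof (rule via[of _ "reparam (\<lambda>s. max 0 (2 * s - 1)) u"])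
      show "rel_concat (\<lambda>x. x0) u \<in> ?M" by (intro concat_in const u)
      show "rel_concat (\<lambda>x. x0) u x = reparam (\<lambda>s. max 0 (2 * s - 1)) u x" if x: "x \<in> unit_cube" for x
      proof -
        have "max 0 (2 * x $ first_index - 1) = (if x $ first_index \<le> 1 / 2 then 0 else 2 * x $ first_index - 1)"
          by simp
        then show ?thesis
          using rel_maps_first_face[OF n u(2) set_first_cube[OF x, of 0]]
          by (simp add: rel_concat_set_first reparam_def set_first_nth)
      qed
      have "(reparam (\<lambda>s. max 0 (2 * s - 1)) u, reparam (\<lambda>s. s) u) \<in> ?R"
        by (rule reparam_homotopic[OF n u(2)]) (auto intro!: continuous_intros)
      then show "(reparam (\<lambda>s. max 0 (2 * s - 1)) u, u) \<in> ?R" unfolding reparam_id .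
    qed
    then show "\<one>\<^bsub>?G\<^esub> \<otimes>\<^bsub>?G\<^esub> U = U" unfolding one u mult[OF const u(2)] .
    define u' where "u' = reparam (\<lambda>s. 1 - s) u"
    have "(u', u') \<in> ?R" unfolding u'_def
      by (rule reparam_homotopic[OF n u(2)]) (auto intro!: continuous_intros)
    then have u': "u' \<in> ?M" using rel_homotopy_maps by blast
    have "?R `` {rel_concat u' u} = ?R `` {\<lambda>x. x0}"
    proof (rule via[of _ "reparam (\<lambda>s. \<bar>2 * s - 1\<bar>) u"])
      show "rel_concat u' u \<in> ?M" by (intro concat_in u' u)
      show "rel_concat u' u x = reparam (\<lambda>s. \<bar>2 * s - 1\<bar>) u x" for x
        by (cases "x $ first_index \<le> 1 / 2")
          (simp_all add: rel_concat_set_first reparam_def u'_def set_first_nth set_first_set_first)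
      have h: "(reparam (\<lambda>s. \<bar>2 * s - 1\<bar>) u, reparam (\<lambda>s. 1) u) \<in> ?R"
        by (rule reparam_homotopic[OF n u(2)]) (auto intro!: continuous_intros)
      have c: "reparam (\<lambda>s. 1) u x = x0" if x: "x \<in> unit_cube" for x
        using rel_maps_first_face[OF n u(2) set_first_cube[OF x, of 1]]
        by (simp add: reparam_def set_first_nth)
      have "(reparam (\<lambda>s. 1) u, \<lambda>x. x0) \<in> ?R"
        by (rule rel_homotopy_cong) (use rel_homotopy_maps[OF h] c in auto)
      with h show "(reparam (\<lambda>s. \<bar>2 * s - 1\<bar>) u, \<lambda>x. x0) \<in> ?R"
        using R unfolding equiv_def trans_def by blast
    qed
    then have "?R `` {u'} \<otimes>\<^bsub>?G\<^esub> U = \<one>\<^bsub>?G\<^esub>" unfolding one u mult[OF u' u(2)] .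
    moreover have "?R `` {u'} \<in> carrier ?G" unfolding carrier by (rule quotientI[OF u'])
    ultimately show "\<exists>V\<in>carrier ?G. V \<otimes>\<^bsub>?G\<^esub> U = \<one>\<^bsub>?G\<^esub>" by blast
  qed
qed

section \<open>Concatenation of coarse maps\<close>

lemma ls_lipschitz_on_nth:
  fixes f :: "'a::metric_space \<Rightarrow> real ^ 'n"
  assumes "ls_lipschitz_on A f"
  shows "ls_lipschitz_on A (\<lambda>x. f x $ i)"
  using assms unfolding ls_lipschitz_on_def by (meson dist_vec_nth_le order_trans)

lemma ls_lipschitz_on_scaleR_left:
  fixes f :: "'a::metric_space \<Rightarrow> real" and v :: "'b::real_normed_vector"
  assumes "ls_lipschitz_on A f"
  shows "ls_lipschitz_on A (\<lambda>x. f x *\<^sub>R v)"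
proof -
  obtain C where C: "C \<ge> 0" "\<And>x y. x \<in> A \<Longrightarrow> y \<in> A \<Longrightarrow> dist (f x) (f y) \<le> C * (dist x y + 1)"
    using assms by (elim ls_lipschitz_onE) blast
  show ?thesis
  proof (rule ls_lipschitz_onI[of _ _ "C * norm v"])
    fix x y assume "x \<in> A" "y \<in> A"
    then have "dist (f x) (f y) * norm v \<le> C * (dist x y + 1) * norm v"
      using C(2) by (intro mult_right_mono) auto
    then show "dist (f x *\<^sub>R v) (f y *\<^sub>R v) \<le> C * norm v * (dist x y + 1)"
      by (simp add: dist_norm algebra_simps flip: scaleR_diff_left)
  qed
qed

definition cone_first :: "((real ^ 'n::{finite,linorder}) \<times> real \<Rightarrow> real) \<Rightarrow>
    (real ^ 'n::{finite,linorder}) \<times> real \<Rightarrow> (real ^ 'n::{finite,linorder}) \<times> real" where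
  "cone_first f z = (set_first (f z) (fst z), snd z)"

text \<open>The two halves of the first coordinate, each stretched to full length and then clamped, so that
  both are defined and Lipschitz on the whole cone.\<close>

abbreviation left_half :: "(real ^ 'n::{finite,linorder}) \<times> real \<Rightarrow> real" where
  "left_half \<equiv> \<lambda>z. min (2 * fst z $ first_index) (snd z)"

abbreviation right_half :: "(real ^ 'n::{finite,linorder}) \<times> real \<Rightarrow> real" where
  "right_half \<equiv> \<lambda>z. max (2 * fst z $ first_index - snd z) 0"

lemma coarse_concat_cone_first:
  "coarse_concat F G z =
     (if fst z $ first_index \<le> snd z / 2 then F (cone_first left_half z) else G (cone_first right_half z))"
  unfolding coarse_concat_set_first cone_first_def by (auto simp: min_def max_def)

lemma cone_first_in_cone:
  assumes "z \<in> cube_cone" "0 \<le> f z" "f z \<le> snd z"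
  shows "cone_first f z \<in> cube_cone"
  using assms unfolding mem_cube_cone cone_first_def by (simp add: set_first_nth)

lemma half_range:
  assumes "z \<in> cube_cone"
  shows "0 \<le> left_half z" "left_half z \<le> snd z" "0 \<le> right_half z" "right_half z \<le> snd z"
proof -
  have "0 \<le> snd z" "0 \<le> fst z $ first_index" "fst z $ first_index \<le> snd z"
    using assms unfolding mem_cube_cone by blast+
  then show "0 \<le> left_half z" "left_half z \<le> snd z" "0 \<le> right_half z" "right_half z \<le> snd z"
    by auto
qed

lemma cone_first_frontier:
  assumes z: "z \<in> metric_cone (frontier unit_cube)" and f: "0 \<le> f z" "f z \<le> snd z"
    and ends: "fst z $ first_index = 0 \<or> fst z $ first_index = snd z \<Longrightarrow> f z = 0 \<or> f z = snd z"
  shows "cone_first f z \<in> metric_cone (frontier unit_cube)"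
proof -
  obtain i where i: "fst z $ i = 0 \<or> fst z $ i = snd z" and zc: "z \<in> cube_cone"
    using z unfolding mem_cone_frontier by blast
  have "fst (cone_first f z) $ i = 0 \<or> fst (cone_first f z) $ i = snd (cone_first f z)"
    using i ends unfolding cone_first_def by (auto simp: set_first_nth)
  then show ?thesis unfolding mem_cone_frontier using cone_first_in_cone[of z f, OF zc f] by blast
qed

lemma cone_first_boundary_plus:
  fixes z :: "(real ^ 'n::{finite,linorder}) \<times> real"
  assumes n: "CARD('n) \<ge> 2" and z: "z \<in> metric_cone boundary_plus" and f: "0 \<le> f z" "f z \<le> snd z"
    and ends: "fst z $ first_index = 0 \<or> fst z $ first_index = snd z \<Longrightarrow> f z = 0 \<or> f z = snd z"
  shows "cone_first f z \<in> metric_cone boundary_plus"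
proof -
  have "snd (cone_first f z) = 0 \<or> 0 < fst (cone_first f z) $ last_index"
    using z first_neq_last[OF n] unfolding mem_cone_boundary_plus cone_first_def by (auto simp: set_first_nth)
  then show ?thesis
    unfolding mem_cone_boundary_plus
    using cone_first_frontier[of z f, OF subsetD[OF cone_boundary_plus_subset z] f ends] by blast
qed

lemma ls_lipschitz_on_cone_first:
  fixes f :: "(real ^ 'n::{finite,linorder}) \<times> real \<Rightarrow> real"
  assumes f: "ls_lipschitz_on cube_cone f"
  shows "ls_lipschitz_on cube_cone (cone_first f)"
proof -
  have "ls_lipschitz_on cube_cone (\<lambda>z. (set_first (f z) (fst z), snd z))"
    unfolding set_first_def
  proof (intro ls_lipschitz_on_Pair ls_lipschitz_on_vec ls_lipschitz_on_snd ls_lipschitz_on_id)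
    have "ls_lipschitz_on cube_cone (\<lambda>z::(real ^ 'n::{finite,linorder}) \<times> real. fst z $ i)" for i
      by (intro ls_lipschitz_on_nth ls_lipschitz_on_fst ls_lipschitz_on_id)
    then show "ls_lipschitz_on cube_cone (\<lambda>z. if i = first_index then f z else fst z $ i)" for i
      using f by (cases "i = first_index") simp_all
  qed
  then show ?thesis unfolding cone_first_def[abs_def] .
qed

lemma ls_lipschitz_on_halves:
  "ls_lipschitz_on cube_cone left_half" "ls_lipschitz_on cube_cone right_half"
  by (intro ls_lipschitz_on_min ls_lipschitz_on_max ls_lipschitz_on_mult ls_lipschitz_on_diff
      ls_lipschitz_on_nth ls_lipschitz_on_fst ls_lipschitz_on_snd ls_lipschitz_on_id ls_lipschitz_on_const)+

context pointed_pair
begin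

text \<open>A coarse map need not be equal to the ray on the whole faces \<open>x\<^sub>1 = 0\<close> and \<open>x\<^sub>1 = h\<close>, since
  these contain points with \<open>x\<^sub>n = 0\<close>. But such points are at distance at most one from
  \<open>boundary_plus\<close>, so it is close to the ray.\<close>

lemma long_homotopy_first_face:
  fixes F :: "(real ^ 'n::{finite,linorder}) \<times> real \<Rightarrow> 'b \<times> real"
  assumes n: "CARD('n) \<ge> 2" and H: "long_homotopy K F G H"
  obtains C where "\<And>z t. z \<in> cube_cone \<Longrightarrow> 0 \<le> t \<Longrightarrow>
    fst z $ first_index = 0 \<or> fst z $ first_index = snd z \<Longrightarrow> dist (H (z, t)) (snd z *\<^sub>R x0, snd z) \<le> C"
proof -
  note D = long_homotopyD[OF H]
  obtain C where C: "C \<ge> 0" "\<And>p p'. p \<in> cone_cylinder \<Longrightarrow> p' \<in> cone_cylinder \<Longrightarrow>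
      dist (H p) (H p') \<le> C * (dist p p' + 1)"
    using D(2) by (elim ls_lipschitz_onE) blast
  have "dist (H (z, t)) (snd z *\<^sub>R x0, snd z) \<le> C * 2"
    if z: "z \<in> cube_cone" and t: "0 \<le> t" and face: "fst z $ first_index = 0 \<or> fst z $ first_index = snd z" for z t
  proof -
    have zi: "0 \<le> snd z" "\<And>i. 0 \<le> fst z $ i" "\<And>i. fst z $ i \<le> snd z" using z unfolding mem_cube_cone by blast+
    define l where "l = max (fst z $ last_index) (min 1 (snd z))"
    define x where "x = (\<chi> i. if i = last_index then l else fst z $ i)"
    have l: "0 \<le> l" "l \<le> snd z" "\<bar>fst z $ last_index - l\<bar> \<le> 1"
      using zi(1) zi(2)[of last_index] zi(3)[of last_index] unfolding l_def by auto
    have xc: "(x, snd z) \<in> cube_cone" unfolding mem_cube_cone x_def using zi l by simp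
    have xf: "x $ first_index = fst z $ first_index" unfolding x_def using first_neq_last[OF n] by simp
    have "(x, snd z) \<in> metric_cone (frontier unit_cube)"
      unfolding mem_cone_frontier fst_conv snd_conv using xc face xf by metis
    moreover have "snd z = 0 \<or> 0 < x $ last_index" using zi(1) unfolding x_def l_def by auto
    ultimately have bp: "(x, snd z) \<in> metric_cone boundary_plus" unfolding mem_cone_boundary_plus by simp
    have "dist (fst z) x \<le> (\<Sum>i\<in>UNIV. \<bar>(fst z - x) $ i\<bar>)" unfolding dist_norm by (rule norm_le_l1_cart)
    also have "\<dots> = (\<Sum>i\<in>(UNIV::'n set). if i = last_index then \<bar>fst z $ last_index - l\<bar> else 0)"
      unfolding x_def by (intro sum.cong) auto
    also have "\<dots> \<le> 1" using l(3) by simp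
    finally have d: "dist (z, t) ((x, snd z), t) \<le> 1"
      by (cases z) (simp add: dist_Pair_Pair)
    have "dist (H (z, t)) (H ((x, snd z), t)) \<le> C * (dist (z, t) ((x, snd z), t) + 1)"
      using z xc t by (intro C(2)) auto
    also have "\<dots> \<le> C * 2" using d C(1) by (intro mult_left_mono) auto
    finally show ?thesis using D(5)[OF bp t] by simp
  qed
  then show thesis by (rule that)
qed

text \<open>Up to a bounded error the concatenation is the sum of the two stretched homotopies minus the
  ray, because each of them is close to the ray where the other one runs.\<close>

lemma coarse_concat_htpy:
  fixes F G :: "(real ^ 'n::{finite,linorder}) \<times> real \<Rightarrow> 'b \<times> real"
  assumes n: "CARD('n) \<ge> 2" and FF: "(F, F') \<in> coarse_htpy" and GG: "(G, G') \<in> coarse_htpy"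
  shows "(coarse_concat F G, coarse_concat F' G') \<in> coarse_htpy"
proof -
  from iffD1[OF coarse_htpy_iff FF] obtain K1 H1 where H1': "long_homotopy K1 F F' H1" by (elim exE)
  from iffD1[OF coarse_htpy_iff GG] obtain K2 H2 where H2': "long_homotopy K2 G G' H2" by (elim exE)
  define K where "K = max K1 K2"
  have H1: "long_homotopy K F F' H1" by (rule long_homotopy_mono[OF H1']) (simp add: K_def)
  have H2: "long_homotopy K G G' H2" by (rule long_homotopy_mono[OF H2']) (simp add: K_def)
  note D1 = long_homotopyD[OF H1] and D2 = long_homotopyD[OF H2]
  obtain C1 where C1: "\<And>z t. z \<in> cube_cone \<Longrightarrow> 0 \<le> t \<Longrightarrow>
    fst z $ first_index = 0 \<or> fst z $ first_index = snd z \<Longrightarrow> dist (H1 (z, t)) (snd z *\<^sub>R x0, snd z) \<le> C1"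
    by (rule long_homotopy_first_face[OF n H1]) (rule that)
  obtain C2 where C2: "\<And>z t. z \<in> cube_cone \<Longrightarrow> 0 \<le> t \<Longrightarrow>
    fst z $ first_index = 0 \<or> fst z $ first_index = snd z \<Longrightarrow> dist (H2 (z, t)) (snd z *\<^sub>R x0, snd z) \<le> C2"
    by (rule long_homotopy_first_face[OF n H2]) (rule that)
  let ?l = "cone_first left_half :: (real ^ 'n::{finite,linorder}) \<times> real \<Rightarrow> _"
  let ?r = "cone_first right_half :: (real ^ 'n::{finite,linorder}) \<times> real \<Rightarrow> _"
  have l_in: "?l z \<in> cube_cone" and r_in: "?r z \<in> cube_cone" if "z \<in> cube_cone" for z
    by (rule cone_first_in_cone[of z left_half, OF that half_range(1,2)[OF that]])
      (rule cone_first_in_cone[of z right_half, OF that half_range(3,4)[OF that]])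
  have snd_eq: "snd (cone_first f z) = snd z" for f and z :: "(real ^ 'n::{finite,linorder}) \<times> real"
    unfolding cone_first_def by simp
  have l_end: "left_half z = 0 \<or> left_half z = snd z"
    if "fst z $ first_index \<le> snd z / 2" "fst z $ first_index = 0 \<or> fst z $ first_index = snd z"
      "0 \<le> snd z" for z :: "(real ^ 'n::{finite,linorder}) \<times> real"
    using that by auto
  have r_end: "right_half z = 0 \<or> right_half z = snd z"
    if "\<not> fst z $ first_index \<le> snd z / 2" "fst z $ first_index = 0 \<or> fst z $ first_index = snd z"
      "0 \<le> snd z" for z :: "(real ^ 'n::{finite,linorder}) \<times> real"
    using that by auto
  define H where "H p = coarse_concat (\<lambda>z. H1 (z, snd p)) (\<lambda>z. H2 (z, snd p)) (fst p)" for p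
  have H: "H (z, t) = (if fst z $ first_index \<le> snd z / 2 then H1 (?l z, t) else H2 (?r z, t))" for z t
    unfolding H_def coarse_concat_cone_first by simp
  define P where "P p = H1 (?l (fst p), snd p) + H2 (?r (fst p), snd p) - (snd (fst p) *\<^sub>R x0, snd (fst p))" for p
  show ?thesis
  proof (rule coarse_htpyI)
    show "long_homotopy K (coarse_concat F G) (coarse_concat F' G') H"
      unfolding long_homotopy_def
    proof (intro conjI ballI allI impI)
      have fst_ls: "ls_lipschitz_on cone_cylinder (\<lambda>p::((real ^ 'n::{finite,linorder}) \<times> real) \<times> real. fst p)"
        by (intro ls_lipschitz_intros)
      have P_ls: "ls_lipschitz_on cone_cylinder P"
        unfolding P_def
      proof (intro ls_lipschitz_on_diff ls_lipschitz_on_add)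
        have "ls_lipschitz_on cone_cylinder (\<lambda>p. ?l (fst p))"
          by (rule ls_lipschitz_on_compose[OF fst_ls _ ls_lipschitz_on_cone_first[OF ls_lipschitz_on_halves(1)]]) auto
        then have "ls_lipschitz_on cone_cylinder (\<lambda>p. (?l (fst p), snd p))"
          by (intro ls_lipschitz_on_Pair ls_lipschitz_on_snd ls_lipschitz_on_id)
        then show "ls_lipschitz_on cone_cylinder (\<lambda>p. H1 (?l (fst p), snd p))"
          by (rule ls_lipschitz_on_compose[OF _ _ D1(2)])
            (rule image_subsetI, simp add: mem_Times_iff l_in)
        have "ls_lipschitz_on cone_cylinder (\<lambda>p. ?r (fst p))"
          by (rule ls_lipschitz_on_compose[OF fst_ls _ ls_lipschitz_on_cone_first[OF ls_lipschitz_on_halves(2)]]) auto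
        then have "ls_lipschitz_on cone_cylinder (\<lambda>p. (?r (fst p), snd p))"
          by (intro ls_lipschitz_on_Pair ls_lipschitz_on_snd ls_lipschitz_on_id)
        then show "ls_lipschitz_on cone_cylinder (\<lambda>p. H2 (?r (fst p), snd p))"
          by (rule ls_lipschitz_on_compose[OF _ _ D2(2)])
            (rule image_subsetI, simp add: mem_Times_iff r_in)
        show "ls_lipschitz_on cone_cylinder
            (\<lambda>p::((real ^ 'n::{finite,linorder}) \<times> real) \<times> real. (snd (fst p) *\<^sub>R x0, snd (fst p)))"
          by (intro ls_lipschitz_on_Pair ls_lipschitz_on_scaleR_left ls_lipschitz_on_snd fst_ls)
      qed
      show "ls_lipschitz_on cone_cylinder H"
      proof (rule ls_lipschitz_on_close[OF P_ls, of _ "max C1 C2"])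
        fix p :: "((real ^ 'n::{finite,linorder}) \<times> real) \<times> real" assume "p \<in> cone_cylinder"
        then obtain z t where p: "p = (z, t)" "z \<in> cube_cone" "0 \<le> t" by auto
        show "dist (P p) (H p) \<le> max C1 C2"
        proof (cases "fst z $ first_index \<le> snd z / 2")
          case True
          then have "fst (?r z) $ first_index = 0" unfolding cone_first_def by (simp add: set_first_nth)
          then have "dist (H2 (?r z, t)) (snd z *\<^sub>R x0, snd z) \<le> C2"
            using C2[OF r_in[OF p(2)] p(3)] unfolding snd_eq by blast
          moreover have "dist (P p) (H p) = dist (H2 (?r z, t)) (snd z *\<^sub>R x0, snd z)"
            using True unfolding P_def p fst_conv snd_conv H dist_norm by simp
          ultimately show ?thesis by simp
        next
          case False
          then have "fst (?l z) $ first_index = snd (?l z)" unfolding cone_first_def by (simp add: set_first_nth)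
          then have "dist (H1 (?l z, t)) (snd z *\<^sub>R x0, snd z) \<le> C1"
            using C1[OF l_in[OF p(2)] p(3)] unfolding snd_eq by blast
          moreover have "dist (P p) (H p) = dist (H1 (?l z, t)) (snd z *\<^sub>R x0, snd z)"
            using False unfolding P_def p fst_conv snd_conv H dist_norm by simp
          ultimately show ?thesis by simp
        qed
      qed
      show "H (z, t) \<in> metric_cone X" if "z \<in> cube_cone" "0 \<le> t" for z t
        unfolding H using D1(1)[OF l_in[OF that(1)] that(2)] D2(1)[OF r_in[OF that(1)] that(2)] by simp
      show "\<exists>N. \<forall>z\<in>cube_cone. \<forall>t\<ge>0. snd (H (z, t)) \<le> M \<longrightarrow> snd z \<le> N" for M
      proof -
        obtain N1 where N1: "\<forall>z\<in>cube_cone. \<forall>t\<ge>0. snd (H1 (z, t)) \<le> M \<longrightarrow> snd z \<le> N1" using D1(3) by metis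
        obtain N2 where N2: "\<forall>z\<in>cube_cone. \<forall>t\<ge>0. snd (H2 (z, t)) \<le> M \<longrightarrow> snd z \<le> N2" using D2(3) by metis
        have "snd z \<le> max N1 N2" if z: "z \<in> cube_cone" "0 \<le> t" "snd (H (z, t)) \<le> M" for z t
        proof (cases "fst z $ first_index \<le> snd z / 2")
          case True
          then have "snd (?l z) \<le> N1" using N1 l_in[OF z(1)] z(2,3) unfolding H by simp
          then show ?thesis unfolding snd_eq by simp
        next
          case False
          then have "snd (?r z) \<le> N2" using N2 r_in[OF z(1)] z(2,3) unfolding H by simp
          then show ?thesis unfolding snd_eq by simp
        qed
        then show ?thesis by blast
      qed
      show "H (z, t) \<in> metric_cone X0" if z: "z \<in> metric_cone (frontier unit_cube)" and t: "0 \<le> t" for z t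
      proof -
        have zc: "z \<in> cube_cone" by (rule subsetD[OF cone_frontier_subset z])
        show ?thesis
        proof (cases "fst z $ first_index \<le> snd z / 2")
          case True
          have "?l z \<in> metric_cone (frontier unit_cube)"
            by (rule cone_first_frontier[of z left_half, OF z half_range(1,2)[OF zc] l_end[OF True _ cube_coneD(1)[OF zc]]])
          then show ?thesis unfolding H using D1(4)[OF _ t] True by simp
        next
          case False
          have "?r z \<in> metric_cone (frontier unit_cube)"
            by (rule cone_first_frontier[of z right_half, OF z half_range(3,4)[OF zc] r_end[OF False _ cube_coneD(1)[OF zc]]])
          then show ?thesis unfolding H using D2(4)[OF _ t] False by simp
        qed
      qed
      show "H (z, t) = (snd z *\<^sub>R x0, snd z)" if z: "z \<in> metric_cone boundary_plus" and t: "0 \<le> t" for z t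
      proof -
        have zc: "z \<in> cube_cone" by (rule subsetD[OF cone_frontier_subset subsetD[OF cone_boundary_plus_subset z]])
        show ?thesis
        proof (cases "fst z $ first_index \<le> snd z / 2")
          case True
          have "?l z \<in> metric_cone boundary_plus"
            by (rule cone_first_boundary_plus[of z left_half, OF n z half_range(1,2)[OF zc] l_end[OF True _ cube_coneD(1)[OF zc]]])
          then show ?thesis unfolding H using D1(5)[OF _ t] True by (simp add: snd_eq)
        next
          case False
          have "?r z \<in> metric_cone boundary_plus"
            by (rule cone_first_boundary_plus[of z right_half, OF n z half_range(3,4)[OF zc] r_end[OF False _ cube_coneD(1)[OF zc]]])
          then show ?thesis unfolding H using D2(5)[OF _ t] False by (simp add: snd_eq)
        qed
      qed
      show "K \<ge> 1" by (rule D1(6))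
      show "H (z, 0) = coarse_concat F G z" if "z \<in> cube_cone" for z
        unfolding H coarse_concat_cone_first D1(7)[OF l_in[OF that]] D2(7)[OF r_in[OF that]] by (rule refl)
      show "H (z, t) = coarse_concat F' G' z" if z: "z \<in> cube_cone" "K * (snd z + 1) \<le> t" for z t
        unfolding H coarse_concat_cone_first
        using D1(8)[OF l_in[OF z(1)], of t] D2(8)[OF r_in[OF z(1)], of t] z(2) unfolding snd_eq by simp
    qed
  qed
qed

lemma equiv_coarse_htpy: "equiv coarse_maps (coarse_htpy ::
    (((real ^ 'n::{finite,linorder}) \<times> real \<Rightarrow> 'b \<times> real) \<times> _) set)"
proof (rule equivI)
  show "coarse_htpy \<subseteq> coarse_maps \<times> coarse_maps" unfolding coarse_rel_homotopy_def by blast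
  show "refl_on coarse_maps coarse_htpy" unfolding refl_on_def using coarse_htpy_refl by blast
  show "sym coarse_htpy" unfolding sym_def using coarse_htpy_sym by blast
  show "trans coarse_htpy" unfolding trans_def using coarse_htpy_trans by blast
qed

lemma coarse_htpy_cong:
  fixes F G :: "(real ^ 'n::{finite,linorder}) \<times> real \<Rightarrow> 'b \<times> real"
  assumes F: "F \<in> coarse_maps" and eq: "\<And>z. z \<in> cube_cone \<Longrightarrow> F z = G z"
  shows "(F, G) \<in> coarse_htpy"
proof -
  from iffD1[OF coarse_htpy_iff coarse_htpy_refl[OF F]] obtain K H where "long_homotopy K F F H" by (elim exE)
  then have "long_homotopy K F G H" unfolding long_homotopy_def using eq by simp
  then show ?thesis by (rule coarse_htpyI)
qed

end

section \<open>The comparison isomorphism\<close>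

context approximable_pair
begin

abbreviation classical_group :: "(real ^ 'n::{finite,linorder} \<Rightarrow> 'b) set monoid" where
  "classical_group \<equiv> rel_homotopy_group X X0 x0"

abbreviation coarse_group :: "((real ^ 'n::{finite,linorder}) \<times> real \<Rightarrow> 'b \<times> real) set monoid" where
  "coarse_group \<equiv> coarse_homotopy_group (metric_cone X) (metric_cone X0) (cone_ray x0)"

text \<open>The Lipschitz representative chosen in the definition is homotopic to \<open>u\<close>, so its cone is
  coarsely homotopic to that of \<open>u\<close>.\<close>

lemma cone_comparison_class:
  fixes u :: "real ^ 'n::{finite,linorder} \<Rightarrow> 'b"
  assumes u: "u \<in> rel_maps X X0 x0" and lip: "C-lipschitz_on unit_cube u"
  shows "cone_comparison X X0 x0 (rel_homotopy X X0 x0 `` {u}) = coarse_htpy `` {radial_map u}"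
proof -
  let ?P = "\<lambda>w. w \<in> rel_homotopy X X0 x0 `` {u} \<and> (\<exists>C. C-lipschitz_on unit_cube w)"
  define w where "w = (SOME w. ?P w)"
  have "?P u" using rel_homotopy_refl[OF u] lip by blast
  then have "?P w" unfolding w_def by (rule someI[of ?P u])
  then obtain C' where w: "(u, w) \<in> rel_homotopy X X0 x0" "C'-lipschitz_on unit_cube w" by blast
  have "(radial_map u, radial_map w) \<in> coarse_htpy" by (rule radial_map_homotopic[OF lip w(2,1)])
  then have "coarse_htpy `` {radial_map w} = coarse_htpy `` {radial_map u}"
    using equiv_class_eq[OF equiv_coarse_htpy] by blast
  then show ?thesis unfolding cone_comparison_def w_def .
qed

lemma lipschitz_class:
  fixes U :: "(real ^ 'n::{finite,linorder} \<Rightarrow> 'b) set"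
  assumes "U \<in> rel_maps X X0 x0 // rel_homotopy X X0 x0"
  obtains u C where "U = rel_homotopy X X0 x0 `` {u}" "u \<in> U" "u \<in> rel_maps X X0 x0" "C-lipschitz_on unit_cube u"
proof -
  obtain u where u: "U = rel_homotopy X X0 x0 `` {u}" "u \<in> rel_maps X X0 x0"
    using assms by (rule quotientE)
  obtain v C where v: "(u, v) \<in> rel_homotopy X X0 x0" "C-lipschitz_on unit_cube v"
    using lipschitz_representative[OF u(2)] by metis
  have "U = rel_homotopy X X0 x0 `` {v}" unfolding u(1) by (rule equiv_class_eq[OF equiv_rel_homotopy v(1)])
  moreover have "v \<in> U" unfolding u(1) using v(1) by simp
  moreover have "v \<in> rel_maps X X0 x0" using rel_homotopy_maps[OF v(1)] by blast
  ultimately show thesis using v(2) by (rule that)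
qed

lemma cone_comparison_bij:
  "bij_betw (cone_comparison X X0 x0)
     (carrier (classical_group :: (real ^ 'n::{finite,linorder} \<Rightarrow> 'b) set monoid)) (carrier coarse_group)"
proof (rule bij_betw_imageI)
  let ?A = "carrier (classical_group :: (real ^ 'n::{finite,linorder} \<Rightarrow> 'b) set monoid)"
  have A: "?A = rel_maps X X0 x0 // rel_homotopy X X0 x0" unfolding rel_homotopy_group_def by simp
  show "inj_on (cone_comparison X X0 x0) ?A"
  proof (rule inj_onI)
    fix U V assume UV: "U \<in> ?A" "V \<in> ?A" and eq: "cone_comparison X X0 x0 U = cone_comparison X X0 x0 V"
    obtain u C where u: "U = rel_homotopy X X0 x0 `` {u}" "u \<in> U" "u \<in> rel_maps X X0 x0" "C-lipschitz_on unit_cube u"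
      using UV(1) unfolding A by (rule lipschitz_class)
    obtain v C' where v: "V = rel_homotopy X X0 x0 `` {v}" "v \<in> V" "v \<in> rel_maps X X0 x0" "C'-lipschitz_on unit_cube v"
      using UV(2) unfolding A by (rule lipschitz_class)
    have "coarse_htpy `` {radial_map u} = coarse_htpy `` {radial_map v}"
      using eq unfolding u(1) v(1) cone_comparison_class[OF u(3,4)] cone_comparison_class[OF v(3,4)] .
    then have "(radial_map u, radial_map v) \<in> coarse_htpy"
      by (rule eq_equiv_class[OF _ equiv_coarse_htpy radial_map_coarse[OF v(3,4)]])
    then have "(u, v) \<in> rel_homotopy X X0 x0" by (rule radial_map_reflects_homotopy[OF u(3) v(3)])
    then show "U = V" unfolding u(1) v(1) by (rule equiv_class_eq[OF equiv_rel_homotopy])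
  qed
  show "cone_comparison X X0 x0 ` ?A =
      carrier (coarse_group :: ((real ^ 'n::{finite,linorder}) \<times> real \<Rightarrow> 'b \<times> real) set monoid)"
  proof (intro equalityI subsetI)
    fix W :: "((real ^ 'n::{finite,linorder}) \<times> real \<Rightarrow> 'b \<times> real) set"
    assume "W \<in> cone_comparison X X0 x0 ` ?A"
    then obtain U where U: "U \<in> ?A" "W = cone_comparison X X0 x0 U" by blast
    obtain u C where u: "U = rel_homotopy X X0 x0 `` {u}" "u \<in> U" "u \<in> rel_maps X X0 x0" "C-lipschitz_on unit_cube u"
      using U(1) unfolding A by (rule lipschitz_class)
    show "W \<in> carrier coarse_group"
      unfolding U(2) u(1) cone_comparison_class[OF u(3,4)] coarse_homotopy_group_def partial_object.simps
      by (rule quotientI[OF radial_map_coarse[OF u(3,4)]])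
  next
    fix W :: "((real ^ 'n::{finite,linorder}) \<times> real \<Rightarrow> 'b \<times> real) set"
    assume "W \<in> carrier coarse_group"
    then have "W \<in> coarse_maps // coarse_htpy" unfolding coarse_homotopy_group_def by simp
    then obtain F where F: "W = coarse_htpy `` {F}" "F \<in> coarse_maps" by (rule quotientE)
    obtain u C where u: "u \<in> rel_maps X X0 x0" "C-lipschitz_on unit_cube u" "(F, radial_map u) \<in> coarse_htpy"
      using coarse_map_homotopic_radial_map[OF F(2)] by metis
    have "W = cone_comparison X X0 x0 (rel_homotopy X X0 x0 `` {u})"
      unfolding cone_comparison_class[OF u(1,2)] F(1) by (rule equiv_class_eq[OF equiv_coarse_htpy u(3)])
    moreover have "rel_homotopy X X0 x0 `` {u} \<in> ?A" unfolding A by (rule quotientI[OF u(1)])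
    ultimately show "W \<in> cone_comparison X X0 x0 ` ?A" by (rule image_eqI)
  qed
qed

lemma const_lipschitz: "0-lipschitz_on S (\<lambda>x. x0)"
  by (rule lipschitz_onI) simp_all

lemma const_rel_map: "(\<lambda>x. x0) \<in> rel_maps X X0 x0"
  using rel_const x0_in X0_subset by blast

lemma cone_comparison_one:
  "cone_comparison X X0 x0 (one (classical_group :: (real ^ 'n::{finite,linorder} \<Rightarrow> 'b) set monoid)) = one coarse_group"
proof -
  have ray: "radial_map (\<lambda>x::real ^ 'n::{finite,linorder}. x0) = (\<lambda>z. cone_ray x0 (snd z))"
    unfolding radial_map_base_point cone_ray_def by (rule refl)
  have "cone_comparison X X0 x0 (rel_homotopy X X0 x0 `` {\<lambda>x::real ^ 'n::{finite,linorder}. x0}) =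
      coarse_htpy `` {radial_map (\<lambda>x. x0)}"
    by (rule cone_comparison_class[OF const_rel_map const_lipschitz])
  then show ?thesis
    unfolding rel_homotopy_group_def coarse_homotopy_group_def monoid.simps ray .
qed

lemma rel_concat_lipschitz:
  fixes u v :: "real ^ 'n::{finite,linorder} \<Rightarrow> 'b"
  assumes n: "CARD('n) \<ge> 2" and u: "u \<in> rel_maps X X0 x0" "C-lipschitz_on unit_cube u"
    and v: "v \<in> rel_maps X X0 x0" "C'-lipschitz_on unit_cube v"
  shows "(C * 4 + C' * 4)-lipschitz_on unit_cube (rel_concat u v)"
proof -
  let ?a = "\<lambda>x::real ^ 'n::{finite,linorder}. set_first (min 1 (2 * x $ first_index)) x"
  let ?b = "\<lambda>x::real ^ 'n::{finite,linorder}. set_first (max 0 (2 * x $ first_index - 1)) x"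
  have x1: "0 \<le> x $ first_index" "x $ first_index \<le> 1" if "x \<in> unit_cube" for x :: "real ^ 'n::{finite,linorder}"
    using that unfolding mem_unit_cube by auto
  have ab: "?a x \<in> unit_cube" "?b x \<in> unit_cube" if x: "x \<in> unit_cube" for x
    by (rule set_first_cube[OF x]; use x1[OF x] in simp)+
  have step: "dist (set_first s x) (set_first s' y) \<le> 4 * dist x y"
    if s: "\<bar>s - s'\<bar> \<le> 2 * \<bar>x $ first_index - y $ first_index\<bar>" for s s' and x y :: "real ^ 'n::{finite,linorder}"
  proof -
    let ?d = "(s - s') - (x $ first_index - y $ first_index)"
    have "set_first s x - set_first s' y = (x - y) + ?d *\<^sub>R axis first_index 1"
      unfolding set_first_def axis_def by (auto simp: vec_eq_iff)
    then have "dist (set_first s x) (set_first s' y) \<le> dist x y + \<bar>?d\<bar>"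
      unfolding dist_norm using norm_triangle_ineq[of "x - y" "?d *\<^sub>R axis first_index 1"] by (simp add: norm_axis_1)
    moreover have "\<bar>x $ first_index - y $ first_index\<bar> \<le> dist x y"
      using dist_vec_nth_le[of x first_index y] by (simp add: dist_real_def)
    ultimately show ?thesis using s by argo
  qed
  have mm: "\<bar>min 1 (2 * a) - min 1 (2 * b)\<bar> \<le> 2 * \<bar>a - b\<bar>"
    "\<bar>max 0 (2 * a - 1) - max 0 (2 * b - 1)\<bar> \<le> 2 * \<bar>a - b\<bar>" for a b :: real
    by (auto simp: min_def max_def abs_if)
  have sum: "rel_concat u v x = u (?a x) + v (?b x) - x0" if x: "x \<in> unit_cube" for x
  proof -
    have f: "u (set_first 1 x) = x0" "v (set_first 0 x) = x0"
      using rel_maps_first_face[OF n u(1), of "set_first 1 x"] rel_maps_first_face[OF n v(1), of "set_first 0 x"]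
        set_first_cube[OF x] by (simp_all add: set_first_nth)
    consider "x $ first_index < 1 / 2" | "x $ first_index = 1 / 2" | "1 / 2 < x $ first_index" by linarith
    then show ?thesis
    proof cases
      case 2
      then have e: "2 * x $ first_index = 1" by simp
      show ?thesis using f 2 unfolding rel_concat_set_first e by simp
    qed (simp_all add: rel_concat_set_first min_def max_def f)
  qed
  show ?thesis
  proof (rule lipschitz_onI)
    fix x y :: "real ^ 'n::{finite,linorder}" assume xy: "x \<in> unit_cube" "y \<in> unit_cube"
    have "dist (rel_concat u v x) (rel_concat u v y) \<le> dist (u (?a x)) (u (?a y)) + dist (v (?b x)) (v (?b y))"
      unfolding sum[OF xy(1)] sum[OF xy(2)] using dist_triangle_add[of "u (?a x)" "v (?b x)" "u (?a y)" "v (?b y)"]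
      by (simp add: dist_norm)
    also have "\<dots> \<le> C * dist (?a x) (?a y) + C' * dist (?b x) (?b y)"
      by (intro add_mono lipschitz_onD[OF u(2)] lipschitz_onD[OF v(2)] ab xy)
    also have "\<dots> \<le> C * (4 * dist x y) + C' * (4 * dist x y)"
      by (intro add_mono mult_left_mono step mm lipschitz_on_nonneg[OF u(2)] lipschitz_on_nonneg[OF v(2)])
    finally show "dist (rel_concat u v x) (rel_concat u v y) \<le> (C * 4 + C' * 4) * dist x y"
      by (simp add: algebra_simps)
  qed (use lipschitz_on_nonneg[OF u(2)] lipschitz_on_nonneg[OF v(2)] in simp)
qed

lemma radial_map_rel_concat:
  fixes u v :: "real ^ 'n::{finite,linorder} \<Rightarrow> 'b"
  assumes z: "z \<in> cube_cone"
  shows "radial_map (rel_concat u v) z = coarse_concat (radial_map u) (radial_map v) z"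
proof (cases "snd z = 0")
  case True
  then show ?thesis by (simp add: radial_map_base_point coarse_concat_set_first)
next
  case False
  then have h: "0 < snd z" using cube_coneD(1)[OF z] by simp
  have sf: "base_point (set_first s (fst z), snd z) = set_first (s / snd z) (base_point z)" for s
    unfolding base_point_def set_first_def by (simp add: vec_eq_iff divide_inverse mult.commute)
  have b1: "base_point z $ first_index = fst z $ first_index / snd z"
    unfolding base_point_def by (simp add: divide_inverse mult.commute)
  have c: "fst z $ first_index / snd z \<le> 1 / 2 \<longleftrightarrow> fst z $ first_index \<le> snd z / 2"
    using h by (simp add: divide_simps mult.commute)
  have e: "2 * (fst z $ first_index / snd z) = 2 * fst z $ first_index / snd z"
    "2 * fst z $ first_index / snd z - 1 = (2 * fst z $ first_index - snd z) / snd z"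
    using h by (simp_all add: divide_simps)
  show ?thesis
    unfolding radial_map_base_point coarse_concat_set_first rel_concat_set_first sf b1 c e snd_conv
    by (cases "fst z $ first_index \<le> snd z / 2") (simp_all only: if_True if_False)
qed

lemma cone_comparison_mult:
  fixes U V :: "(real ^ 'n::{finite,linorder} \<Rightarrow> 'b) set"
  assumes n: "CARD('n) \<ge> 2" and UV: "U \<in> carrier classical_group" "V \<in> carrier classical_group"
  shows "cone_comparison X X0 x0 (U \<otimes>\<^bsub>classical_group\<^esub> V) =
    cone_comparison X X0 x0 U \<otimes>\<^bsub>coarse_group\<^esub> cone_comparison X X0 x0 V"
proof -
  have A: "carrier classical_group = (rel_maps X X0 x0 // rel_homotopy X X0 x0 :: (real ^ 'n::{finite,linorder} \<Rightarrow> 'b) set set)"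
    unfolding rel_homotopy_group_def by simp
  obtain u C where u: "U = rel_homotopy X X0 x0 `` {u}" "u \<in> U" "u \<in> rel_maps X X0 x0" "C-lipschitz_on unit_cube u"
    using UV(1) unfolding A by (rule lipschitz_class)
  obtain v C' where v: "V = rel_homotopy X X0 x0 `` {v}" "v \<in> V" "v \<in> rel_maps X X0 x0" "C'-lipschitz_on unit_cube v"
    using UV(2) unfolding A by (rule lipschitz_class)
  have uv: "rel_concat u v \<in> rel_maps X X0 x0"
    using rel_homotopy_maps[OF rel_concat_homotopic[OF n rel_homotopy_refl[OF u(3)] rel_homotopy_refl[OF v(3)]]] by blast
  have lip: "(C * 4 + C' * 4)-lipschitz_on unit_cube (rel_concat u v)"
    by (rule rel_concat_lipschitz[OF n u(3,4) v(3,4)])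
  have m: "U \<otimes>\<^bsub>classical_group\<^esub> V = rel_homotopy X X0 x0 `` {rel_concat u v}"
    unfolding rel_homotopy_group_def monoid.simps u(1) v(1)
    by (rule quotient_operation[OF equiv_rel_homotopy u(3) v(3)]) (rule rel_concat_homotopic[OF n])
  have "coarse_htpy `` {radial_map u} \<otimes>\<^bsub>coarse_group\<^esub> coarse_htpy `` {radial_map v}
      = coarse_htpy `` {coarse_concat (radial_map u) (radial_map v)}"
    unfolding coarse_homotopy_group_def monoid.simps
    by (rule quotient_operation[OF equiv_coarse_htpy radial_map_coarse[OF u(3,4)] radial_map_coarse[OF v(3,4)]])
      (rule coarse_concat_htpy[OF n])
  also have "\<dots> = coarse_htpy `` {radial_map (rel_concat u v)}"
    by (rule equiv_class_eq[OF equiv_coarse_htpy, symmetric])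
      (rule coarse_htpy_cong[OF radial_map_coarse[OF uv lip] radial_map_rel_concat])
  finally show ?thesis
    unfolding m cone_comparison_class[OF uv lip]
    unfolding u(1) v(1) cone_comparison_class[OF u(3,4)] cone_comparison_class[OF v(3,4)] by (rule sym)
qed

theorem cone_comparison_iso:
  assumes n: "CARD('n::{finite,linorder}) \<ge> 2"
  shows "group (classical_group :: (real ^ 'n::{finite,linorder} \<Rightarrow> 'b) set monoid)"
    "group (coarse_group :: ((real ^ 'n::{finite,linorder}) \<times> real \<Rightarrow> 'b \<times> real) set monoid)"
    "cone_comparison X X0 x0 \<in> iso (classical_group :: (real ^ 'n::{finite,linorder} \<Rightarrow> 'b) set monoid) coarse_group"
proof -
  let ?G = "classical_group :: (real ^ 'n::{finite,linorder} \<Rightarrow> 'b) set monoid"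
  let ?H = "coarse_group :: ((real ^ 'n::{finite,linorder}) \<times> real \<Rightarrow> 'b \<times> real) set monoid"
  let ?f = "cone_comparison X X0 x0 :: (real ^ 'n::{finite,linorder} \<Rightarrow> 'b) set \<Rightarrow> _"
  show G: "group ?G"
    by (rule rel_homotopy_group_group[OF n]) (use x0_in X0_subset in blast)+
  show iso: "?f \<in> iso ?G ?H"
    unfolding iso_def hom_def mem_Collect_eq
  proof (intro conjI ballI)
    show "?f \<in> carrier ?G \<rightarrow> carrier ?H" using bij_betwE[OF cone_comparison_bij] by blast
    show "?f (U \<otimes>\<^bsub>?G\<^esub> V) = ?f U \<otimes>\<^bsub>?H\<^esub> ?f V" if "U \<in> carrier ?G" "V \<in> carrier ?G" for U V
      by (rule cone_comparison_mult[OF n that])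
  qed (rule cone_comparison_bij)
  have "group (?H \<lparr> one := ?f \<one>\<^bsub>?G\<^esub> \<rparr>)" by (rule group.iso_imp_img_group[OF G iso])
  then show "group ?H" unfolding cone_comparison_one by simp
qed

end

section \<open>Piecewise linearly embedded complexes\<close>

text \<open>\<open>S\<close> lies in a simplex \<open>T'\<close> of \<open>K\<close>, which \<open>T\<close> meets in a face; cutting with the convex set \<open>S\<close>
  turns this face of \<open>T'\<close> into a face of \<open>S\<close>. Consequently a subcomplex of \<open>K\<close> is covered by the
  simplices of the subdivision that it contains, and a vertex of \<open>K\<close> is a vertex of the
  subdivision.\<close>

lemma subdivision_Int_face:
  assumes K: "simplicial_complex K" and sub: "subdivision_of K' K" and S: "S \<in> K'" and T: "T \<in> K"
  shows "S \<inter> T \<in> K'"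
proof -
  have K': "simplicial_complex K'" using sub unfolding subdivision_of_def by blast
  obtain T' where T': "T' \<in> K" "S \<subseteq> T'" using sub S unfolding subdivision_of_def by blast
  have "convex S" using K' S unfolding simplicial_complex_def by (meson convex_simplex)
  moreover have "(T' \<inter> T) face_of T'" using K T T'(1) unfolding simplicial_complex_def by blast
  ultimately have "(T' \<inter> T \<inter> S) face_of (T' \<inter> S)" by (intro face_of_slice)
  moreover have "T' \<inter> T \<inter> S = S \<inter> T" "T' \<inter> S = S" using T'(2) by blast+
  ultimately have "(S \<inter> T) face_of S" by simp
  then show ?thesis using K' S unfolding simplicial_complex_def by blast
qed

lemma pl_embedding_cells:
  assumes K: "simplicial_complex K" and e: "pl_embedding K e"
  obtains K' where "subdivision_of K' K" "finite K'" "inj_on e (\<Union>K')"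
    "\<And>S. S \<in> K' \<Longrightarrow> compact (e ` S)" "\<And>S. S \<in> K' \<Longrightarrow> convex (e ` S)"
    "\<And>S T. S \<in> K' \<Longrightarrow> T \<in> K' \<Longrightarrow> S \<inter> T \<in> K'"
proof -
  obtain K' where sub: "subdivision_of K' K" and aff: "\<And>S. S \<in> K' \<Longrightarrow> affine_map_on S e"
    and emb: "embedding_map (top_of_set (\<Union>K)) euclidean e"
    using e unfolding pl_embedding_def by blast
  have K': "simplicial_complex K'" and un: "\<Union>K' = \<Union>K" using sub unfolding subdivision_of_def by blast+
  have "inj_on e (topspace (top_of_set (\<Union>K)))"
    using emb unfolding embedding_map_def by (rule homeomorphic_imp_injective_map)
  then have inj: "inj_on e (\<Union>K')" unfolding un by simp
  have cells: "compact (e ` S) \<and> convex (e ` S)" if S: "S \<in> K'" for S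
  proof -
    obtain n where n: "n simplex S" using K' S unfolding simplicial_complex_def by blast
    obtain l b where l: "linear l" "\<And>x. x \<in> S \<Longrightarrow> e x = l x + b" using aff[OF S] unfolding affine_map_on_def by blast
    have eq: "e ` S = (\<lambda>y. b + y) ` (l ` S)" unfolding image_image by (rule image_cong) (simp_all add: l(2) add.commute)
    have "compact (l ` S)"
      by (rule compact_continuous_image[OF linear_continuous_on compact_simplex[OF n]])
        (simp add: l(1) linear_conv_bounded_linear[symmetric])
    then have "compact (e ` S)" unfolding eq by (rule compact_translation)
    moreover have "convex (e ` S)"
      unfolding eq by (intro convex_translation convex_linear_image[OF l(1)] convex_simplex[OF n])
    ultimately show ?thesis by blast
  qed
  have int: "S \<inter> T \<in> K'" if "S \<in> K'" "T \<in> K'" for S T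
    using K' that unfolding simplicial_complex_def by blast
  have fin: "finite K'" using K' unfolding simplicial_complex_def by blast
  show thesis by (rule that[OF sub fin inj]) (use cells int in blast)+
qed

text \<open>The cells are the images of the simplices on which \<open>e\<close> is affine: they are convex, and since
  \<open>e\<close> is injective, their intersections are again cells.\<close>

lemma pl_pair_approximable:
  fixes K L :: "'a::euclidean_space set set" and e :: "'a \<Rightarrow> 'b::euclidean_space"
  assumes K: "simplicial_complex K" and LK: "L \<subseteq> K" and v: "{v} \<in> L" and e: "pl_embedding K e"
  shows "\<exists>\<epsilon> M \<rho>. approximable_pair (e ` \<Union>K) (e ` \<Union>L) (e v) \<epsilon> M \<rho>"
proof -
  obtain K' where sub: "subdivision_of K' K" and fin: "finite K'" and inj: "inj_on e (\<Union>K')"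
    and cpt: "\<And>S. S \<in> K' \<Longrightarrow> compact (e ` S)" and cvx: "\<And>S. S \<in> K' \<Longrightarrow> convex (e ` S)"
    and int: "\<And>S T. S \<in> K' \<Longrightarrow> T \<in> K' \<Longrightarrow> S \<inter> T \<in> K'"
    by (rule pl_embedding_cells[OF K e]) (rule that; assumption)
  have un: "\<Union>K' = \<Union>K" using sub unfolding subdivision_of_def by blast
  define \<S> where "\<S> = (\<lambda>S. e ` S) ` K'"
  have US: "\<Union>\<S> = e ` \<Union>K" unfolding \<S>_def un[symmetric] by blast
  have Sfin: "finite \<S>" unfolding \<S>_def using fin by simp
  have Scpt: "compact S" and Scvx: "convex S" if "S \<in> \<S>" for S
    using that cpt cvx unfolding \<S>_def by blast+
  have Sint: "S \<inter> T \<in> \<S>" if ST: "S \<in> \<S>" "T \<in> \<S>" for S T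
  proof -
    obtain S' T' where S': "S' \<in> K'" "S = e ` S'" "T' \<in> K'" "T = e ` T'" using ST unfolding \<S>_def by blast
    have "e ` (S' \<inter> T') = S \<inter> T"
      unfolding S'(2,4) by (rule inj_on_image_Int[OF inj]) (use S' in blast)+
    moreover have "e ` (S' \<inter> T') \<in> \<S>" unfolding \<S>_def by (rule imageI[OF int[OF S'(1,3)]])
    ultimately show ?thesis by simp
  qed
  obtain \<epsilon> M \<rho> where \<rho>: "\<epsilon> > 0" "M-lipschitz_on {y. \<exists>x\<in>\<Union>\<S>. dist x y < \<epsilon>} \<rho>"
    "\<And>S x y. S \<in> \<S> \<Longrightarrow> x \<in> S \<Longrightarrow> dist x y < \<epsilon> \<Longrightarrow> \<rho> y \<in> S"
    by (rule neighbourhood_cell_map[OF Sfin Scpt Scvx Sint]) (assumption | (rule that; assumption))+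
  have seg: "closed_segment x (\<rho> y) \<subseteq> S" if "S \<in> \<S>" "x \<in> S" "dist x y < \<epsilon>" for S x y
    by (rule closed_segment_subset[OF that(2) \<rho>(3)[OF that] Scvx[OF that(1)]])
  have cell0: "\<exists>S\<in>K'. x \<in> S \<and> S \<subseteq> T" if x: "x \<in> T" "T \<in> K" for x T
  proof -
    obtain S where S: "S \<in> K'" "x \<in> S" using x un by blast
    have "S \<inter> T \<in> K'" by (rule subdivision_Int_face[OF K sub S(1) x(2)])
    then show ?thesis using S x by blast
  qed
  have "approximable_pair (e ` \<Union>K) (e ` \<Union>L) (e v) \<epsilon> M \<rho>"
  proof unfold_locales
    show "bounded (e ` \<Union>K)" unfolding US[symmetric] using Sfin Scpt by (intro compact_imp_bounded compact_Union) auto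
    show "e ` \<Union>L \<subseteq> e ` \<Union>K" using LK by blast
    show "e v \<in> e ` \<Union>L" using v by blast
    show "\<epsilon> > 0" by (rule \<rho>(1))
    show "M-lipschitz_on {y. \<exists>x\<in>e ` \<Union>K. dist x y < \<epsilon>} \<rho>" using \<rho>(2) unfolding US .
    show "closed_segment x (\<rho> y) \<subseteq> e ` \<Union>K" if x: "x \<in> e ` \<Union>K" and d: "dist x y < \<epsilon>" for x y
    proof -
      obtain S where S: "S \<in> \<S>" "x \<in> S" using x unfolding US[symmetric] by blast
      show ?thesis using seg[OF S d] S(1) unfolding US[symmetric] by blast
    qed
    show "closed_segment x (\<rho> y) \<subseteq> e ` \<Union>L" if x: "x \<in> e ` \<Union>L" and d: "dist x y < \<epsilon>" for x y
    proof -
      obtain a T where a: "x = e a" "a \<in> T" "T \<in> L" using x by blast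
      obtain S where S: "S \<in> K'" "a \<in> S" "S \<subseteq> T" using cell0[OF a(2) subsetD[OF LK a(3)]] by blast
      have "closed_segment x (\<rho> y) \<subseteq> e ` S"
        by (rule seg[OF _ _ d]) (use S a in \<open>auto simp: \<S>_def\<close>)
      then show ?thesis using S(3) a(3) by blast
    qed
    show "\<rho> y = e v" if d: "dist (e v) y < \<epsilon>" for y
    proof -
      obtain S where S: "S \<in> K'" "v \<in> S" "S \<subseteq> {v}" using cell0[of v "{v}"] v LK by blast
      then have "S = {v}" by blast
      then have "{e v} \<in> \<S>" using S(1) unfolding \<S>_def by force
      from \<rho>(3)[OF this _ d] show ?thesis by simp
    qed
  qed
  then show ?thesis by blast
qed

theorem theorem5p6:
  fixes K L :: "'a::euclidean_space set set" and v :: 'a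
    and e :: "'a \<Rightarrow> 'b::euclidean_space"
    and X X0 :: "'b set" and x0 :: 'b
    and G :: "(real ^ 'n::{finite,linorder} \<Rightarrow> 'b) set monoid"
    and H :: "((real ^ 'n::{finite,linorder}) \<times> real \<Rightarrow> 'b \<times> real) set monoid"
    and \<Psi> :: "(real ^ 'n::{finite,linorder} \<Rightarrow> 'b) set \<Rightarrow>
      ((real ^ 'n::{finite,linorder}) \<times> real \<Rightarrow> 'b \<times> real) set"
  assumes "simplicial_complex K"
    and "simplicial_complex L" and "L \<subseteq> K"
    and "{v} \<in> L"
    and "pl_embedding K e"
    and "X = e ` \<Union>K" and "X0 = e ` \<Union>L" and "x0 = e v"
    and "G = rel_homotopy_group X X0 x0"
    and "H = coarse_homotopy_group (metric_cone X) (metric_cone X0) (cone_ray x0)"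
    and "\<Psi> = cone_comparison X X0 x0"
  shows
    "(\<forall>U\<in>carrier G. \<exists>u\<in>U. \<exists>C. C-lipschitz_on unit_cube u) \<and>
     (\<forall>u\<in>rel_maps X X0 x0. (\<exists>C. C-lipschitz_on unit_cube u) \<longrightarrow>
        \<Psi> (rel_homotopy X X0 x0 `` {u}) =
          coarse_rel_homotopy (metric_cone X) (metric_cone X0) (cone_ray x0) `` {radial_map u}) \<and>
     (CARD('n) = 1 \<longrightarrow> bij_betw \<Psi> (carrier G) (carrier H) \<and> \<Psi> (one G) = one H) \<and>
     (CARD('n) \<ge> 2 \<longrightarrow> group G \<and> group H \<and> \<Psi> \<in> iso G H)"
proof -
  obtain \<epsilon> M \<rho> where "approximable_pair X X0 x0 \<epsilon> M \<rho>"
    using pl_pair_approximable[OF assms(1,3,4,5)] unfolding assms(6-8) by blast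
  then interpret approximable_pair X X0 x0 \<epsilon> M \<rho> .
  show ?thesis
  proof (intro conjI ballI impI)
    fix U assume "U \<in> carrier G"
    then have "U \<in> rel_maps X X0 x0 // rel_homotopy X X0 x0"
      unfolding assms(9) rel_homotopy_group_def by simp
    then obtain u C where "U = rel_homotopy X X0 x0 `` {u}" "u \<in> U" "u \<in> rel_maps X X0 x0" "C-lipschitz_on unit_cube u"
      by (rule lipschitz_class)
    then show "\<exists>u\<in>U. \<exists>C. C-lipschitz_on unit_cube u" by blast
  next
    fix u :: "real ^ 'n::{finite,linorder} \<Rightarrow> 'b"
    assume u: "u \<in> rel_maps X X0 x0" "\<exists>C. C-lipschitz_on unit_cube u"
    then obtain C where "C-lipschitz_on unit_cube u" by blast
    then show "\<Psi> (rel_homotopy X X0 x0 `` {u}) = coarse_htpy `` {radial_map u}"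
      unfolding assms(11) by (rule cone_comparison_class[OF u(1)])
  qed (simp_all only: assms(9-11) cone_comparison_bij cone_comparison_one cone_comparison_iso)
qed

end
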